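(* Let $p$ be a prime. Assume that for every positive integer $n$ we are given subsets $\sigma_{n,1} \subseteq \sigma_{n,2} \subseteq \cdots \subseteq \sigma_{n,n} \subseteq [n]$. Let $X_n \in \mathrm{M}_n(\mathbb{Z}_p)$ be the Haar-random matrix over $\mathbb{Z}_p$ supported on $\Sigma_n = (\sigma_{n,1}, \sigma_{n,2}, \ldots, \sigma_{n,n})$. Then $\mathrm{cok}(X_n)$ converges to CL if and only if $\mathrm{cok}(X_n)$ converges to CL in rank $0$.
   Context: $[n] = \{1,\ldots,n\}$; $\mathbb{Z}_p$ is the ring of $p$-adic integers, $\mathbb{F}_p$ the field with $p$ elements, and $\mathrm{cok}(A) = \mathbb{Z}_p^n / A\mathbb{Z}_p^n$ for $A \in \mathrm{M}_n(\mathbb{Z}_p)$. A $\mathbb{Z}_p$-valued random variable is Haar-random if it is distributed according to the Haar probability measure on $\mathbb{Z}_p$. For subsets $\sigma_{n,1},\ldots,\sigma_{n,n}$ of $[n]$ and $\Sigma_n = (\sigma_{n,1},\ldots,\sigma_{n,n})$, the Haar-random matrix supported on $\Sigma_n$ is the random matrix $X_n \in \mathrm{M}_n(\mathbb{Z}_p)$ whose entries $(X_n)_{i,j}$ (row $i$, column $j$) with $i \in \sigma_{n,j}$ are Haar-random and independent, and $(X_n)_{i,j} = 0$ whenever $i \notin \sigma_{n,j}$. For a finite abelian $p$-group $G$ put $\mathrm{CL}(G) = \frac{1}{\#\mathrm{Aut}(G)} \prod_{i=1}^{\infty}(1-p^{-i})$, and for an integer $m \ge 0$ put $\mathrm{cl}(m)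 = p^{-m^2}\prod_{i=1}^{m}(1-p^{-i})^{-2}\prod_{i=1}^{\infty}(1-p^{-i})$. A sequence $(Y_n)_{n\ge1}$ of random finitely generated $\mathbb{Z}_p$-modules converges to CL if $\lim_{n\to\infty}\mathbb{P}(Y_n \cong G) = \mathrm{CL}(G)$ for every finite abelian $p$-group $G$. It converges to CL in rank $m$ if $\lim_{n\to\infty}\mathbb{P}(Y_n/pY_n \cong \mathbb{F}_p^m) = \mathrm{cl}(m)$. *)

theory Defs
  imports
    "HOL-Probability.Probability"
    "HOL-Number_Theory.Residues"
    "HOL-Algebra.Product_Groups"
    "HOL-Algebra.Bij"
begin

subsection \<open>The ring of $p$-adic integers\<close>

text \<open>
  $\mathbb{Z}_p = \varprojlim_k \mathbb{Z}/p^k$: a $p$-adic integer is the sequence of its residues,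
  the \<open>k\<close>-th one being represented in \<open>{0..<p^k}\<close>.
\<close>

type_synonym padic = "nat \<Rightarrow> int"

definition Zp :: "nat \<Rightarrow> padic ring" where
  "Zp p = \<lparr>carrier = {x. \<forall>k. x k \<in> {0..<int p ^ k} \<and> x (Suc k) mod int p ^ k = x k},
           monoid.mult = (\<lambda>x y k. (x k * y k) mod int p ^ k),
           one = (\<lambda>k. 1 mod int p ^ k),
           zero = (\<lambda>k. 0),
           add = (\<lambda>x y k. (x k + y k) mod int p ^ k)\<rparr>"

lemma Zp_cring:
  assumes "p > 0"
  shows "cring (Zp p)"
proof (intro cringI abelian_groupI comm_monoidI)
  fix x assume x: "x \<in> carrier (Zp p)"
  let ?y = "\<lambda>k. (- x k) mod int p ^ k"
  have "?y (Suc k) mod int p ^ k = ?y k" for k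
  proof -
    have "?y (Suc k) mod int p ^ k = (- x (Suc k)) mod int p ^ k"
      by (simp add: mod_mod_cancel)
    also have "\<dots> = (- (x (Suc k) mod int p ^ k)) mod int p ^ k"
      by (simp add: mod_minus_eq)
    finally show ?thesis using x by (simp add: Zp_def)
  qed
  then have "?y \<in> carrier (Zp p)"
    using assms by (simp add: Zp_def)
  moreover have "?y \<oplus>\<^bsub>Zp p\<^esub> x = \<zero>\<^bsub>Zp p\<^esub>"
    by (simp add: Zp_def fun_eq_iff mod_add_left_eq)
  ultimately show "\<exists>y\<in>carrier (Zp p). y \<oplus>\<^bsub>Zp p\<^esub> x = \<zero>\<^bsub>Zp p\<^esub>" by blast
next
  fix x y assume xy: "x \<in> carrier (Zp p)" "y \<in> carrier (Zp p)"
  have mods: "x (Suc k) mod int p ^ k = x k" "y (Suc k) mod int p ^ k = y k" for k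
    using xy by (simp_all add: Zp_def)
  have "(x (Suc k) * y (Suc k)) mod int p ^ Suc k mod int p ^ k = (x k * y k) mod int p ^ k"
    "(x (Suc k) + y (Suc k)) mod int p ^ Suc k mod int p ^ k = (x k + y k) mod int p ^ k" for k
    using mod_mult_eq[of "x (Suc k)" "int p ^ k" "y (Suc k)"]
      mod_add_eq[of "x (Suc k)" "int p ^ k" "y (Suc k)"]
    by (simp_all add: mods mod_mod_cancel)
  then show "x \<otimes>\<^bsub>Zp p\<^esub> y \<in> carrier (Zp p)" "x \<oplus>\<^bsub>Zp p\<^esub> y \<in> carrier (Zp p)"
    using assms by (simp_all add: Zp_def)
next
  have "1 mod int p ^ Suc k mod int p ^ k = 1 mod int p ^ k" for k
    by (simp add: mod_mod_cancel)
  then show "\<one>\<^bsub>Zp p\<^esub> \<in> carrier (Zp p)" "\<zero>\<^bsub>Zp p\<^esub> \<in> carrier (Zp p)"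
    using assms by (simp_all add: Zp_def)
next
  fix x y z
  show "(x \<otimes>\<^bsub>Zp p\<^esub> y) \<otimes>\<^bsub>Zp p\<^esub> z = x \<otimes>\<^bsub>Zp p\<^esub> (y \<otimes>\<^bsub>Zp p\<^esub> z)"
    by (simp add: Zp_def mod_mult_left_eq mod_mult_right_eq mult.assoc)
  show "(x \<oplus>\<^bsub>Zp p\<^esub> y) \<oplus>\<^bsub>Zp p\<^esub> z = x \<oplus>\<^bsub>Zp p\<^esub> (y \<oplus>\<^bsub>Zp p\<^esub> z)"
    by (simp add: Zp_def mod_add_left_eq mod_add_right_eq add.assoc)
  show "x \<otimes>\<^bsub>Zp p\<^esub> y = y \<otimes>\<^bsub>Zp p\<^esub> x" "x \<oplus>\<^bsub>Zp p\<^esub> y = y \<oplus>\<^bsub>Zp p\<^esub> x"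
    by (simp_all add: Zp_def mult.commute add.commute)
  show "(x \<oplus>\<^bsub>Zp p\<^esub> y) \<otimes>\<^bsub>Zp p\<^esub> z = x \<otimes>\<^bsub>Zp p\<^esub> z \<oplus>\<^bsub>Zp p\<^esub> y \<otimes>\<^bsub>Zp p\<^esub> z"
    by (simp add: Zp_def mod_mult_left_eq mod_add_eq distrib_right)
next
  fix x assume "x \<in> carrier (Zp p)"
  then have "x k mod int p ^ k = x k" for k
    by (simp add: Zp_def)
  then show "\<one>\<^bsub>Zp p\<^esub> \<otimes>\<^bsub>Zp p\<^esub> x = x" "\<zero>\<^bsub>Zp p\<^esub> \<oplus>\<^bsub>Zp p\<^esub> x = x"
    by (simp_all add: Zp_def mod_mult_left_eq fun_eq_iff)
qed

text \<open>
  The $p$-adic topology is the subspace topology of the product topology on \<open>nat \<Rightarrow> int\<close>, with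
  \<open>int\<close> discrete.
\<close>

definition borel_Zp :: "nat \<Rightarrow> padic measure" where
  "borel_Zp p = restrict_space borel (carrier (Zp p))"

definition haar_prob_measure :: "nat \<Rightarrow> padic measure \<Rightarrow> bool" where
  "haar_prob_measure p \<mu> \<longleftrightarrow>
     prob_space \<mu> \<and> sets \<mu> = sets (borel_Zp p) \<and>
     (\<forall>a\<in>carrier (Zp p). \<forall>A\<in>sets \<mu>. emeasure \<mu> ((\<lambda>x. a \<oplus>\<^bsub>Zp p\<^esub> x) ` A) = emeasure \<mu> A)"

definition haar_random :: "nat \<Rightarrow> 'w measure \<Rightarrow> ('w \<Rightarrow> padic) \<Rightarrow> bool" where
  "haar_random p M x \<longleftrightarrow>
     x \<in> measurable M (borel_Zp p) \<and> haar_prob_measure p (distr M (borel_Zp p) x)"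


subsection \<open>Matrices and cokernels\<close>

text \<open>An \<open>n \<times> n\<close> matrix is a function of the row and the column, of which only the values at
  indices in \<open>{1..n}\<close> matter.\<close>

type_synonym padic_matrix = "nat \<Rightarrow> nat \<Rightarrow> padic"

definition Zp_pow :: "nat \<Rightarrow> nat \<Rightarrow> (nat \<Rightarrow> padic) monoid" where
  "Zp_pow p n = product_group {1..n} (\<lambda>_. add_monoid (Zp p))"

definition mat_image :: "nat \<Rightarrow> nat \<Rightarrow> padic_matrix \<Rightarrow> (nat \<Rightarrow> padic) set" where
  "mat_image p n A =
     (\<lambda>v. \<lambda>i\<in>{1..n}. \<Oplus>\<^bsub>Zp p\<^esub>j\<in>{1..n}. A i j \<otimes>\<^bsub>Zp p\<^esub> v j) ` carrier (Zp_pow p n)"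

definition cok :: "nat \<Rightarrow> nat \<Rightarrow> padic_matrix \<Rightarrow> (nat \<Rightarrow> padic) set monoid" where
  "cok p n A = Zp_pow p n Mod mat_image p n A"

definition haar_random_matrix ::
  "nat \<Rightarrow> nat \<Rightarrow> (nat \<Rightarrow> nat set) \<Rightarrow> 'w measure \<Rightarrow> ('w \<Rightarrow> padic_matrix) \<Rightarrow> bool" where
  "haar_random_matrix p n \<sigma> M X \<longleftrightarrow>
     (\<forall>j\<in>{1..n}. \<forall>i\<in>\<sigma> j. haar_random p M (\<lambda>w. X w i j)) \<and>
     prob_space.indep_vars M (\<lambda>_. borel_Zp p) (\<lambda>(i, j) w. X w i j)
       {(i, j). j \<in> {1..n} \<and> i \<in> \<sigma> j} \<and>
     (\<forall>j\<in>{1..n}. \<forall>i\<in>{1..n} - \<sigma> j. \<forall>w\<in>space M. X w i j = \<zero>\<^bsub>Zp p\<^esub>)"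


subsection \<open>Convergence to the Cohen--Lenstra distribution\<close>

definition finite_abelian_p_group :: "nat \<Rightarrow> 'g monoid \<Rightarrow> bool" where
  "finite_abelian_p_group p G \<longleftrightarrow> comm_group G \<and> finite (carrier G) \<and> (\<exists>k. order G = p ^ k)"

text \<open>Automorphisms have to be counted by \<^const>\<open>auto\<close>, whose elements are extensional, and
  not by \<open>iso G G\<close>, whose elements are arbitrary outside the carrier.\<close>

definition CL :: "nat \<Rightarrow> 'g monoid \<Rightarrow> real" where
  "CL p G = 1 / real (card (auto G)) * (\<Prod>i. 1 - 1 / real p ^ Suc i)"

definition cl :: "nat \<Rightarrow> nat \<Rightarrow> real" where
  "cl p m = 1 / real p ^ (m\<^sup>2) * (\<Prod>i=1..m. 1 / (1 - 1 / real p ^ i)\<^sup>2)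
              * (\<Prod>i. 1 - 1 / real p ^ Suc i)"

text \<open>
  Random finitely generated $\mathbb{Z}_p$-modules enter only through their (multiplicatively
  written) additive groups: the comparisons are with finite abelian \<open>p\<close>-groups, $pY$ is the
  set of \<open>p\<close>-fold sums, and every group isomorphism between $\mathbb{Z}_p$-modules one of which
  is a finite \<open>p\<close>-group is $\mathbb{Z}_p$-linear.  The finite abelian \<open>p\<close>-groups range over those
  with carrier in \<open>nat\<close>, among which every isomorphism class is represented; see
  \<open>converges_to_CL_any_type\<close> below.
\<close>

definition converges_to_CL ::
  "nat \<Rightarrow> (nat \<Rightarrow> 'w measure) \<Rightarrow> (nat \<Rightarrow> 'w \<Rightarrow> 'y monoid) \<Rightarrow> bool" where
  "converges_to_CL p M Y \<longleftrightarrow>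
     (\<forall>G :: nat monoid. finite_abelian_p_group p G \<longrightarrow>
        (\<lambda>n. measure (M n) {w \<in> space (M n). Y n w \<cong> G}) \<longlonglongrightarrow> CL p G)"

definition mod_p :: "nat \<Rightarrow> 'y monoid \<Rightarrow> 'y set monoid" where
  "mod_p p Y = Y Mod ((\<lambda>y. y [^]\<^bsub>Y\<^esub> p) ` carrier Y)"

definition Fp_pow :: "nat \<Rightarrow> nat \<Rightarrow> (nat \<Rightarrow> int) monoid" where
  "Fp_pow p m = product_group {1..m} (\<lambda>_. add_monoid (residue_ring (int p)))"

definition converges_to_CL_in_rank ::
  "nat \<Rightarrow> nat \<Rightarrow> (nat \<Rightarrow> 'w measure) \<Rightarrow> (nat \<Rightarrow> 'w \<Rightarrow> 'y monoid) \<Rightarrow> bool" where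
  "converges_to_CL_in_rank p m M Y \<longleftrightarrow>
     (\<lambda>n. measure (M n) {w \<in> space (M n). mod_p p (Y n w) \<cong> Fp_pow p m}) \<longlonglongrightarrow> cl p m"

lemma card_auto_cong:
  assumes "group G" "group H" "G \<cong> H"
  shows "card (auto G) = card (auto H)"
proof -
  obtain h where h: "h \<in> hom G H" and bij: "bij_betw h (carrier G) (carrier H)"
    using assms(3) by (auto simp: is_iso_def iso_def)
  define k where "k = inv_into (carrier G) h"
  have "k \<in> iso H G"
    using group.iso_set_sym[OF assms(1)] h bij by (auto simp: iso_def k_def)
  then have k: "k \<in> hom H G" and bijk: "bij_betw k (carrier H) (carrier G)"
    by (auto simp: iso_def)
  have hk: "h (k y) = y" "k y \<in> carrier G" if "y \<in> carrier H" for y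
    using that bij bijk by (auto simp: k_def bij_betw_def f_inv_into_f)
  have kh: "k (h x) = x" "h x \<in> carrier H" if "x \<in> carrier G" for x
    using that bij by (auto simp: k_def bij_betw_def)
  define \<Phi> where "\<Phi> f = (\<lambda>y\<in>carrier H. h (f (k y)))" for f
  define \<Psi> where "\<Psi> f = (\<lambda>x\<in>carrier G. k (f (h x)))" for f
  have \<Phi>: "\<Phi> f \<in> auto H" if f: "f \<in> auto G" for f
  proof -
    have fG: "f \<in> hom G G" "bij_betw f (carrier G) (carrier G)"
      using f by (auto simp: auto_def Bij_def)
    have "(h \<circ> (f \<circ> k)) \<in> hom H H"
      by (intro hom_compose[of _ H G] k fG h)
    moreover have "bij_betw (h \<circ> (f \<circ> k)) (carrier H) (carrier H)"
      by (intro bij_betw_trans[of _ _ "carrier G"] bijk bij fG(2))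
    moreover have eq: "(h \<circ> (f \<circ> k)) x = \<Phi> f x" if "x \<in> carrier H" for x
      using that by (simp add: \<Phi>_def)
    ultimately have "\<Phi> f \<in> hom H H" "bij_betw (\<Phi> f) (carrier H) (carrier H)"
      using group.hom_restrict[OF assms(2), of "h \<circ> (f \<circ> k)" H "\<Phi> f"]
        bij_betw_cong[of "carrier H" "h \<circ> (f \<circ> k)" "\<Phi> f" "carrier H"] by simp_all
    then show ?thesis
      by (simp add: auto_def Bij_def \<Phi>_def)
  qed
  have \<Psi>: "\<Psi> f \<in> auto G" if f: "f \<in> auto H" for f
  proof -
    have fH: "f \<in> hom H H" "bij_betw f (carrier H) (carrier H)"
      using f by (auto simp: auto_def Bij_def)
    have "(k \<circ> (f \<circ> h)) \<in> hom G G"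
      by (intro hom_compose[of _ G H] h fH k)
    moreover have "bij_betw (k \<circ> (f \<circ> h)) (carrier G) (carrier G)"
      by (intro bij_betw_trans[of _ _ "carrier H"] bijk bij fH(2))
    moreover have eq: "(k \<circ> (f \<circ> h)) x = \<Psi> f x" if "x \<in> carrier G" for x
      using that by (simp add: \<Psi>_def)
    ultimately have "\<Psi> f \<in> hom G G" "bij_betw (\<Psi> f) (carrier G) (carrier G)"
      using group.hom_restrict[OF assms(1), of "k \<circ> (f \<circ> h)" G "\<Psi> f"]
        bij_betw_cong[of "carrier G" "k \<circ> (f \<circ> h)" "\<Psi> f" "carrier G"] by simp_all
    then show ?thesis
      by (simp add: auto_def Bij_def \<Psi>_def)
  qed
  have "bij_betw \<Phi> (auto G) (auto H)"
  proof (rule bij_betwI[where g = \<Psi>])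
    show "\<Psi> (\<Phi> f) = f" if "f \<in> auto G" for f
    proof
      fix x
      show "\<Psi> (\<Phi> f) x = f x"
        using that kh[of x] kh(1)[of "f x"]
        by (cases "x \<in> carrier G")
           (auto simp: \<Phi>_def \<Psi>_def auto_def hom_def Bij_def extensional_def Pi_iff)
    qed
    show "\<Phi> (\<Psi> f) = f" if "f \<in> auto H" for f
    proof
      fix y
      show "\<Phi> (\<Psi> f) y = f y"
        using that hk[of y] hk(1)[of "f y"]
        by (cases "y \<in> carrier H")
           (auto simp: \<Phi>_def \<Psi>_def auto_def hom_def Bij_def extensional_def Pi_iff)
    qed
  qed (use \<Phi> \<Psi> in auto)
  then show ?thesis by (rule bij_betw_same_card)
qed

lemma converges_to_CL_any_type:
  fixes G :: "'g monoid" (structure)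
  assumes conv: "converges_to_CL p M Y" and G: "finite_abelian_p_group p G"
  shows "(\<lambda>n. measure (M n) {w \<in> space (M n). Y n w \<cong> G}) \<longlonglongrightarrow> CL p G"
proof -
  interpret comm_group G
    using G by (simp add: finite_abelian_p_group_def)
  obtain f :: "'g \<Rightarrow> nat" where f: "inj_on f (carrier G)"
    using G finite_imp_inj_to_nat_seg by (metis finite_abelian_p_group_def)
  define g where "g = inv_into (carrier G) f"
  have gf: "g (f x) = x" if "x \<in> carrier G" for x
    using that f by (simp add: g_def)
  define H :: "nat monoid" where
    "H = \<lparr>carrier = f ` carrier G, monoid.mult = (\<lambda>a b. f (g a \<otimes> g b)), one = f \<one>\<rparr>"
  have "comm_group H"
  proof (intro comm_groupI)
    fix a assume "a \<in> carrier H"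
    then obtain x where "x \<in> carrier G" "a = f x" by (auto simp: H_def)
    then show "\<exists>b\<in>carrier H. b \<otimes>\<^bsub>H\<^esub> a = \<one>\<^bsub>H\<^esub>"
      by (intro bexI[of _ "f (inv x)"]) (auto simp: H_def gf)
  qed (auto simp: H_def gf m_ac)
  have iso: "f \<in> iso G H"
    using f by (auto simp: iso_def hom_def H_def gf bij_betw_def)
  then have GH: "G \<cong> H" by (auto simp: is_iso_def)
  have HG: "H \<cong> G"
    using iso_sym GH by blast
  have H: "finite_abelian_p_group p H"
    using G \<open>comm_group H\<close> card_image[OF f]
    by (simp add: finite_abelian_p_group_def H_def order_def)
  have "(\<lambda>n. measure (M n) {w \<in> space (M n). Y n w \<cong> H}) \<longlonglongrightarrow> CL p H"
    using conv H by (simp add: converges_to_CL_def)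
  moreover have "Y n w \<cong> H \<longleftrightarrow> Y n w \<cong> G" for n w
    using iso_trans[OF _ HG] iso_trans[OF _ GH] by (rule iffI)
  moreover have "CL p H = CL p G"
    using card_auto_cong[OF is_group comm_group.axioms(2)[OF \<open>comm_group H\<close>] GH] by (simp add: CL_def)
  ultimately show ?thesis by simp
qed

end

theory Submission
  imports Defs
begin

text \<open>
  There is an exact formula behind the equivalence.  Write \<open>s j\<close> for the size of the support of the
  \<open>j\<close>-th column, \<open>Q n\<close> for the probability that the random matrix is nonsingular modulo \<open>p\<close>, which is
  the product of the \<open>1 - p ^ (j - 1) / p ^ s j\<close> (or \<open>0\<close> if some \<open>s j < j\<close>), and \<open>S n G\<close> for the
  expected number of surjections from the cokernel onto \<open>G\<close>.  Then the cokernel is isomorphic to \<open>G\<close>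
  with probability \<open>Q n * S n G / card (auto G)\<close> (\<open>cok_law\<close>).

  To see this, count presentations.  The cokernel is isomorphic to \<open>G\<close> exactly if the image of the
  matrix is the kernel of some surjective homomorphism \<open>g\<close> to \<open>G\<close>, and then \<open>card (auto G)\<close>
  homomorphisms will do.  Fix \<open>g\<close>.  The columns lie in the kernel of \<open>g\<close> with probability
  \<open>gen_weight G \<sigma> n g\<close>, and the sum of these probabilities over all surjective \<open>g\<close> is \<open>S n G\<close>.
  Given this, they generate the kernel if and only if they do so modulo \<open>p\<close>.  Because the supports
  are nested, the columns can be inserted one by one, and each has to avoid the span of those
  before it.  The numbers in this count turn out not to depend on \<open>g\<close>
  (\<open>card_columns_generating_kernel\<close>), so the conditional probability is \<open>Q n\<close>, its value for the
  trivial group.  By Nakayama's lemma all of it happens modulo a power of \<open>p\<close>, in a finite group,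
  where a Haar-random matrix has independent and uniformly distributed entries.

  For trivial \<open>G\<close> the formula says that the cokernel vanishes, equivalently has rank \<open>0\<close>, with
  probability \<open>Q n\<close>.  So convergence in rank \<open>0\<close> means that \<open>Q n\<close> tends to the Euler product, which
  is implied by convergence to the Cohen--Lenstra distribution.  For the converse it has to be shown
  that \<open>S n G\<close> then tends to \<open>1\<close> for every \<open>G\<close>.  The lower bound holds for all supports
  (\<open>surj_moment_ge\<close>).  For the upper bound, \<open>S n G\<close> is at most the product of
  \<open>1 + C / p ^ (s i - i)\<close> over the columns \<open>i\<close> at which the supports jump, where \<open>C\<close> is the number of
  subgroups of \<open>G\<close> (\<open>surj_moment_le\<close>).  The columns without a jump alone contribute a long partial
  product of the Euler product to \<open>Q n\<close>, so if \<open>Q n\<close> is close to the Euler product, the jumps can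
  contribute little (\<open>jump_product_bound\<close>).
\<close>

section \<open>Generating tuples of a finite abelian group\<close>

lemma (in group_hom) card_subgroup_hom:
  assumes "subgroup S G" "finite S"
  shows "card S = card {x \<in> S. h x = \<one>\<^bsub>H\<^esub>} * card (h ` S)"
proof -
  interpret S: subgroup S G by fact
  have fibre: "card {x \<in> S. h x = y} = card {x \<in> S. h x = \<one>\<^bsub>H\<^esub>}" if "y \<in> h ` S" for y
  proof -
    from that obtain a where a: "a \<in> S" "y = h a" by auto
    have aG: "a \<in> carrier G" using a by auto
    have "bij_betw (\<lambda>x. x \<otimes> a) {x \<in> S. h x = \<one>\<^bsub>H\<^esub>} {x \<in> S. h x = y}"
    proof (rule bij_betwI[where g = "\<lambda>x. x \<otimes> inv a"])
      show "(\<lambda>x. x \<otimes> inv a) \<in> {x \<in> S. h x = y} \<rightarrow> {x \<in> S. h x = \<one>\<^bsub>H\<^esub>}"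
        using a by auto
    qed (use a aG in \<open>auto simp: G.m_assoc\<close>)
    then show ?thesis by (simp add: bij_betw_same_card)
  qed
  have "card S = (\<Sum>y\<in>h ` S. card {x \<in> S. h x = y})"
    using sum.image_gen[OF assms(2), of "\<lambda>_. 1::nat" h] by simp
  also have "\<dots> = (\<Sum>y\<in>h ` S. card {x \<in> S. h x = \<one>\<^bsub>H\<^esub>})"
    by (intro sum.cong refl fibre)
  finally show ?thesis by (simp add: mult.commute)
qed

context comm_group
begin

lemma nat_pow_subgroup_closed:
  "subgroup H G \<Longrightarrow> x \<in> H \<Longrightarrow> x [^] (i::nat) \<in> H"
  by (metis int_pow_int subgroup_int_pow_closed)

text \<open>
  As \<open>y [^] p\<close> lies in \<open>H\<close>, exponents of \<open>y\<close> matter only modulo \<open>p\<close>: adjoining such a \<open>y\<close>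
  enlarges a subgroup by a factor of at most \<open>p\<close>.
\<close>

lemma generate_insert_prime_index:
  assumes H: "subgroup H G" and y: "y \<in> carrier G" and yp: "y [^] (p::nat) \<in> H" and p: "p > 0"
  shows "generate G (insert y H) = (\<lambda>(h, i::nat). h \<otimes> y [^] i) ` (H \<times> {..<p})"
proof -
  interpret H: subgroup H G by fact
  define U where "U = (\<lambda>(h, i::nat). h \<otimes> y [^] i) ` (H \<times> {..<p})"
  have red: "h \<otimes> y [^] i \<in> U" if h: "h \<in> H" for h and i :: nat
  proof -
    have "y [^] i = y [^] (p * (i div p) + i mod p)" by simp
    also have "\<dots> = (y [^] p) [^] (i div p) \<otimes> y [^] (i mod p)"
      using y by (simp only: nat_pow_mult[symmetric] nat_pow_pow)
    finally have "h \<otimes> y [^] i = (h \<otimes> (y [^] p) [^] (i div p)) \<otimes> y [^] (i mod p)"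
      using y h yp by (simp add: m_assoc)
    moreover have "h \<otimes> (y [^] p) [^] (i div p) \<in> H"
      using h yp nat_pow_subgroup_closed[OF H] by simp
    ultimately show ?thesis using p unfolding U_def
      by (intro image_eqI[where x = "(h \<otimes> (y [^] p) [^] (i div p), i mod p)"]) auto
  qed
  have "subgroup U G"
  proof
    show "U \<subseteq> carrier G" using y by (auto simp: U_def)
    show "\<one> \<in> U" using red[of \<one> 0] by simp
  next
    fix a b assume "a \<in> U" "b \<in> U"
    then obtain h i h' j where ab: "h \<in> H" "h' \<in> H" "a = h \<otimes> y [^] (i::nat)" "b = h' \<otimes> y [^] (j::nat)"
      by (auto simp: U_def)
    then have "a \<otimes> b = (h \<otimes> h') \<otimes> y [^] (i + j)"
      using y by (simp add: nat_pow_mult[symmetric] m_ac)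
    then show "a \<otimes> b \<in> U" using red ab by simp
  next
    fix a assume "a \<in> U"
    then obtain h i where a: "h \<in> H" "a = h \<otimes> y [^] (i::nat)" by (auto simp: U_def)
    have "y [^] i \<otimes> y [^] ((p - 1) * i) = y [^] (i * p)"
      using y p by (simp add: nat_pow_mult algebra_simps)
    also have "\<dots> = (y [^] i) [^] p" using y by (simp add: nat_pow_pow)
    also have "\<dots> = (y [^] p) [^] i" using y by (simp add: nat_pow_pow mult.commute)
    finally have e: "y [^] i \<otimes> y [^] ((p - 1) * i) = (y [^] p) [^] i" .
    have m: "inv h \<otimes> inv ((y [^] p) [^] i) \<in> H"
      using a yp H by (metis H.m_closed H.m_inv_closed H.subgroup_axioms int_pow_int subgroup_int_pow_closed)
    have rearr: "b \<otimes> c \<otimes> ((d \<otimes> e) \<otimes> f) = (b \<otimes> d) \<otimes> ((c \<otimes> f) \<otimes> e)"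
      if "b \<in> carrier G" "c \<in> carrier G" "d \<in> carrier G" "e \<in> carrier G" "f \<in> carrier G" for b c d e f
      using that by (simp add: m_ac)
    have "a \<otimes> ((inv h \<otimes> inv ((y [^] p) [^] i)) \<otimes> y [^] ((p - 1) * i)) = 
       (h \<otimes> inv h) \<otimes> ((y [^] i \<otimes> y [^] ((p - 1) * i)) \<otimes> inv ((y [^] p) [^] i))"
      unfolding a(2) using a(1) y by (intro rearr) auto
    also have "\<dots> = \<one>" unfolding e using a y yp by simp
    finally have "inv a = (inv h \<otimes> inv ((y [^] p) [^] i)) \<otimes> y [^] ((p - 1) * i)"
      using a y yp by (intro inv_equality) (auto simp: m_comm)
    then show "inv a \<in> U" using red[OF m] by simp
  qed
  then have "U = generate G (insert y H)"
  proof (rule generateI)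
    have "y \<in> U" using red[of \<one> 1] y by simp
    moreover have "h \<in> U" if "h \<in> H" for h using red[OF that, of 0] that by simp
    ultimately show "insert y H \<subseteq> U" by auto
  next
    fix K assume K: "subgroup K G" "insert y H \<subseteq> K"
    then have "y [^] (i::nat) \<in> K" for i
      by (metis insert_subset int_pow_int subgroup_int_pow_closed)
    then show "U \<subseteq> K" using K by (auto simp: U_def subgroup.m_closed)
  qed
  then show ?thesis by (simp add: U_def)
qed

lemma card_generate_insert_le:
  assumes "subgroup H G" "finite H" "y \<in> carrier G" "y [^] (p::nat) \<in> H" "p > 0"
  shows "card (generate G (insert y H)) \<le> p * card H"
proof -
  have "card (generate G (insert y H)) \<le> card (H \<times> {..<p})"
    unfolding generate_insert_prime_index[OF assms(1,3,4,5)]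
    by (intro card_image_le) (use assms in auto)
  then show ?thesis by (simp add: card_cartesian_product mult.commute)
qed

text \<open>
  For prime \<open>p\<close> there is nothing between factor \<open>1\<close> and factor \<open>p\<close>: if \<open>h \<otimes> y [^] i\<close> took a value
  twice, a power of \<open>y\<close> with exponent prime to \<open>p\<close> would lie in \<open>H\<close>, and then so would \<open>y\<close>.
\<close>

lemma card_generate_insert_eq:
  assumes H: "subgroup H G" "finite H" and y: "y \<in> carrier G" "y [^] (p::nat) \<in> H" 
    and p: "prime p" and new: "y \<notin> H"
  shows "card (generate G (insert y H)) = p * card H"
proof -
  interpret H: subgroup H G by fact
  have False if h: "h \<in> H" "h' \<in> H" and eq: "h \<otimes> y [^] i = h' \<otimes> y [^] j" and ij: "i < j" "j < p"
    for h h' and i j :: nat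
  proof -
    have "h \<otimes> y [^] i = h' \<otimes> y [^] (j - i) \<otimes> y [^] i"
      using eq ij y h by (simp add: m_assoc nat_pow_mult)
    then have "h = h' \<otimes> y [^] (j - i)" using h y by simp
    then have "y [^] (j - i) = inv h' \<otimes> h"
      using h y by (metis H.mem_carrier inv_solve_left nat_pow_closed)
    then have 1: "y [^] (j - i) \<in> H" using h by simp
    have "\<not> p dvd (j - i)" using ij by (auto dest: dvd_imp_le)
    then have "coprime (j - i) p" using p by (simp add: coprime_commute prime_imp_coprime)
    then obtain u v :: int where uv: "u * int (j - i) + v * int p = 1"
      using bezout_int[of "int (j - i)" "int p"] by auto
    have "y = y [^] (u * int (j - i) + v * int p)" using uv y by simp
    also have "\<dots> = (y [^] (j - i)) [^] u \<otimes> (y [^] p) [^] v"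
      using y by (simp add: int_pow_mult int_pow_pow mult.commute flip: int_pow_int)
    also have "\<dots> \<in> H"
      using 1 y H subgroup_int_pow_closed by (metis H.m_closed)
    finally show False using new by simp
  qed
  then have ij: "i = j" if "h \<in> H" "h' \<in> H" "h \<otimes> y [^] i = h' \<otimes> y [^] j" "i < p" "j < p"
    for h h' and i j :: nat
    using that by (metis nat_neq_iff)
  have "inj_on (\<lambda>(h, i::nat). h \<otimes> y [^] i) (H \<times> {..<p})"
  proof (intro inj_onI, clarsimp)
    fix h h' and i j :: nat
    assume *: "h \<in> H" "h' \<in> H" "h \<otimes> y [^] i = h' \<otimes> y [^] j" "i < p" "j < p"
    then show "h = h' \<and> i = j" using ij[OF *] y by auto
  qed
  then show ?thesis
    unfolding generate_insert_prime_index[OF H(1) y prime_gt_0_nat[OF p]]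
    by (simp add: card_image card_cartesian_product mult.commute)
qed

lemma generate_Un_generate:
  assumes "A \<subseteq> carrier G" "B \<subseteq> carrier G"
  shows "generate G (A \<union> generate G B) = generate G (A \<union> B)"
proof (rule generateI)
  show "subgroup (generate G (A \<union> generate G B)) G"
    using assms generate_incl by (intro generate_is_subgroup) auto
  show "A \<union> B \<subseteq> generate G (A \<union> generate G B)"
    using generate.incl by (metis UnCI subsetI UnE)
  fix K assume "subgroup K G" "A \<union> B \<subseteq> K"
  then show "generate G (A \<union> generate G B) \<subseteq> K"
    by (intro generate_subgroup_incl) (auto dest: generate_subgroup_incl[of B K])
qed


lemma card_generate_le:
  assumes fin: "finite (carrier G)" and P: "subgroup P G" and p: "p > 0"
    and "finite X" "X \<subseteq> carrier G" "\<And>x. x \<in> X \<Longrightarrow> x [^] (p::nat) \<in> P"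
  shows "card (generate G (P \<union> X)) \<le> p ^ card X * card P"
  using assms(4-)
proof (induction rule: finite_induct)
  case empty
  then show ?case
    using generate_subgroup_incl[OF order_refl P] card_mono[OF finite_subset[OF subgroup.subset[OF P] fin]]
    by simp
next
  case (insert y X)
  have PG: "P \<subseteq> carrier G" using subgroup.subset[OF P] .
  let ?H = "generate G (P \<union> X)"
  have H: "subgroup ?H G" using PG insert.prems by (intro generate_is_subgroup) auto
  have "generate G (P \<union> insert y X) = generate G ({y} \<union> (P \<union> X))" by (simp add: Un_commute)
  also have "\<dots> = generate G (insert y ?H)"
    using generate_Un_generate[of "{y}" "P \<union> X"] PG insert.prems by simp
  finally have "card (generate G (P \<union> insert y X)) \<le> p * card ?H"
    using card_generate_insert_le[OF H finite_subset[OF subgroup.subset[OF H] fin], of y p]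
      insert.prems p by (auto intro: generate.incl)
  also have "\<dots> \<le> p * (p ^ card X * card P)"
    using insert by (intro mult_left_mono insert.IH) auto
  finally show ?case using insert by simp
qed

lemma card_generate_independent:
  assumes fin: "finite (carrier G)" and P: "subgroup P G" and p: "prime p"
    and x: "x \<in> {1..n} \<rightarrow> carrier G" and xp: "\<And>j. j \<in> {1..n} \<Longrightarrow> x j [^] (p::nat) \<in> P"
    and ind: "\<And>j. j \<in> {1..n} \<Longrightarrow> x j \<notin> generate G (P \<union> x ` {1..<j})"
  shows "card (generate G (P \<union> x ` {1..n})) = p ^ n * card P"
  using x xp ind
proof (induction n)
  case 0
  have "generate G P = P" using generateI[OF P order_refl] by auto
  then show ?case by simp
next
  case (Suc n)
  have PG: "P \<subseteq> carrier G" using subgroup.subset[OF P] .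
  have xG: "x ` {1..Suc n} \<subseteq> carrier G" using Suc.prems(1) by auto
  let ?H = "generate G (P \<union> x ` {1..n})"
  have H: "subgroup ?H G" using PG xG by (intro generate_is_subgroup) auto
  have "P \<union> x ` {1..Suc n} = {x (Suc n)} \<union> (P \<union> x ` {1..n})" by (auto simp: atLeastAtMostSuc_conv)
  then have "generate G (P \<union> x ` {1..Suc n}) = generate G (insert (x (Suc n)) ?H)"
    using generate_Un_generate[of "{x (Suc n)}" "P \<union> x ` {1..n}"] PG xG by auto
  also have "card \<dots> = p * card ?H"
  proof (rule card_generate_insert_eq[OF H finite_subset[OF subgroup.subset[OF H] fin] _ _ p])
    show "x (Suc n) \<in> carrier G" using xG by auto
    show "x (Suc n) [^] p \<in> ?H" using Suc.prems(2)[of "Suc n"] by (auto intro: generate.incl)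
    show "x (Suc n) \<notin> ?H" using Suc.prems(3)[of "Suc n"] by (simp add: atLeastLessThanSuc_atLeastAtMost)
  qed
  also have "card ?H = p ^ n * card P"
    by (rule Suc.IH) (use Suc.prems in \<open>auto simp: Pi_iff\<close>)
  finally show ?case by simp
qed

lemma generate_Un_subset_set_mult:
  assumes A: "subgroup A G" and B: "B \<subseteq> carrier G"
  shows "generate G (A \<union> B) \<subseteq> A <#> generate G B"
proof (rule generate_subgroup_incl)
  have sB: "subgroup (generate G B) G" by (rule generate_is_subgroup[OF B])
  show "subgroup (A <#> generate G B) G" by (rule mult_subgroups[OF A sB])
  have "x \<in> A <#> generate G B" if "x \<in> A" for x
  proof -
    have "x = x \<otimes> \<one>" using subgroup.mem_carrier[OF A that] by simp
    then show ?thesis using that generate.one[of G B] unfolding set_mult_def by blast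
  qed
  moreover have "x \<in> A <#> generate G B" if "x \<in> B" for x
  proof -
    have "x = \<one> \<otimes> x" using B that by auto
    then show ?thesis
      using generate.incl[OF that, of G] subgroup.one_closed[OF A] unfolding set_mult_def by blast
  qed
  ultimately show "A \<union> B \<subseteq> A <#> generate G B" by blast
qed

text \<open>
  Dedekind's modular law.  It makes the count below possible: the part of a span that lies in a
  smaller subgroup \<open>K\<close> is again a span, over \<open>P \<inter> K\<close>.
\<close>

lemma generate_Un_Int_modular:
  assumes P: "subgroup P G" and K: "subgroup K G" and X: "X \<subseteq> K"
  shows "generate G (P \<union> X) \<inter> K = generate G ((P \<inter> K) \<union> X)"
proof
  have PG: "P \<subseteq> carrier G" "K \<subseteq> carrier G" "X \<subseteq> carrier G"
    using subgroup.subset[OF P] subgroup.subset[OF K] X by auto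
  show "generate G ((P \<inter> K) \<union> X) \<subseteq> generate G (P \<union> X) \<inter> K"
    using mono_generate[of "(P \<inter> K) \<union> X" "P \<union> X"] generate_subgroup_incl[OF _ K, of "(P \<inter> K) \<union> X"] X
    by blast
  have "generate G (P \<union> X) \<subseteq> P <#> generate G X"
    by (rule generate_Un_subset_set_mult[OF P PG(3)])
  moreover have "z \<in> generate G ((P \<inter> K) \<union> X)" if z: "z \<in> P <#> generate G X" "z \<in> K" for z
  proof -
    from z obtain a b where ab: "a \<in> P" "b \<in> generate G X" "z = a \<otimes> b" by (auto simp: set_mult_def)
    have bK: "b \<in> K" using ab(2) generate_subgroup_incl[OF X K] by blast
    have "z \<otimes> inv b = a"
      using subsetD[OF PG(1) ab(1)] subsetD[OF PG(2) bK] ab(3) by (simp add: m_assoc)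
    moreover have "z \<otimes> inv b \<in> K"
      by (rule subgroup.m_closed[OF K z(2) subgroup.m_inv_closed[OF K bK]])
    ultimately have "a \<in> P \<inter> K" using ab(1) by simp
    then have "a \<in> generate G ((P \<inter> K) \<union> X)" by (intro generate.incl) simp
    moreover have "b \<in> generate G ((P \<inter> K) \<union> X)" using ab(2) mono_generate[of X "(P \<inter> K) \<union> X"] by blast
    ultimately show ?thesis unfolding ab(3) by (rule generate.eng)
  qed
  ultimately show "generate G (P \<union> X) \<inter> K \<subseteq> generate G ((P \<inter> K) \<union> X)" by blast
qed

text \<open>
  If all \<open>p\<close>-th powers lie in \<open>P\<close>, the \<open>K j\<close> give a flag of vector spaces over the field with \<open>p\<close>
  elements, and the tuples counted are the linearly independent ones with \<open>x j\<close> in the \<open>j\<close>-th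
  space.  Choose the entries one by one.  By the modular law, \<open>P\<close> and the first \<open>j - 1\<close> entries
  span a group that meets \<open>K j\<close> in \<open>p ^ (j - 1) * card (P \<inter> K j)\<close> elements, whatever the entries
  are; these are the forbidden values of \<open>x j\<close>.
\<close>

lemma card_independent_tuples:
  assumes fin: "finite (carrier G)" and P: "subgroup P G" and p: "prime (p::nat)"
    and K: "\<And>j. j \<in> {1..n} \<Longrightarrow> subgroup (K j) G"
    and mono: "\<And>i j. 1 \<le> i \<Longrightarrow> i \<le> j \<Longrightarrow> j \<le> n \<Longrightarrow> K i \<subseteq> K j"
    and pow: "\<And>j x. j \<in> {1..n} \<Longrightarrow> x \<in> K j \<Longrightarrow> x [^] p \<in> P"
  shows "card {x \<in> PiE {1..n} K. \<forall>j\<in>{1..n}. x j \<notin> generate G (P \<union> x ` {1..<j})} =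
    (\<Prod>j=1..n. card (K j) - p ^ (j - 1) * card (P \<inter> K j))"
  using K mono pow
proof (induction n)
  case 0
  then show ?case by simp
next
  case (Suc n)
  have finK: "finite (K j)" if "j \<in> {1..Suc n}" for j
    using subgroup.subset[OF Suc.prems(1)[OF that]] fin by (rule finite_subset)
  define T where "T m = {x \<in> PiE {1..m} K. \<forall>j\<in>{1..m}. x j \<notin> generate G (P \<union> x ` {1..<j})}" for m
  define N where "N x = {y \<in> K (Suc n). y \<notin> generate G (P \<union> x ` {1..n})}" for x
  have upd: "(x(Suc n := y)) ` A = x ` A" if "Suc n \<notin> A" for x :: "nat \<Rightarrow> 'a" and y A
    using that by (intro image_cong) auto
  have "bij_betw (\<lambda>(x, y). x(Suc n := y)) (Sigma (T n) N) (T (Suc n))"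
  proof (rule bij_betwI[where g = "\<lambda>z. (z(Suc n := undefined), z (Suc n))"])
    show "(\<lambda>(x, y). x(Suc n := y)) \<in> Sigma (T n) N \<rightarrow> T (Suc n)"
    proof (rule funcsetI, clarify)
      fix x y assume x: "x \<in> T n" and y: "y \<in> N x"
      have "x(Suc n := y) \<in> PiE {1..Suc n} K"
        using x y by (auto simp: PiE_iff extensional_def T_def N_def)
      moreover have "(x(Suc n := y)) j \<notin> generate G (P \<union> (x(Suc n := y)) ` {1..<j})" 
        if j: "j \<in> {1..Suc n}" for j
      proof -
        have "(x(Suc n := y)) ` {1..<j} = x ` {1..<j}" using j by (intro upd) auto
        then show ?thesis using x y j
          by (cases "j = Suc n") (auto simp: T_def N_def atLeastLessThanSuc_atLeastAtMost)
      qed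
      ultimately show "x(Suc n := y) \<in> T (Suc n)" by (simp add: T_def)
    qed
    show "(\<lambda>z. (z(Suc n := undefined), z (Suc n))) \<in> T (Suc n) \<rightarrow> Sigma (T n) N"
    proof (rule funcsetI, intro SigmaI)
      fix z assume z: "z \<in> T (Suc n)"
      have img: "(z(Suc n := undefined)) ` {1..<j} = z ` {1..<j}" if "j \<in> {1..Suc n}" for j
        using that by (intro upd) auto
      have ind: "z j \<notin> generate G (P \<union> z ` {1..<j})" if "j \<in> {1..Suc n}" for j
        using z that by (simp add: T_def)
      have "z(Suc n := undefined) \<in> PiE {1..n} K"
        using z by (auto simp: PiE_iff extensional_def T_def)
      moreover have "(z(Suc n := undefined)) j \<notin> generate G (P \<union> (z(Suc n := undefined)) ` {1..<j})" 
        if "j \<in> {1..n}" for j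
        using that ind[of j] img[of j] by simp
      ultimately show "z(Suc n := undefined) \<in> T n" by (simp add: T_def)
      show "z (Suc n) \<in> N (z(Suc n := undefined))"
        using z ind[of "Suc n"] img[of "Suc n"] 
        by (auto simp: T_def N_def PiE_iff atLeastLessThanSuc_atLeastAtMost)
    qed
  qed (auto simp: T_def PiE_iff extensional_def fun_eq_iff)
  then have "card (T (Suc n)) = card (Sigma (T n) N)" by (simp add: bij_betw_same_card)
  also have "\<dots> = (\<Sum>x\<in>T n. card (N x))"
  proof (intro card_SigmaI ballI)
    show "finite (T n)"
      by (rule finite_subset[OF _ finite_PiE[of "{1..n}" K]]) (auto simp: T_def finK)
  qed (use finK in \<open>auto simp: N_def\<close>)
  also have "\<dots> = (\<Sum>x\<in>T n. card (K (Suc n)) - p ^ n * card (P \<inter> K (Suc n)))"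
  proof (rule sum.cong[OF refl])
    fix x assume x: "x \<in> T n"
    let ?K = "K (Suc n)"
    have sK: "subgroup ?K G" using Suc.prems(1) by simp
    have xK: "x ` {1..n} \<subseteq> ?K" using x Suc.prems(2)[of _ "Suc n"] by (fastforce simp: T_def PiE_iff)
    have sPK: "subgroup (P \<inter> ?K) G" by (rule subgroups_Inter_pair[OF P sK])
    have "generate G (P \<union> x ` {1..n}) \<inter> ?K = generate G ((P \<inter> ?K) \<union> x ` {1..n})"
      by (rule generate_Un_Int_modular[OF P sK xK])
    moreover have "card (generate G ((P \<inter> ?K) \<union> x ` {1..n})) = p ^ n * card (P \<inter> ?K)"
    proof (rule card_generate_independent[OF fin sPK p])
      show "x \<in> {1..n} \<rightarrow> carrier G" using xK subgroup.subset[OF sK] by auto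
      show "x j [^] p \<in> P \<inter> ?K" if "j \<in> {1..n}" for j
      proof -
        have "x j \<in> ?K" using that xK by blast
        then show ?thesis using Suc.prems(3)[of "Suc n" "x j"] nat_pow_subgroup_closed[OF sK] by simp
      qed
      show "x j \<notin> generate G ((P \<inter> ?K) \<union> x ` {1..<j})" if "j \<in> {1..n}" for j
      proof -
        have "generate G ((P \<inter> ?K) \<union> x ` {1..<j}) \<subseteq> generate G (P \<union> x ` {1..<j})"
          by (rule mono_generate) auto
        then show ?thesis using x that unfolding T_def by blast
      qed
    qed
    moreover have "card (N x) = card ?K - card (generate G (P \<union> x ` {1..n}) \<inter> ?K)"
    proof -
      have "N x = ?K - generate G (P \<union> x ` {1..n}) \<inter> ?K" by (auto simp: N_def)
      moreover have "finite (generate G (P \<union> x ` {1..n}) \<inter> ?K)" using finK[of "Suc n"] by simp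
      ultimately show ?thesis by (metis card_Diff_subset Int_lower2)
    qed
    ultimately show "card (N x) = card ?K - p ^ n * card (P \<inter> ?K)" by simp
  qed
  also have "\<dots> = card (T n) * (card (K (Suc n)) - p ^ n * card (P \<inter> K (Suc n)))" by simp
  also have "card (T n) = (\<Prod>j=1..n. card (K j) - p ^ (j - 1) * card (P \<inter> K j))"
    unfolding T_def
  proof (rule Suc.IH)
    show "K i \<subseteq> K j" if "1 \<le> i" "i \<le> j" "j \<le> n" for i j
      using that Suc.prems(2) by simp
    show "x [^] p \<in> P" if "j \<in> {1..n}" "x \<in> K j" for j x
      using Suc.prems(3)[of j x] that by simp
  qed (use Suc.prems(1) in auto)
  finally have "card (T (Suc n)) = (\<Prod>j=1..Suc n. card (K j) - p ^ (j - 1) * card (P \<inter> K j))"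
    by (simp add: mult.commute)
  then show ?case unfolding T_def .
qed

lemma subgroup_pow_image:
  assumes K: "subgroup K G"
  shows "subgroup ((\<lambda>x. x [^] (m::nat)) ` K) G"
proof -
  interpret K: subgroup K G by fact
  show ?thesis
  proof
    show "(\<lambda>x. x [^] m) ` K \<subseteq> carrier G" by auto
    show "\<one> \<in> (\<lambda>x. x [^] m) ` K" by (rule image_eqI[of _ _ \<one>]) auto
    fix a b assume "a \<in> (\<lambda>x. x [^] m) ` K" "b \<in> (\<lambda>x. x [^] m) ` K"
    then obtain x y where "x \<in> K" "y \<in> K" "a = x [^] m" "b = y [^] m" by auto
    then show "a \<otimes> b \<in> (\<lambda>x. x [^] m) ` K"
      by (intro image_eqI[of _ _ "x \<otimes> y"]) (auto simp: nat_pow_distrib)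
  next
    fix a assume "a \<in> (\<lambda>x. x [^] m) ` K"
    then obtain x where "x \<in> K" "a = x [^] m" by auto
    then show "inv a \<in> (\<lambda>x. x [^] m) ` K"
      by (intro image_eqI[of _ _ "inv x"]) (auto simp: nat_pow_inv)
  qed
qed

text \<open>
  Frattini's argument: generating a group of exponent \<open>p ^ N\<close> can be checked modulo \<open>p\<close>-th powers.
\<close>

lemma generate_Un_pow_image:
  assumes K: "subgroup K G" and X: "X \<subseteq> K" and exp: "\<And>x. x \<in> K \<Longrightarrow> x [^] (p ^ N :: nat) = \<one>"
    and gen: "generate G ((\<lambda>x. x [^] p) ` K \<union> X) = K"
  shows "generate G X = K"
proof
  show "generate G X \<subseteq> K" by (rule generate_subgroup_incl[OF X K])
  interpret K: subgroup K G by fact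
  have XG: "X \<subseteq> carrier G" using X by auto
  have sX: "subgroup (generate G X) G" by (rule generate_is_subgroup[OF XG])
  let ?P = "(\<lambda>x. x [^] p) ` K"
  have sP: "subgroup ?P G" by (rule subgroup_pow_image[OF K])
  have "generate G (?P \<union> X) \<subseteq> ?P <#> generate G X"
    by (rule generate_Un_subset_set_mult[OF sP XG])
  then have KPX: "K \<subseteq> ?P <#> generate G X" using gen by simp
  have step: "\<exists>y\<in>K. \<exists>b\<in>generate G X. x = y [^] (p ^ m) \<otimes> b" if "x \<in> K" for x and m :: nat
  proof (induction m)
    case 0
    have "x = x [^] (p ^ 0) \<otimes> \<one>" using that by simp
    then show ?case using that generate.one[of G X] by blast
  next
    case (Suc m)
    then obtain y b where yb: "y \<in> K" "b \<in> generate G X" "x = y [^] (p ^ m) \<otimes> b" by auto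
    from KPX yb obtain z c where zc: "z \<in> K" "c \<in> generate G X" "y = z [^] p \<otimes> c"
      unfolding set_mult_def by blast
    have cG: "c \<in> carrier G" "b \<in> carrier G" using zc yb generate_incl[OF XG] by auto
    have "x = z [^] (p ^ Suc m) \<otimes> (c [^] (p ^ m) \<otimes> b)"
      using yb zc cG by (simp add: nat_pow_distrib nat_pow_pow m_assoc)
    moreover have "c [^] (p ^ m) \<otimes> b \<in> generate G X"
      using zc yb nat_pow_subgroup_closed[OF sX] by (auto intro: generate.eng)
    ultimately show ?case using zc by blast
  qed
  show "K \<subseteq> generate G X"
  proof
    fix x assume "x \<in> K"
    then obtain y b where "y \<in> K" "b \<in> generate G X" "x = y [^] (p ^ N) \<otimes> b" using step by blast
    then show "x \<in> generate G X" using exp generate_incl[OF XG] by auto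
  qed
qed

text \<open>
  The hypothesis \<open>rank\<close> says that \<open>K0\<close> modulo \<open>p\<close>-th powers is a vector space of dimension \<open>n\<close>, so
  that \<open>n\<close> elements generate \<open>K0\<close> exactly if they are independent there.
\<close>

lemma card_generating_tuples:
  assumes fin: "finite (carrier G)" and p: "prime (p::nat)"
    and K0: "subgroup K0 G" and exp: "\<And>x. x \<in> K0 \<Longrightarrow> x [^] (p ^ N) = \<one>"
    and rank: "card K0 = p ^ n * card ((\<lambda>x. x [^] p) ` K0)"
    and K: "\<And>j. j \<in> {1..n} \<Longrightarrow> subgroup (K j) G" "\<And>j. j \<in> {1..n} \<Longrightarrow> K j \<subseteq> K0"
    and mono: "\<And>i j. 1 \<le> i \<Longrightarrow> i \<le> j \<Longrightarrow> j \<le> n \<Longrightarrow> K i \<subseteq> K j"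
  shows "card {x \<in> PiE {1..n} K. generate G (x ` {1..n}) = K0} =
    (\<Prod>j=1..n. card (K j) - p ^ (j - 1) * card ((\<lambda>x. x [^] p) ` K0 \<inter> K j))"
proof -
  define P where "P = (\<lambda>x. x [^] p) ` K0"
  have P: "subgroup P G" unfolding P_def by (rule subgroup_pow_image[OF K0])
  have PK0: "P \<subseteq> K0" using nat_pow_subgroup_closed[OF K0] by (auto simp: P_def)
  have finK0: "finite K0" using finite_subset[OF subgroup.subset[OF K0] fin] .
  have "0 < card P" using P fin subgroup.finite_imp_card_positive by blast
  have "generate G (x ` {1..n}) = K0 \<longleftrightarrow> (\<forall>j\<in>{1..n}. x j \<notin> generate G (P \<union> x ` {1..<j}))"
    if x: "x \<in> PiE {1..n} K" for x
  proof -
    have xK0: "x ` {1..n} \<subseteq> K0" 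
    proof
      fix a assume "a \<in> x ` {1..n}"
      then obtain j where "j \<in> {1..n}" "a = x j" by blast
      then show "a \<in> K0" using PiE_mem[OF x] K(2)[of j] by blast
    qed
    have xG: "x ` {1..n} \<subseteq> carrier G" using xK0 subgroup.subset[OF K0] by auto
    have xP: "x j [^] p \<in> P" if "j \<in> {1..n}" for j using that xK0 unfolding P_def by blast
    have sub: "generate G (P \<union> x ` {1..n}) \<subseteq> K0"
      using PK0 xK0 by (intro generate_subgroup_incl[OF _ K0]) auto
    show ?thesis
    proof
      assume ind: "\<forall>j\<in>{1..n}. x j \<notin> generate G (P \<union> x ` {1..<j})"
      have "card (generate G (P \<union> x ` {1..n})) = p ^ n * card P"
        by (rule card_generate_independent[OF fin P p]) (use xG xP ind in auto)
      then have "generate G (P \<union> x ` {1..n}) = K0"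
        using sub rank finK0 by (intro card_subset_eq) (auto simp: P_def)
      then show "generate G (x ` {1..n}) = K0"
        using generate_Un_pow_image[OF K0 xK0 exp] by (simp add: P_def)
    next
      assume gen: "generate G (x ` {1..n}) = K0"
      show "\<forall>j\<in>{1..n}. x j \<notin> generate G (P \<union> x ` {1..<j})"
      proof (rule ballI, rule notI)
        fix j assume j: "j \<in> {1..n}" "x j \<in> generate G (P \<union> x ` {1..<j})"
        let ?X = "x ` ({1..n} - {j})"
        have XG: "?X \<subseteq> carrier G" "P \<subseteq> carrier G" using xG subgroup.subset[OF P] by auto
        have sX: "subgroup (generate G (P \<union> ?X)) G" using XG by (intro generate_is_subgroup) auto
        have "x j \<in> generate G (P \<union> ?X)"
        proof -
          have "x ` {1..<j} \<subseteq> ?X" using j(1) by (intro image_mono) auto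
          then have "P \<union> x ` {1..<j} \<subseteq> P \<union> ?X" by blast
          from mono_generate[OF this] show ?thesis using j(2) by blast
        qed
        moreover have "x i \<in> generate G (P \<union> ?X)" if "i \<in> {1..n}" "i \<noteq> j" for i
          using that by (intro generate.incl) blast
        ultimately have "x ` {1..n} \<subseteq> generate G (P \<union> ?X)" by blast
        then have "K0 \<subseteq> generate G (P \<union> ?X)"
          using generate_subgroup_incl[OF _ sX] gen by blast
        then have "card K0 \<le> card (generate G (P \<union> ?X))"
          using finite_subset[OF subgroup.subset[OF sX] fin] by (intro card_mono)
        also have "\<dots> \<le> p ^ card ?X * card P"
          using XG xP by (intro card_generate_le[OF fin P prime_gt_0_nat[OF p]]) auto
        also have "\<dots> \<le> p ^ (n - 1) * card P"
          using card_image_le[of "{1..n} - {j}" x] j(1) prime_gt_0_nat[OF p]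
          by (intro mult_right_mono power_increasing) auto
        also have "\<dots> < p ^ n * card P"
          using \<open>0 < card P\<close> j(1) prime_gt_1_nat[OF p] by (intro mult_strict_right_mono power_strict_increasing) auto
        finally show False using rank by (simp add: P_def)
      qed
    qed
  qed
  then have "{x \<in> PiE {1..n} K. generate G (x ` {1..n}) = K0} =
    {x \<in> PiE {1..n} K. \<forall>j\<in>{1..n}. x j \<notin> generate G (P \<union> x ` {1..<j})}" by blast
  also have "card \<dots> = (\<Prod>j=1..n. card (K j) - p ^ (j - 1) * card (P \<inter> K j))"
    using K mono by (intro card_independent_tuples[OF fin P p]) (auto simp: P_def)
  finally show ?thesis by (simp add: P_def)
qed

end

section \<open>The expected number of surjections from the cokernel\<close>

lemma sum_PiE_restrict:
  fixes f :: "('i \<Rightarrow> 'a) \<Rightarrow> real"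
  assumes "A \<subseteq> B" "finite B" "finite H"
  shows "(\<Sum>g\<in>PiE B (\<lambda>_. H). f (restrict g A)) =
    real (card H) ^ card (B - A) * (\<Sum>g\<in>PiE A (\<lambda>_. H). f g)"
proof -
  have "(\<Sum>g\<in>PiE B (\<lambda>_. H). f (restrict g A)) =
    (\<Sum>(g, u)\<in>PiE A (\<lambda>_. H) \<times> PiE (B - A) (\<lambda>_. H). f g)"
  proof (rule sum.reindex_bij_witness[where j = "\<lambda>g. (restrict g A, restrict g (B - A))"
        and i = "\<lambda>(g, u). \<lambda>i\<in>B. if i \<in> A then g i else u i"], goal_cases)
    case (2 g)
    then show ?case using assms(1) by (auto simp: PiE_iff)
  next
    case (1 g)
    then show ?case using assms(1) by (auto simp: PiE_iff fun_eq_iff extensional_def)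
  next
    case (3 gu)
    have "i \<notin> B \<Longrightarrow> i \<notin> A" for i using assms(1) by blast
    then show ?case using 3 assms(1) by (auto simp: PiE_iff fun_eq_iff extensional_def)
  next
    case (4 gu)
    then show ?case by (auto simp: PiE_iff)
  qed auto
  also have "\<dots> = (\<Sum>g\<in>PiE A (\<lambda>_. H). real (card (PiE (B - A) (\<lambda>_. H))) * f g)"
    by (simp add: sum.cartesian_product[symmetric])
  finally show ?thesis
    using assms by (simp add: card_PiE sum_distrib_left)
qed

text \<open>
  A tuple \<open>g\<close> of elements of \<open>G\<close> is a homomorphism to \<open>G\<close> that sends the \<open>i\<close>-th unit vector to
  \<open>g i\<close>.  A random vector supported on \<open>\<sigma> j\<close> has a uniformly distributed image in the subgroup
  generated by the \<open>g i\<close> with \<open>i \<in> \<sigma> j\<close>.  So the weight of \<open>g\<close> is the probability that the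
  homomorphism kills all columns of the random matrix, and the sum of the weights over the tuples
  that generate \<open>G\<close> is the expected number of surjections from the cokernel onto \<open>G\<close>.
\<close>

definition gen_weight :: "('g, 'b) monoid_scheme \<Rightarrow> (nat \<Rightarrow> nat set) \<Rightarrow> nat \<Rightarrow> (nat \<Rightarrow> 'g) \<Rightarrow> real" where
  "gen_weight G \<sigma> n g = (\<Prod>j=1..n. 1 / real (card (generate G (g ` \<sigma> j))))"

definition gen_tuples :: "('g, 'b) monoid_scheme \<Rightarrow> nat set \<Rightarrow> 'g set \<Rightarrow> (nat \<Rightarrow> 'g) set" where
  "gen_tuples G I H = {g \<in> PiE I (\<lambda>_. H). generate G (g ` I) = H}"

definition surj_moment :: "('g, 'b) monoid_scheme \<Rightarrow> (nat \<Rightarrow> nat set) \<Rightarrow> nat \<Rightarrow> real" where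
  "surj_moment G \<sigma> n = (\<Sum>g\<in>gen_tuples G {1..n} (carrier G). gen_weight G \<sigma> n g)"

lemma gen_weight_nonneg: "gen_weight G \<sigma> n g \<ge> 0"
  unfolding gen_weight_def by (intro prod_nonneg) auto

lemma gen_weight_Suc:
  "gen_weight G \<sigma> (Suc n) g = gen_weight G \<sigma> n g / real (card (generate G (g ` \<sigma> (Suc n))))"
  by (simp add: gen_weight_def)

lemma gen_weight_restrict:
  assumes "\<And>i. 1 \<le> i \<Longrightarrow> i \<le> n \<Longrightarrow> \<sigma> i \<subseteq> A"
  shows "gen_weight G \<sigma> n (restrict g A) = gen_weight G \<sigma> n g"
  unfolding gen_weight_def
proof (intro prod.cong refl)
  fix i assume "i \<in> {1..n}"
  then have "restrict g A ` \<sigma> i = g ` \<sigma> i" using assms[of i] by (intro image_cong) auto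
  then show "1 / real (card (generate G (restrict g A ` \<sigma> i))) = 1 / real (card (generate G (g ` \<sigma> i)))" by simp
qed

context comm_group
begin

lemma finite_subgroups: "finite (carrier G) \<Longrightarrow> finite {H. subgroup H G}"
  by (rule finite_subset[of _ "Pow (carrier G)"]) (auto dest: subgroup.subset)

lemma card_proper_subgroup_le:
  assumes "finite (carrier G)" "prime (p::nat)" "order G = p ^ k"
    and H: "subgroup H G" "subgroup H' G" "H' \<subset> H"
  shows "p * card H' \<le> card H"
proof -
  have finH: "finite H" using subgroup.subset[OF H(1)] assms(1) by (rule finite_subset)
  have dvd: "card H' dvd card H"
  proof -
    interpret K: group "G\<lparr>carrier := H\<rparr>" using H(1) by (rule subgroup_imp_group)
    have "subgroup H' (G\<lparr>carrier := H\<rparr>)" using H subgroup_incl by blast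
    from K.lagrange[OF this] show ?thesis by (simp add: order_def) (metis dvd_triv_right)
  qed
  have "card H dvd p ^ k" using lagrange[OF H(1)] assms(3) by (metis dvd_triv_right)
  then obtain a where a: "card H = p ^ a" using assms(2) divides_primepow_nat by blast
  then obtain b where b: "card H' = p ^ b" using dvd assms(2) divides_primepow_nat by metis
  have "card H' < card H" using psubset_card_mono[OF finH H(3)] .
  then have "b < a" using a b prime_gt_1_nat[OF assms(2)] by simp
  then have "p ^ Suc b \<le> p ^ a" using prime_gt_0_nat[OF assms(2)] by (intro power_increasing) auto
  then show ?thesis using a b by simp
qed

lemma sum_PiE_by_generated_subgroup:
  fixes f :: "(nat \<Rightarrow> 'a) \<Rightarrow> real"
  assumes fin: "finite (carrier G)" "finite A" and H: "subgroup H G"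
  shows "(\<Sum>g\<in>PiE A (\<lambda>_. H). f g) = (\<Sum>H' | subgroup H' G \<and> H' \<subseteq> H. \<Sum>g\<in>gen_tuples G A H'. f g)"
proof -
  have finH: "finite H" using subgroup.subset[OF H] fin(1) by (rule finite_subset)
  have "(\<Sum>g\<in>PiE A (\<lambda>_. H). f g) =
    (\<Sum>H' | subgroup H' G \<and> H' \<subseteq> H. \<Sum>g\<in>{g \<in> PiE A (\<lambda>_. H). generate G (g ` A) = H'}. f g)"
  proof (rule sum.group[symmetric])
    show "finite (PiE A (\<lambda>_. H))" using fin finH by (intro finite_PiE) auto
    show "finite {H'. subgroup H' G \<and> H' \<subseteq> H}"
      using finite_subgroups[OF fin(1)] by (rule rev_finite_subset) auto
    show "(\<lambda>g. generate G (g ` A)) ` PiE A (\<lambda>_. H) \<subseteq> {H'. subgroup H' G \<and> H' \<subseteq> H}"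
    proof clarify
      fix g assume "g \<in> PiE A (\<lambda>_. H)"
      then have gA: "g ` A \<subseteq> H" by (auto simp: PiE_iff)
      then show "subgroup (generate G (g ` A)) G \<and> generate G (g ` A) \<subseteq> H"
        using generate_subgroup_incl[OF gA H] generate_is_subgroup[of "g ` A"] subgroup.subset[OF H] by blast
    qed
  qed
  also have "\<dots> = (\<Sum>H' | subgroup H' G \<and> H' \<subseteq> H. \<Sum>g\<in>gen_tuples G A H'. f g)"
  proof (intro sum.cong refl)
    fix H' assume "H' \<in> {H'. subgroup H' G \<and> H' \<subseteq> H}"
    then show "{g \<in> PiE A (\<lambda>_. H). generate G (g ` A) = H'} = gen_tuples G A H'"
      unfolding gen_tuples_def by (auto simp: PiE_iff intro: generate.incl)
  qed
  finally show ?thesis .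
qed

text \<open>
  Induction on \<open>n\<close>, for all subgroups \<open>H\<close> at once.  If \<open>\<sigma>\<close> does not change at a step, neither do
  the tuples, and the new factor \<open>1 / card H\<close> is accounted for by the exponent.  If \<open>\<sigma>\<close> grows, the
  old part of a tuple generates some subgroup \<open>H'\<close> of \<open>H\<close>.  The case \<open>H' = H\<close> contributes the
  bound for \<open>n\<close>; each of the proper subgroups is smaller by a factor \<open>p\<close> at least, and
  contributes at most \<open>p ^ (card (\<sigma> n) - n)\<close> times less.
\<close>

lemma gen_tuples_sum_le:
  assumes fin: "finite (carrier G)" and p: "prime (p::nat)" "order G = p ^ k"
    and \<sigma>: "\<And>j. j \<in> {1..n} \<Longrightarrow> finite (\<sigma> j)"
    and mono: "\<And>i j. 1 \<le> i \<Longrightarrow> i \<le> j \<Longrightarrow> j \<le> n \<Longrightarrow> \<sigma> i \<subseteq> \<sigma> j"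
    and large: "\<And>j. j \<in> {1..n} \<Longrightarrow> j \<le> card (\<sigma> j)"
    and n: "1 \<le> n" and H: "subgroup H G"
  shows "(\<Sum>g\<in>gen_tuples G (\<sigma> n) H. gen_weight G \<sigma> n g) \<le> real (card H) ^ (card (\<sigma> n) - n) *
    (\<Prod>i | i \<in> {1..<n} \<and> \<sigma> (Suc i) \<noteq> \<sigma> i.
       1 + real (card {H. subgroup H G}) / real p ^ (card (\<sigma> i) - i))"
  using n \<sigma> mono large H
proof (induction n arbitrary: H rule: nat_induct_at_least)
  case base
  have finH: "finite H" using subgroup.subset[OF base(4)] fin by (rule finite_subset)
  have cH: "0 < card H" using base(4) fin subgroup.finite_imp_card_positive by blast
  have "(\<Sum>g\<in>gen_tuples G (\<sigma> 1) H. gen_weight G \<sigma> 1 g) = (\<Sum>g\<in>gen_tuples G (\<sigma> 1) H. 1 / card H)"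
    by (intro sum.cong refl) (auto simp: gen_weight_def gen_tuples_def)
  also have "\<dots> \<le> (\<Sum>g\<in>PiE (\<sigma> 1) (\<lambda>_. H). 1 / card H)"
    using base(1) finH by (intro sum_mono2 finite_PiE) (auto simp: gen_tuples_def)
  also have "\<dots> = real (card H) ^ card (\<sigma> 1) / card H"
    using base(1) by (simp add: card_PiE)
  also have "\<dots> = real (card H) ^ (card (\<sigma> 1) - 1)"
    using base(3)[of 1] cH by (simp add: power_diff)
  finally show ?case by simp
next
  case (Suc n H)
  define C where "C = real (card {H. subgroup H G})"
  define e where "e = card (\<sigma> n) - n"
  define B where "B m = (\<Prod>i | i \<in> {1..<m} \<and> \<sigma> (Suc i) \<noteq> \<sigma> i. 1 + C / real p ^ (card (\<sigma> i) - i))" for m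
  define W where "W H' = (\<Sum>g\<in>gen_tuples G (\<sigma> n) H'. gen_weight G \<sigma> n g)" for H'
  have IH: "W H' \<le> real (card H') ^ e * B n" if "subgroup H' G" for H'
    unfolding W_def B_def C_def e_def using Suc.prems that by (intro Suc.IH) auto
  have finH: "finite H" using subgroup.subset[OF Suc.prems(4)] fin by (rule finite_subset)
  have cH: "0 < card H" using Suc.prems(4) fin subgroup.finite_imp_card_positive by blast
  have B0: "B m \<ge> 0" for m unfolding B_def C_def by (intro prod_nonneg) auto
  have fS: "finite (\<sigma> (Suc n))" "finite (\<sigma> n)" using Suc.prems(1) Suc.hyps by auto
  have sub: "\<sigma> n \<subseteq> \<sigma> (Suc n)" using Suc.prems(2)[of n "Suc n"] Suc.hyps by auto
  have large: "Suc n \<le> card (\<sigma> (Suc n))" "n \<le> card (\<sigma> n)" using Suc.prems(3) Suc.hyps by auto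
  have eq: "(\<Sum>g\<in>gen_tuples G (\<sigma> (Suc n)) H. gen_weight G \<sigma> (Suc n) g) =
     (\<Sum>g\<in>gen_tuples G (\<sigma> (Suc n)) H. gen_weight G \<sigma> n g) / card H"
    by (simp add: gen_weight_Suc gen_tuples_def sum_divide_distrib)
  show ?case
  proof (cases "\<sigma> (Suc n) = \<sigma> n")
    case True
    have "{i. i \<in> {1..<Suc n} \<and> \<sigma> (Suc i) \<noteq> \<sigma> i} = {i. i \<in> {1..<n} \<and> \<sigma> (Suc i) \<noteq> \<sigma> i}"
      using True less_Suc_eq by auto
    then have BS: "B (Suc n) = B n" by (simp add: B_def)
    have "W H / card H \<le> real (card H) ^ e * B n / card H"
      using IH[OF Suc.prems(4)] by (intro divide_right_mono) auto
    also have "\<dots> = real (card H) ^ (card (\<sigma> (Suc n)) - Suc n) * B (Suc n)"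
    proof -
      have "e = Suc (card (\<sigma> (Suc n)) - Suc n)" using large True unfolding e_def by simp
      then show ?thesis using cH BS by simp
    qed
    finally show ?thesis unfolding eq using True by (simp add: W_def B_def C_def)
  next
    case False
    define t where "t = card (\<sigma> (Suc n) - \<sigma> n)"
    have t: "t = card (\<sigma> (Suc n)) - card (\<sigma> n)" unfolding t_def using sub fS by (simp add: card_Diff_subset)
    have tpos: "t > 0" unfolding t_def using False sub fS by (auto simp: card_gt_0_iff)
    have "{i. i \<in> {1..<Suc n} \<and> \<sigma> (Suc i) \<noteq> \<sigma> i} = insert n {i. i \<in> {1..<n} \<and> \<sigma> (Suc i) \<noteq> \<sigma> i}"
      using False Suc.hyps by auto
    then have BS: "B (Suc n) = (1 + C / real p ^ e) * B n" by (simp add: B_def e_def)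
    have "(\<Sum>g\<in>gen_tuples G (\<sigma> (Suc n)) H. gen_weight G \<sigma> n g)
       \<le> (\<Sum>g\<in>PiE (\<sigma> (Suc n)) (\<lambda>_. H). gen_weight G \<sigma> n g)"
      using fS finH by (intro sum_mono2 finite_PiE) (auto simp: gen_tuples_def gen_weight_nonneg)
    also have "\<dots> = (\<Sum>g\<in>PiE (\<sigma> (Suc n)) (\<lambda>_. H). gen_weight G \<sigma> n (restrict g (\<sigma> n)))"
      using Suc.prems(2) by (intro sum.cong refl gen_weight_restrict[symmetric]) auto
    also have "\<dots> = real (card H) ^ t * (\<Sum>g\<in>PiE (\<sigma> n) (\<lambda>_. H). gen_weight G \<sigma> n g)"
      unfolding t_def by (rule sum_PiE_restrict[OF sub fS(1) finH])
    also have "(\<Sum>g\<in>PiE (\<sigma> n) (\<lambda>_. H). gen_weight G \<sigma> n g) = (\<Sum>H' | subgroup H' G \<and> H' \<subseteq> H. W H')"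
      unfolding W_def by (rule sum_PiE_by_generated_subgroup[OF fin fS(2) Suc.prems(4)])
    also have "\<dots> \<le> (\<Sum>H' | subgroup H' G \<and> H' \<subseteq> H. real (card H') ^ e * B n)"
      by (intro sum_mono IH) auto
    also have "\<dots> = real (card H) ^ e * B n + (\<Sum>H' | subgroup H' G \<and> H' \<subset> H. real (card H') ^ e * B n)"
    proof -
      have "{H'. subgroup H' G \<and> H' \<subseteq> H} = insert H {H'. subgroup H' G \<and> H' \<subset> H}"
        using Suc.prems(4) by auto
      moreover have "finite {H'. subgroup H' G \<and> H' \<subset> H}"
        using finite_subgroups[OF fin] by (rule rev_finite_subset) auto
      ultimately show ?thesis by simp
    qed
    also have "(\<Sum>H' | subgroup H' G \<and> H' \<subset> H. real (card H') ^ e * B n)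
      \<le> (\<Sum>H' | subgroup H' G \<and> H' \<subset> H. (real (card H) / p) ^ e * B n)"
    proof (intro sum_mono mult_right_mono power_mono B0)
      fix H' assume "H' \<in> {H'. subgroup H' G \<and> H' \<subset> H}"
      then have "p * card H' \<le> card H"
        using card_proper_subgroup_le[OF fin p Suc.prems(4)] by auto
      then have "real p * real (card H') \<le> real (card H)" by (metis of_nat_le_iff of_nat_mult)
      then show "real (card H') \<le> real (card H) / p"
        using prime_gt_0_nat[OF p(1)] by (simp add: field_simps)
    qed auto
    also have "\<dots> = real (card {H'. subgroup H' G \<and> H' \<subset> H}) * ((real (card H) / p) ^ e * B n)" by simp
    also have "\<dots> \<le> C * ((real (card H) / p) ^ e * B n)"
      unfolding C_def using finite_subgroups[OF fin] B0
      by (intro mult_right_mono) (auto intro!: card_mono)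
    also have "real (card H) ^ e * B n + C * ((real (card H) / p) ^ e * B n) = real (card H) ^ e * B (Suc n)"
      unfolding BS by (simp add: field_simps power_divide)
    finally have "(\<Sum>g\<in>gen_tuples G (\<sigma> (Suc n)) H. gen_weight G \<sigma> n g) 
      \<le> real (card H) ^ t * (real (card H) ^ e * B (Suc n))" 
      by (simp add: mult_left_mono)
    then have "(\<Sum>g\<in>gen_tuples G (\<sigma> (Suc n)) H. gen_weight G \<sigma> n g) / card H
      \<le> real (card H) ^ t * (real (card H) ^ e * B (Suc n)) / card H"
      by (intro divide_right_mono) auto
    also have "\<dots> = real (card H) ^ (card (\<sigma> (Suc n)) - Suc n) * B (Suc n)"
    proof -
      have "t + e = Suc (card (\<sigma> (Suc n)) - Suc n)"
        using large tpos t card_mono[OF fS(1) sub] unfolding e_def by linarith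
      then have "real (card H) ^ t * real (card H) ^ e = real (card H) ^ (card (\<sigma> (Suc n)) - Suc n) * card H"
        by (simp flip: power_add)
      moreover have "a * (b * x) / d = c * x" if "a * b = c * d" "d \<noteq> 0" for a b c d x :: real
        using that by (simp add: mult.assoc[symmetric])
      ultimately show ?thesis using cH by simp
    qed
    finally show ?thesis unfolding eq by (simp add: B_def C_def)
  qed
qed

lemma surj_moment_le:
  assumes fin: "finite (carrier G)" and p: "prime (p::nat)" "order G = p ^ k"
    and \<sigma>: "\<And>j. j \<in> {1..n} \<Longrightarrow> \<sigma> j \<subseteq> {1..n}"
    and mono: "\<And>i j. 1 \<le> i \<Longrightarrow> i \<le> j \<Longrightarrow> j \<le> n \<Longrightarrow> \<sigma> i \<subseteq> \<sigma> j"
    and large: "\<And>j. j \<in> {1..n} \<Longrightarrow> j \<le> card (\<sigma> j)" and n: "1 \<le> n"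
  shows "surj_moment G \<sigma> n \<le> (\<Prod>i | i \<in> {1..<n} \<and> \<sigma> (Suc i) \<noteq> \<sigma> i.
       1 + real (card {H. subgroup H G}) / real p ^ (card (\<sigma> i) - i))"
proof -
  have "\<sigma> n = {1..n}" using \<sigma>[of n] large[of n] n by (intro card_seteq) auto
  moreover have "finite (\<sigma> j)" if "j \<in> {1..n}" for j using \<sigma>[OF that] finite_subset by blast
  ultimately show ?thesis
    using gen_tuples_sum_le[OF fin p _ mono large n subgroup_self] by (simp add: surj_moment_def)
qed

text \<open>
  Each weight is at least \<open>1 / order G ^ n\<close>, and almost all tuples generate: those that do not
  lie in one of the finitely many proper subgroups.
\<close>

lemma surj_moment_ge:
  assumes fin: "finite (carrier G)" and p: "prime (p::nat)" "order G = p ^ k"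
    and \<sigma>: "\<And>j. j \<in> {1..n} \<Longrightarrow> \<sigma> j \<subseteq> {1..n}"
  shows "surj_moment G \<sigma> n \<ge> 1 - real (card {H. subgroup H G}) / real p ^ n"
proof -
  define c where "c = real (card (carrier G))"
  have c0: "c > 0" using fin one_closed unfolding c_def by (auto simp: card_gt_0_iff)
  have w: "gen_weight G \<sigma> n g \<ge> 1 / c ^ n" if g: "g \<in> gen_tuples G {1..n} (carrier G)" for g
  proof -
    have "(\<Prod>j=1..n. 1 / c) \<le> gen_weight G \<sigma> n g"
      unfolding gen_weight_def
    proof (intro prod_mono conjI)
      fix j assume "j \<in> {1..n}"
      then have "g ` \<sigma> j \<subseteq> carrier G" using g \<sigma>[of j] by (fastforce simp: gen_tuples_def PiE_iff)
      then have s: "subgroup (generate G (g ` \<sigma> j)) G" by (rule generate_is_subgroup)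
      have "0 < card (generate G (g ` \<sigma> j))"
        using subgroup.finite_imp_card_positive[OF s fin] .
      moreover have "card (generate G (g ` \<sigma> j)) \<le> card (carrier G)"
        using subgroup.subset[OF s] fin by (intro card_mono)
      ultimately show "1 / c \<le> 1 / real (card (generate G (g ` \<sigma> j)))"
        unfolding c_def by (intro divide_left_mono) auto
    qed (use c0 in auto)
    then show ?thesis by (simp add: power_divide)
  qed
  have "c ^ n = (\<Sum>g\<in>PiE {1..n} (\<lambda>_. carrier G). 1)" by (simp add: card_PiE c_def)
  also have "\<dots> = (\<Sum>H' | subgroup H' G \<and> H' \<subseteq> carrier G. \<Sum>g\<in>gen_tuples G {1..n} H'. 1)"
    by (rule sum_PiE_by_generated_subgroup[OF fin _ subgroup_self]) simp
  also have "{H'. subgroup H' G \<and> H' \<subseteq> carrier G} = insert (carrier G) {H'. subgroup H' G \<and> H' \<subset> carrier G}"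
    using subgroup_self by (auto dest: subgroup.subset)
  also have "(\<Sum>H'\<in>\<dots>. \<Sum>g\<in>gen_tuples G {1..n} H'. 1::real) = card (gen_tuples G {1..n} (carrier G)) +
     (\<Sum>H' | subgroup H' G \<and> H' \<subset> carrier G. real (card (gen_tuples G {1..n} H')))"
  proof -
    have "finite {H'. subgroup H' G \<and> H' \<subset> carrier G}"
      using finite_subgroups[OF fin] by (rule rev_finite_subset) auto
    then show ?thesis by simp
  qed
  also have "(\<Sum>H' | subgroup H' G \<and> H' \<subset> carrier G. real (card (gen_tuples G {1..n} H')))
    \<le> (\<Sum>H' | subgroup H' G \<and> H' \<subset> carrier G. (c / p) ^ n)"
  proof (intro sum_mono)
    fix H' assume H': "H' \<in> {H'. subgroup H' G \<and> H' \<subset> carrier G}"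
    then have "H' \<subseteq> carrier G" by blast
    then have finH': "finite H'" using fin by (rule finite_subset)
    have "card (gen_tuples G {1..n} H') \<le> card (PiE {1..n} (\<lambda>_. H'))"
      using finH' by (intro card_mono finite_PiE) (auto simp: gen_tuples_def)
    also have "\<dots> = card H' ^ n" by (simp add: card_PiE)
    finally have "real (card (gen_tuples G {1..n} H')) \<le> real (card H') ^ n" by (metis of_nat_le_iff of_nat_power)
    also have "\<dots> \<le> (c / p) ^ n"
    proof (intro power_mono)
      have "p * card H' \<le> card (carrier G)"
        using H' card_proper_subgroup_le[OF fin p subgroup_self] by auto
      then have "real p * real (card H') \<le> c" unfolding c_def by (metis of_nat_le_iff of_nat_mult)
      then show "real (card H') \<le> c / p"
        using prime_gt_0_nat[OF p(1)] by (simp add: field_simps)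
    qed auto
    finally show "real (card (gen_tuples G {1..n} H')) \<le> (c / p) ^ n" .
  qed
  also have "\<dots> = real (card {H'. subgroup H' G \<and> H' \<subset> carrier G}) * (c / p) ^ n" by simp
  also have "\<dots> \<le> real (card {H. subgroup H G}) * (c / p) ^ n"
    using finite_subgroups[OF fin] c0 by (intro mult_right_mono) (auto intro!: card_mono)
  finally have "c ^ n \<le> real (card (gen_tuples G {1..n} (carrier G))) + real (card {H. subgroup H G}) * (c / p) ^ n"
    by simp
  then have "(c ^ n - real (card {H. subgroup H G}) * (c / p) ^ n) / c ^ n \<le> real (card (gen_tuples G {1..n} (carrier G))) / c ^ n"
    using c0 by (intro divide_right_mono) auto
  also have "(c ^ n - real (card {H. subgroup H G}) * (c / p) ^ n) / c ^ n = 1 - real (card {H. subgroup H G}) / real p ^ n"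
    using c0 by (simp add: power_divide diff_divide_distrib)
  also have "real (card (gen_tuples G {1..n} (carrier G))) / c ^ n = (\<Sum>g\<in>gen_tuples G {1..n} (carrier G). 1 / c ^ n)" by simp
  also have "\<dots> \<le> surj_moment G \<sigma> n" unfolding surj_moment_def by (intro sum_mono w)
  finally show ?thesis .
qed

end

section \<open>The probability of being nonsingular modulo p\<close>

text \<open>
  If the columns of a random square matrix over the field with \<open>p\<close> elements have nested supports of
  sizes \<open>s 1 \<le> \<dots> \<le> s n\<close>, the matrix is invertible with this probability: the \<open>j\<close>-th column has to
  avoid the span of the \<open>j - 1\<close> columns before it.  The maximum covers the case \<open>s j < j\<close>, in which
  no matrix is invertible.
\<close>

definition nonsingular_prob :: "nat \<Rightarrow> (nat \<Rightarrow> nat) \<Rightarrow> nat \<Rightarrow> real" where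
  "nonsingular_prob p s n = (\<Prod>j=1..n. max 0 (1 - real p ^ (j - 1) / real p ^ s j))"

lemma nonsingular_prob_pos_imp_le:
  assumes "p > 1" "nonsingular_prob p s n > 0" "j \<in> {1..n}"
  shows "j \<le> s j"
proof (rule ccontr)
  assume "\<not> j \<le> s j"
  then have "real p ^ s j \<le> real p ^ (j - 1)" using assms(1) by (intro power_increasing) auto
  then have "max 0 (1 - real p ^ (j - 1) / real p ^ s j) = 0" using assms(1) by (simp add: field_simps)
  then have "nonsingular_prob p s n = 0"
    unfolding nonsingular_prob_def using assms(3) by (intro prod_zero) auto
  then show False using assms(2) by simp
qed

text \<open>
  The codimension of the span of the first \<open>j - 1\<close> columns in the space of vectors supported on the
  \<open>j\<close>-th support, for independent columns.
\<close>
definition excess :: "(nat \<Rightarrow> nat) \<Rightarrow> nat \<Rightarrow> nat" where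
  "excess s j = Suc (s j - j)"

lemma nonsingular_prob_eq:
  assumes "p > 1" "\<And>j. j \<in> {1..n} \<Longrightarrow> j \<le> s j"
  shows "nonsingular_prob p s n = (\<Prod>j=1..n. 1 - 1 / real p ^ excess s j)"
  unfolding nonsingular_prob_def
proof (intro prod.cong refl)
  fix j assume j: "j \<in> {1..n}"
  then have "s j = (j - 1) + excess s j" using assms(2)[OF j] by (simp add: excess_def)
  then have "real p ^ s j = real p ^ (j - 1) * real p ^ excess s j" by (metis power_add)
  then have "real p ^ (j - 1) / real p ^ s j = 1 / real p ^ excess s j" using assms(1) by simp
  moreover have "1 / real p ^ excess s j \<le> 1" using assms(1) by simp
  ultimately show "max 0 (1 - real p ^ (j - 1) / real p ^ s j) = 1 - 1 / real p ^ excess s j" by simp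
qed

definition jumps :: "(nat \<Rightarrow> nat) \<Rightarrow> nat \<Rightarrow> nat set" where
  "jumps s n = {i \<in> {1..<n}. s (Suc i) \<noteq> s i}"

text \<open>
  From one column to the next the excess falls by at most one, and it ends at \<open>1\<close>, so it takes
  every value below its maximum.  The last column with excess at least \<open>i\<close> has excess exactly \<open>i\<close>,
  and the supports of this column and its successor, if there is one, have the same size.
\<close>

lemma excess_attained:
  assumes "n \<ge> 1" and large: "\<And>j. j \<in> {1..n} \<Longrightarrow> j \<le> s j" and "s n = n"
    and mono: "\<And>i j. 1 \<le> i \<Longrightarrow> i \<le> j \<Longrightarrow> j \<le> n \<Longrightarrow> s i \<le> s j"
    and j0: "j0 \<in> {1..n}" and i: "1 \<le> i" "i \<le> excess s j0"
  shows "\<exists>j\<in>{1..n} - jumps s n. excess s j = i"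
proof -
  define A where "A = {j \<in> {1..n}. i \<le> excess s j}"
  have A: "finite A" "A \<noteq> {}" using j0 i unfolding A_def by auto
  define m where "m = Max A"
  have m: "m \<in> {1..n}" "i \<le> excess s m" using Max_in[OF A] by (auto simp: m_def A_def)
  have later: "excess s j < i" if "m < j" "j \<le> n" for j
  proof (rule ccontr)
    assume "\<not> excess s j < i"
    then have "j \<in> A" using that m by (auto simp: A_def)
    then show False using Max_ge[OF A(1), of j] that by (simp add: m_def)
  qed
  show ?thesis
  proof (cases "m = n")
    case True
    then have "excess s m = 1" using assms(3) by (simp add: excess_def)
    then show ?thesis using m i True by (intro bexI[of _ m]) (auto simp: jumps_def)
  next
    case False
    then have mn: "Suc m \<le> n" using m by simp
    have l: "excess s (Suc m) < i" using later[of "Suc m"] mn by simp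
    have "s m \<le> s (Suc m)" using mono[of m "Suc m"] m mn by simp
    moreover have "m \<le> s m" "Suc m \<le> s (Suc m)" using large[of m] large[of "Suc m"] m mn by auto
    ultimately have "s (Suc m) = s m" "excess s m = i" using l m(2) by (auto simp: excess_def)
    then show ?thesis using m by (intro bexI[of _ m]) (auto simp: jumps_def)
  qed
qed

text \<open>
  The columns that \<open>excess_attained\<close> provides, one for each \<open>i\<close> up to any value of the excess, already
  account for a partial product of the Euler product; the jumps are other columns, so that their
  factors come on top.
\<close>

lemma nonsingular_prob_le:
  assumes p: "p > 1" and n: "n \<ge> 1" and large: "\<And>j. j \<in> {1..n} \<Longrightarrow> j \<le> s j" and "s n = n"
    and mono: "\<And>i j. 1 \<le> i \<Longrightarrow> i \<le> j \<Longrightarrow> j \<le> n \<Longrightarrow> s i \<le> s j"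
    and j0: "j0 \<in> {1..n}"
  shows "nonsingular_prob p s n \<le>
    (\<Prod>i=1..excess s j0. 1 - 1 / real p ^ i) * (\<Prod>j\<in>jumps s n. 1 - 1 / real p ^ excess s j)"
proof -
  define x where "x j = 1 - 1 / real p ^ excess s j" for j
  have x: "0 \<le> x j" "x j \<le> 1" for j using p unfolding x_def by auto
  define D where "D = excess s j0"
  have "\<forall>i\<in>{1..D}. \<exists>j. j \<in> {1..n} - jumps s n \<and> excess s j = i"
  proof
    fix i assume "i \<in> {1..D}"
    then show "\<exists>j. j \<in> {1..n} - jumps s n \<and> excess s j = i"
      using excess_attained[OF n large assms(4) mono j0, of i] unfolding D_def by auto
  qed
  then obtain h where h: "\<And>i. i \<in> {1..D} \<Longrightarrow> h i \<in> {1..n} - jumps s n \<and> excess s (h i) = i"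
    by metis
  have inj: "inj_on h {1..D}" by (rule inj_onI) (metis h)
  have J: "jumps s n \<subseteq> {1..n}" by (auto simp: jumps_def)
  then have fJ: "finite (jumps s n)" using finite_subset by blast
  have hJ: "h ` {1..D} \<union> jumps s n \<subseteq> {1..n}" using h J by blast
  have "nonsingular_prob p s n = prod x {1..n}"
    unfolding x_def by (rule nonsingular_prob_eq[OF p large])
  also have "\<dots> = prod x ({1..n} - (h ` {1..D} \<union> jumps s n)) * prod x (h ` {1..D} \<union> jumps s n)"
    by (rule prod.subset_diff[OF hJ]) simp
  also have "\<dots> \<le> 1 * prod x (h ` {1..D} \<union> jumps s n)"
    using x by (intro mult_right_mono prod_le_1 prod_nonneg) auto
  also have "\<dots> = prod x (h ` {1..D}) * prod x (jumps s n)"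
    using h fJ by (simp, intro prod.union_disjoint) auto
  also have "prod x (h ` {1..D}) = (\<Prod>i=1..D. x (h i))"
    using prod.reindex[OF inj, of x] by (simp add: o_def)
  also have "\<dots> = (\<Prod>i=1..D. 1 - 1 / real p ^ i)"
    using h by (intro prod.cong refl) (simp add: x_def)
  finally show ?thesis by (simp add: x_def D_def)
qed

lemma prod_one_plus_le:
  fixes x :: "'a \<Rightarrow> real"
  assumes "finite J" and x: "\<And>i. i \<in> J \<Longrightarrow> 0 \<le> x i \<and> x i < 1"
  shows "(\<Prod>i\<in>J. 1 + real m * x i) \<le> (1 / (\<Prod>i\<in>J. 1 - x i)) ^ m"
proof -
  have "(\<Prod>i\<in>J. 1 + real m * x i) \<le> (\<Prod>i\<in>J. (1 / (1 - x i)) ^ m)"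
  proof (intro prod_mono conjI)
    fix i assume "i \<in> J"
    then have xi: "0 \<le> x i" "x i < 1" using x by auto
    then show "0 \<le> 1 + real m * x i" by simp
    have "1 + real m * x i \<le> (1 + x i) ^ m" using xi by (intro Bernoulli_inequality) auto
    also have "1 + x i \<le> 1 / (1 - x i)"
    proof -
      have "(1 + x i) * (1 - x i) \<le> 1" by (simp add: algebra_simps)
      then show ?thesis using xi by (simp add: pos_le_divide_eq)
    qed
    then have "(1 + x i) ^ m \<le> (1 / (1 - x i)) ^ m" using xi by (intro power_mono) auto
    finally show "1 + real m * x i \<le> (1 / (1 - x i)) ^ m" .
  qed
  also have "\<dots> = (1 / (\<Prod>i\<in>J. 1 - x i)) ^ m"
    by (simp add: prod_power_distrib[symmetric] prod_dividef)
  finally show ?thesis .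
qed

text \<open>
  The limiting probability that a full random square matrix over the field with \<open>p\<close> elements is
  invertible.
\<close>

definition euler_prod :: "nat \<Rightarrow> real" where
  "euler_prod p = (\<Prod>i. 1 - 1 / real p ^ Suc i)"

lemma
  assumes "p > 1"
  shows euler_prod_LIMSEQ: "(\<lambda>D. \<Prod>i=1..D. 1 - 1 / real p ^ i) \<longlonglongrightarrow> euler_prod p"
    and euler_prod_pos: "euler_prod p > 0"
proof -
  let ?f = "\<lambda>i. 1 - 1 / real p ^ Suc i"
  have f: "0 < ?f i" "?f i \<le> 1" for i
  proof -
    have "1 < real p ^ Suc i" using assms by (intro one_less_power) auto
    then show "0 < ?f i" "?f i \<le> 1" by (simp_all add: field_simps)
  qed
  have "summable (\<lambda>i. (1 / real p) ^ Suc i)"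
    using assms by (subst summable_Suc_iff) (auto intro!: summable_geometric)
  then have "summable (\<lambda>i. norm (?f i - 1))" by (simp add: power_divide)
  then have conv: "convergent_prod ?f"
    by (intro abs_convergent_prod_imp_convergent_prod summable_imp_abs_convergent_prod)
  have "(\<lambda>n. \<Prod>i\<le>n. ?f i) \<longlonglongrightarrow> euler_prod p"
    unfolding euler_prod_def by (rule convergent_prod_LIMSEQ[OF conv])
  then have "(\<lambda>n. \<Prod>i<n. ?f i) \<longlonglongrightarrow> euler_prod p" by (simp add: LIMSEQ_lessThan_iff_atMost)
  moreover have "(\<Prod>i<D. ?f i) = (\<Prod>i=1..D. 1 - 1 / real p ^ i)" for D
    by (rule prod.reindex_bij_witness[where i = "\<lambda>i. i - 1" and j = Suc]) auto
  ultimately show "(\<lambda>D. \<Prod>i=1..D. 1 - 1 / real p ^ i) \<longlonglongrightarrow> euler_prod p" by simp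
  show "euler_prod p > 0"
    unfolding euler_prod_def using f(1) by (rule less_0_prodinf[OF conv])
qed

text \<open>
  If the nonsingularity probability \<open>Q n\<close> tends to the Euler product, the maximal excess \<open>D n\<close> tends to
  infinity: a product of \<open>n\<close> factors, each at most \<open>1 - 1 / p ^ D n\<close>, would otherwise come close to
  \<open>0\<close>.  Hence the partial Euler product up to \<open>D n\<close> has the same limit as \<open>Q n\<close>, and by
  \<open>nonsingular_prob_le\<close> the factors that belong to the jumps have a product that tends to \<open>1\<close>.
  By \<open>prod_one_plus_le\<close> that controls the error product in the bound for the expected number of
  surjections.
\<close>

lemma jump_product_bound:
  fixes s :: "nat \<Rightarrow> nat \<Rightarrow> nat" and C :: nat
  assumes p: "p > 1"
    and mono: "\<And>n i j. 1 \<le> i \<Longrightarrow> i \<le> j \<Longrightarrow> j \<le> n \<Longrightarrow> s n i \<le> s n j"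
    and bound: "\<And>n j. j \<in> {1..n} \<Longrightarrow> s n j \<le> n"
    and lim: "(\<lambda>n. nonsingular_prob p (s n) n) \<longlonglongrightarrow> euler_prod p"
  shows "\<exists>B. B \<longlonglongrightarrow> 1 \<and> (\<forall>\<^sub>F n in sequentially. (\<forall>j\<in>{1..n}. j \<le> s n j) \<and>
     (\<Prod>i\<in>jumps (s n) n. 1 + real C / real p ^ (s n i - i)) \<le> B n)"
proof -
  define Q where "Q n = nonsingular_prob p (s n) n" for n
  define c where "c = euler_prod p"
  define P where "P D = (\<Prod>i=1..D. 1 - 1 / real p ^ i)" for D
  define D where "D n = Max (excess (s n) ` {1..n})" for n
  have c0: "c > 0" unfolding c_def by (rule euler_prod_pos[OF p])
  have Qlim: "Q \<longlonglongrightarrow> c" using lim unfolding Q_def[abs_def] c_def .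
  have Qpos: "\<forall>\<^sub>F n in sequentially. Q n > c / 2"
    using order_tendstoD(1)[OF Qlim, of "c / 2"] c0 by simp
  have dn: "D n \<in> excess (s n) ` {1..n}" if "n \<ge> 1" for n
    unfolding D_def using that by (intro Max_in) auto
  have large: "j \<le> s n j" if "Q n > c / 2" "j \<in> {1..n}" for n j
    using nonsingular_prob_pos_imp_le[OF p _ that(2), of "s n"] that(1) c0 unfolding Q_def by simp
  have Qle: "Q n \<le> P (D n) * (\<Prod>j\<in>jumps (s n) n. 1 - 1 / real p ^ excess (s n) j)"
    if n: "n \<ge> 1" "Q n > c / 2" for n
  proof -
    obtain j0 where j0: "j0 \<in> {1..n}" "D n = excess (s n) j0" using dn[OF n(1)] by auto
    have "s n n = n" using bound[of n n] large[OF n(2), of n] n(1) by simp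
    from nonsingular_prob_le[where s = "s n", OF p n(1) large[OF n(2)] this mono j0(1)]
    show ?thesis unfolding Q_def P_def j0(2) by simp
  qed
  have Qpow: "Q n \<le> (1 - 1 / real p ^ D n) ^ n" if "n \<ge> 1" "Q n > c / 2" for n
  proof -
    have "Q n = (\<Prod>j=1..n. 1 - 1 / real p ^ excess (s n) j)"
      unfolding Q_def by (rule nonsingular_prob_eq[OF p large[OF that(2)]])
    also have "\<dots> \<le> (\<Prod>j=1..n. 1 - 1 / real p ^ D n)"
    proof (intro prod_mono conjI)
      fix j assume j: "j \<in> {1..n}"
      have "excess (s n) j \<le> D n" unfolding D_def using j by (intro Max_ge) auto
      then have "real p ^ excess (s n) j \<le> real p ^ D n" using p by (intro power_increasing) auto
      then show "1 - 1 / real p ^ excess (s n) j \<le> 1 - 1 / real p ^ D n"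
        using p by (simp add: frac_le)
      show "0 \<le> 1 - 1 / real p ^ excess (s n) j" using p by simp
    qed
    finally show ?thesis by simp
  qed
  have "filterlim D at_top sequentially"
    unfolding filterlim_at_top
  proof
    fix k
    have "(\<lambda>n. (1 - 1 / real p ^ k) ^ n) \<longlonglongrightarrow> 0"
      using p by (intro LIMSEQ_power_zero) (auto simp: field_simps)
    then have "\<forall>\<^sub>F n in sequentially. (1 - 1 / real p ^ k) ^ n < c / 2"
      using order_tendstoD(2)[of _ 0 _ "c / 2"] c0 by simp
    then show "\<forall>\<^sub>F n in sequentially. k \<le> D n"
      using Qpos eventually_ge_at_top[of 1]
    proof eventually_elim
      case (elim n)
      show ?case
      proof (rule ccontr)
        assume "\<not> k \<le> D n"
        then have "real p ^ D n \<le> real p ^ k" using p by (intro power_increasing) auto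
        then have "1 - 1 / real p ^ D n \<le> 1 - 1 / real p ^ k" using p by (simp add: frac_le)
        then have "(1 - 1 / real p ^ D n) ^ n \<le> (1 - 1 / real p ^ k) ^ n"
          using p by (intro power_mono) auto
        then show False using Qpow[OF elim(3,2)] elim by simp
      qed
    qed
  qed
  then have "(\<lambda>n. P (D n)) \<longlonglongrightarrow> c"
    using filterlim_compose[OF euler_prod_LIMSEQ[OF p]] unfolding P_def c_def by blast
  then have "(\<lambda>n. (P (D n) / Q n) ^ (C * p)) \<longlonglongrightarrow> (c / c) ^ (C * p)"
    using Qlim c0 by (intro tendsto_intros) auto
  then have "(\<lambda>n. (P (D n) / Q n) ^ (C * p)) \<longlonglongrightarrow> 1" using c0 by simp
  moreover have "\<forall>\<^sub>F n in sequentially. (\<forall>j\<in>{1..n}. j \<le> s n j) \<and>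
     (\<Prod>i\<in>jumps (s n) n. 1 + real C / real p ^ (s n i - i)) \<le> (P (D n) / Q n) ^ (C * p)"
    using Qpos eventually_ge_at_top[of 1]
  proof eventually_elim
    case (elim n)
    define R where "R = (\<Prod>j\<in>jumps (s n) n. 1 - 1 / real p ^ excess (s n) j)"
    have fJ: "finite (jumps (s n) n)" by (simp add: jumps_def)
    have x: "0 \<le> 1 / real p ^ excess (s n) i \<and> 1 / real p ^ excess (s n) i < 1" for i
    proof -
      have "1 < real p ^ excess (s n) i" using p unfolding excess_def by (intro one_less_power) auto
      moreover from this have "0 < real p ^ excess (s n) i" by linarith
      ultimately show ?thesis by (simp only: divide_less_eq_1_pos zero_le_divide_1_iff less_imp_le)
    qed
    have R: "R > 0" unfolding R_def using x by (intro prod_pos) auto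
    \<comment> \<open>One factor \<open>p\<close> of the exponent \<open>C * p\<close> makes up for the shift by one between \<open>s n i - i\<close> and the excess.\<close>
    have "(\<Prod>i\<in>jumps (s n) n. 1 + real C / real p ^ (s n i - i)) =
       (\<Prod>i\<in>jumps (s n) n. 1 + real (C * p) * (1 / real p ^ excess (s n) i))"
      using p by (intro prod.cong refl) (simp add: excess_def)
    also have "\<dots> \<le> (1 / R) ^ (C * p)"
      unfolding R_def using prod_one_plus_le[OF fJ x] .
    also have "\<dots> \<le> (P (D n) / Q n) ^ (C * p)"
    proof (intro power_mono)
      have "Q n > 0" using elim c0 by linarith
      then show "1 / R \<le> P (D n) / Q n"
        using Qle[OF elim(2,1)] R by (simp add: R_def[symmetric] field_simps)
    qed (use R in auto)
    finally show ?case using large[OF elim(1)] by blast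
  qed
  ultimately show ?thesis by blast
qed

section \<open>Random generators of kernels over the integers modulo p^N\<close>

definition Zmod_pow :: "int \<Rightarrow> nat \<Rightarrow> (nat \<Rightarrow> int) monoid" where
  "Zmod_pow q n = product_group {1..n} (\<lambda>_. add_monoid (residue_ring q))"

definition supported_on :: "int \<Rightarrow> nat \<Rightarrow> nat set \<Rightarrow> (nat \<Rightarrow> int) set" where
  "supported_on q n \<tau> = {x \<in> carrier (Zmod_pow q n). \<forall>i\<in>{1..n} - \<tau>. x i = 0}"

lemma carrier_Zmod_pow: "carrier (Zmod_pow q n) = PiE {1..n} (\<lambda>_. {0..<q})"
  by (auto simp: Zmod_pow_def residue_ring_def)

lemma mult_Zmod_pow: "x \<otimes>\<^bsub>Zmod_pow q n\<^esub> y = (\<lambda>i\<in>{1..n}. (x i + y i) mod q)"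
  by (simp add: Zmod_pow_def residue_ring_def)

lemma one_Zmod_pow: "\<one>\<^bsub>Zmod_pow q n\<^esub> = (\<lambda>i\<in>{1..n}. 0)"
  by (simp add: Zmod_pow_def residue_ring_def)

lemma comm_group_Zmod_pow:
  assumes "q > 1"
  shows "comm_group (Zmod_pow q n)"
proof -
  interpret R: residues q "residue_ring q" using assms by unfold_locales auto
  have "group (Zmod_pow q n)"
    unfolding Zmod_pow_def by (intro product_group) (rule R.add.is_group)
  then show ?thesis
    by (rule group.group_comm_groupI) (simp add: mult_Zmod_pow add.commute)
qed

lemma finite_Zmod_pow: "finite (carrier (Zmod_pow q n))"
  unfolding carrier_Zmod_pow by (intro finite_PiE) auto

lemma nat_pow_Zmod_pow:
  assumes "q > 1" "x \<in> carrier (Zmod_pow q n)"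
  shows "x [^]\<^bsub>Zmod_pow q n\<^esub> (m::nat) = (\<lambda>i\<in>{1..n}. (int m * x i) mod q)"
proof (induction m)
  case 0
  then show ?case by (simp add: one_Zmod_pow)
next
  case (Suc m)
  then show ?case
    by (auto simp: mult_Zmod_pow fun_eq_iff restrict_def mod_simps algebra_simps)
qed

lemma subgroup_supported_on:
  assumes "q > 1"
  shows "subgroup (supported_on q n \<tau>) (Zmod_pow q n)"
proof -
  interpret R: comm_group "Zmod_pow q n" by (rule comm_group_Zmod_pow[OF assms])
  show ?thesis
  proof (rule R.subgroupI)
    show "supported_on q n \<tau> \<subseteq> carrier (Zmod_pow q n)" by (auto simp: supported_on_def)
    have "\<one>\<^bsub>Zmod_pow q n\<^esub> \<in> supported_on q n \<tau>"
      using R.one_closed by (simp add: supported_on_def) (simp add: one_Zmod_pow)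
    then show "supported_on q n \<tau> \<noteq> {}" by blast
  next
    fix x assume x: "x \<in> supported_on q n \<tau>"
    let ?y = "\<lambda>i\<in>{1..n}. (- x i) mod q"
    have y: "?y \<in> supported_on q n \<tau>" using x assms by (auto simp: supported_on_def carrier_Zmod_pow)
    have "?y \<otimes>\<^bsub>Zmod_pow q n\<^esub> x = \<one>\<^bsub>Zmod_pow q n\<^esub>"
      by (auto simp: mult_Zmod_pow one_Zmod_pow fun_eq_iff mod_add_left_eq)
    then have "inv\<^bsub>Zmod_pow q n\<^esub> x = ?y"
      using x y by (intro R.inv_equality) (auto simp: supported_on_def)
    then show "inv\<^bsub>Zmod_pow q n\<^esub> x \<in> supported_on q n \<tau>" using y by simp
  next
    fix x y assume "x \<in> supported_on q n \<tau>" "y \<in> supported_on q n \<tau>"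
    then show "x \<otimes>\<^bsub>Zmod_pow q n\<^esub> y \<in> supported_on q n \<tau>"
      unfolding supported_on_def by (auto simp: R.m_closed) (simp add: mult_Zmod_pow)
  qed
qed

lemma card_supported_choice:
  fixes \<tau> :: "nat set"
  assumes "\<tau> \<subseteq> {1..n}" "finite A" "(0::int) \<in> A"
  shows "card {x \<in> PiE {1..n} (\<lambda>_. A). \<forall>i\<in>{1..n} - \<tau>. x i = 0} = card A ^ card \<tau>"
proof -
  have "{x \<in> PiE {1..n} (\<lambda>_. A). \<forall>i\<in>{1..n} - \<tau>. x i = 0} = PiE {1..n} (\<lambda>i. if i \<in> \<tau> then A else {0})"
  proof -
    have "x i \<in> (if i \<in> \<tau> then A else {0}) \<longleftrightarrow> x i \<in> A \<and> (i \<notin> \<tau> \<longrightarrow> x i = 0)" for x :: "nat \<Rightarrow> int" and i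
      using assms(3) by auto
    then show ?thesis unfolding set_eq_iff mem_Collect_eq PiE_iff by blast
  qed
  also have "card \<dots> = (\<Prod>i=1..n. if i \<in> \<tau> then card A else 1)"
    by (subst card_PiE) (auto intro!: prod.cong)
  also have "\<dots> = (\<Prod>i\<in>{1..n} \<inter> \<tau>. card A)" using prod.inter_restrict[of "{1..n}" "\<lambda>_. card A" \<tau>] by simp
  also have "{1..n} \<inter> \<tau> = \<tau>" using assms(1) by blast
  finally show ?thesis by simp
qed

lemma card_supported_on:
  assumes "q > 0" "\<tau> \<subseteq> {1..n}"
  shows "card (supported_on q n \<tau>) = nat q ^ card \<tau>"
  unfolding supported_on_def carrier_Zmod_pow using card_supported_choice[OF assms(2), of "{0..<q}"] assms(1) by simp

lemma finite_supported_on: "finite (supported_on q n \<tau>)"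
  using finite_Zmod_pow by (rule rev_finite_subset) (auto simp: supported_on_def)

lemma supported_on_all: "supported_on q n {1..n} = carrier (Zmod_pow q n)"
  by (auto simp: supported_on_def)

lemma (in comm_group) finprod_in_subgroup:
  assumes "subgroup H G" "finite A" "\<And>i. i \<in> A \<Longrightarrow> f i \<in> H"
  shows "finprod G f A \<in> H"
  using assms(2,3)
proof (induction A rule: finite_induct)
  case empty
  then show ?case using assms(1) by (simp add: subgroup.one_closed)
next
  case (insert a A)
  then have "f \<in> A \<rightarrow> carrier G" "f a \<in> carrier G" using subgroup.subset[OF assms(1)] by auto
  then show ?case using insert assms(1) by (simp add: subgroup.m_closed)
qed

text \<open>
  The exponent of \<open>G\<close> divides \<open>p ^ (N - 1)\<close> and not merely the modulus \<open>p ^ N\<close>.  The spare factor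
  \<open>p\<close> puts all elements of order \<open>p\<close> of the free module into the kernel of every homomorphism to
  \<open>G\<close>, so that the kernel, and its intersection with each coordinate subspace, has as many of them
  as in the free case.
\<close>

locale torsion_module = comm_group G for G (structure) +
  fixes p N :: nat
  assumes prime_p: "prime p" and N_pos: "N > 0"
    and exponent: "\<And>x. x \<in> carrier G \<Longrightarrow> x [^] (p ^ (N - 1)) = \<one>"
begin

abbreviation q :: int where "q \<equiv> int p ^ N"

lemma q_gt_1: "q > 1"
  using prime_gt_1_nat[OF prime_p] N_pos by (intro one_less_power) auto

lemma q_eq: "q = int p * int p ^ (N - 1)"
  using N_pos by (metis power_eq_if gr_implies_not0)

lemma pow_q: "x \<in> carrier G \<Longrightarrow> x [^] q = \<one>"
proof -
  assume x: "x \<in> carrier G"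
  have "x [^] q = x [^] (int (p ^ (N - 1)) * int p)" by (simp add: q_eq mult.commute)
  also have "\<dots> = (x [^] (p ^ (N - 1))) [^] p"
    using x by (simp only: int_pow_pow[symmetric] int_pow_int)
  finally show ?thesis using exponent[OF x] by simp
qed

lemma pow_mod_q: "x \<in> carrier G \<Longrightarrow> x [^] (z mod q) = x [^] (z :: int)"
proof -
  assume x: "x \<in> carrier G"
  have "x [^] z = x [^] (q * (z div q) + z mod q)" by simp
  also have "\<dots> = (x [^] q) [^] (z div q) \<otimes> x [^] (z mod q)"
    using x by (simp only: int_pow_mult int_pow_pow)
  finally show ?thesis using x pow_q by simp
qed

text \<open>
  The argument is an arbitrary integer vector, so that the same function serves residues and
  unreduced sums of residues; see \<open>eval_hom_cong\<close>.
\<close>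

definition eval_hom :: "nat \<Rightarrow> (nat \<Rightarrow> 'a) \<Rightarrow> (nat \<Rightarrow> int) \<Rightarrow> 'a" where
  "eval_hom n g x = finprod G (\<lambda>i. g i [^] x i) {1..n}"

lemma eval_hom_closed:
  "g \<in> {1..n} \<rightarrow> carrier G \<Longrightarrow> eval_hom n g x \<in> carrier G"
  unfolding eval_hom_def by (intro finprod_closed) (auto simp: Pi_iff)

lemma eval_hom_cong:
  assumes "g \<in> {1..n} \<rightarrow> carrier G" "\<And>i. i \<in> {1..n} \<Longrightarrow> x i mod q = y i mod q"
  shows "eval_hom n g x = eval_hom n g y"
  unfolding eval_hom_def
proof (rule finprod_cong')
  fix i assume "i \<in> {1..n}"
  then show "g i [^] x i = g i [^] y i"
    using assms pow_mod_q[of "g i" "x i"] pow_mod_q[of "g i" "y i"] by (auto simp: Pi_iff)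
qed (use assms in \<open>auto simp: Pi_iff\<close>)

lemma eval_hom_add:
  assumes "g \<in> {1..n} \<rightarrow> carrier G"
  shows "eval_hom n g (\<lambda>i. x i + y i) = eval_hom n g x \<otimes> eval_hom n g y"
proof -
  have "eval_hom n g (\<lambda>i. x i + y i) = finprod G (\<lambda>i. g i [^] x i \<otimes> g i [^] y i) {1..n}"
    unfolding eval_hom_def using assms by (intro finprod_cong') (auto simp: Pi_iff int_pow_mult)
  then show ?thesis
    unfolding eval_hom_def using assms by (simp add: finprod_multf Pi_iff)
qed

lemma eval_hom_hom:
  assumes g: "g \<in> {1..n} \<rightarrow> carrier G"
  shows "group_hom (Zmod_pow q n) G (eval_hom n g)"
proof -
  interpret R: comm_group "Zmod_pow q n" by (rule comm_group_Zmod_pow[OF q_gt_1])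
  have "eval_hom n g (x \<otimes>\<^bsub>Zmod_pow q n\<^esub> y) = eval_hom n g x \<otimes> eval_hom n g y" for x y
    unfolding eval_hom_add[OF g, symmetric]
    by (rule eval_hom_cong[OF g]) (simp add: mult_Zmod_pow)
  then show ?thesis
    using eval_hom_closed[OF g] by (unfold_locales) (auto simp: hom_def)
qed

lemma eval_hom_unit:
  assumes g: "g \<in> {1..n} \<rightarrow> carrier G" and k: "k \<in> {1..n}"
  shows "eval_hom n g (\<lambda>i\<in>{1..n}. if i = k then 1 else 0) = g k"
proof -
  have "eval_hom n g (\<lambda>i\<in>{1..n}. if i = k then 1 else 0) = finprod G (\<lambda>i. if k = i then g i else \<one>) {1..n}"
    unfolding eval_hom_def using g by (intro finprod_cong') (auto simp: Pi_iff)
  also have "\<dots> = g k" using g k by (intro finprod_singleton) (auto simp: Pi_iff)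
  finally show ?thesis .
qed

lemma eval_hom_image_supported_on:
  assumes g: "g \<in> {1..n} \<rightarrow> carrier G" and \<tau>: "\<tau> \<subseteq> {1..n}"
  shows "eval_hom n g ` supported_on q n \<tau> = generate G (g ` \<tau>)"
proof
  interpret E: group_hom "Zmod_pow q n" G "eval_hom n g" by (rule eval_hom_hom[OF g])
  have g\<tau>: "g ` \<tau> \<subseteq> carrier G" using g \<tau> by auto
  have sub: "subgroup (generate G (g ` \<tau>)) G" by (rule generate_is_subgroup[OF g\<tau>])
  show "eval_hom n g ` supported_on q n \<tau> \<subseteq> generate G (g ` \<tau>)"
  proof clarify
    fix x assume x: "x \<in> supported_on q n \<tau>"
    show "eval_hom n g x \<in> generate G (g ` \<tau>)"
      unfolding eval_hom_def
    proof (rule finprod_in_subgroup[OF sub])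
      fix i assume i: "i \<in> {1..n}"
      show "g i [^] x i \<in> generate G (g ` \<tau>)"
      proof (cases "i \<in> \<tau>")
        case True
        then show ?thesis using sub by (intro subgroup_int_pow_closed) (auto intro: generate.incl)
      next
        case False
        then have "x i = 0" using x i by (auto simp: supported_on_def)
        then show ?thesis by (simp add: generate.one)
      qed
    qed simp
  qed
  show "generate G (g ` \<tau>) \<subseteq> eval_hom n g ` supported_on q n \<tau>"
  proof (rule generate_subgroup_incl)
    show "subgroup (eval_hom n g ` supported_on q n \<tau>) G"
      by (rule E.subgroup_img_is_subgroup[OF subgroup_supported_on[OF q_gt_1]])
    show "g ` \<tau> \<subseteq> eval_hom n g ` supported_on q n \<tau>"
    proof clarify
      fix k assume k: "k \<in> \<tau>"
      let ?e = "\<lambda>i\<in>{1..n}. if i = k then 1 else (0::int)"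
      have "?e \<in> supported_on q n \<tau>"
        using q_gt_1 k prime_gt_0_nat[OF prime_p] by (auto simp: supported_on_def carrier_Zmod_pow)
      moreover have "eval_hom n g ?e = g k" using k \<tau> by (intro eval_hom_unit[OF g]) auto
      ultimately show "g k \<in> eval_hom n g ` supported_on q n \<tau>" by (metis imageI)
    qed
  qed
qed

definition hom_kernel :: "nat \<Rightarrow> (nat \<Rightarrow> 'a) \<Rightarrow> (nat \<Rightarrow> int) set" where
  "hom_kernel n g = {x \<in> carrier (Zmod_pow q n). eval_hom n g x = \<one>}"

lemma subgroup_hom_kernel:
  assumes "g \<in> {1..n} \<rightarrow> carrier G"
  shows "subgroup (hom_kernel n g) (Zmod_pow q n)"
  using group_hom.subgroup_kernel[OF eval_hom_hom[OF assms]] by (simp add: hom_kernel_def kernel_def)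

lemma multiples_in_range:
  "{x \<in> {0..<q}. (int p * x) mod q = 0} = (\<lambda>k. int p ^ (N - 1) * k) ` {0..<int p}"
proof -
  have p0: "int p > 0" "int p ^ (N - 1) > 0" using prime_gt_0_nat[OF prime_p] by auto
  show ?thesis
  proof (rule equalityI; rule subsetI)
    fix x assume "x \<in> {x \<in> {0..<q}. (int p * x) mod q = 0}"
    then have x: "0 \<le> x" "x < int p ^ (N - 1) * int p" "int p * int p ^ (N - 1) dvd int p * x"
      unfolding q_eq by (auto simp: mult.commute dvd_eq_mod_eq_0)
    then have "int p ^ (N - 1) dvd x" using p0 by simp
    then obtain k where k: "x = int p ^ (N - 1) * k" by (elim dvdE)
    then have "0 \<le> k" using x(1) p0(2) by (metis zero_le_mult_iff not_less)
    moreover have "k < int p" using x(2) p0(2) k by simp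
    ultimately have "0 \<le> k" "k < int p" by simp_all
    then show "x \<in> (\<lambda>k. int p ^ (N - 1) * k) ` {0..<int p}" using k by auto
  next
    fix x assume "x \<in> (\<lambda>k. int p ^ (N - 1) * k) ` {0..<int p}"
    then obtain k where k: "x = int p ^ (N - 1) * k" "0 \<le> k" "k < int p" by auto
    then have "int p * x = q * k" by (simp add: q_eq)
    then show "x \<in> {x \<in> {0..<q}. (int p * x) mod q = 0}"
      using k p0 by (auto simp: q_eq mult.commute[of "int p"])
  qed
qed

lemma
  assumes g: "g \<in> {1..n} \<rightarrow> carrier G"
  shows pow_p_one_in_kernel: "\<And>x. x \<in> carrier (Zmod_pow q n) \<Longrightarrow> x [^]\<^bsub>Zmod_pow q n\<^esub> p = \<one>\<^bsub>Zmod_pow q n\<^esub> \<Longrightarrow> x \<in> hom_kernel n g"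
    and card_pow_p_one: "\<tau> \<subseteq> {1..n} \<Longrightarrow>
      card {x \<in> supported_on q n \<tau>. x [^]\<^bsub>Zmod_pow q n\<^esub> p = \<one>\<^bsub>Zmod_pow q n\<^esub>} = p ^ card \<tau>"
proof -
  have p0: "int p ^ (N - 1) > 0" using prime_gt_0_nat[OF prime_p] by auto
  define A where "A = (\<lambda>k. int p ^ (N - 1) * k) ` {0..<int p}"
  have iff: "x \<in> carrier (Zmod_pow q n) \<and> x [^]\<^bsub>Zmod_pow q n\<^esub> p = \<one>\<^bsub>Zmod_pow q n\<^esub> \<longleftrightarrow> x \<in> PiE {1..n} (\<lambda>_. A)" for x
  proof -
    have "x [^]\<^bsub>Zmod_pow q n\<^esub> p = \<one>\<^bsub>Zmod_pow q n\<^esub> \<longleftrightarrow> (\<forall>i\<in>{1..n}. (int p * x i) mod q = 0)"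
      if "x \<in> carrier (Zmod_pow q n)"
      unfolding nat_pow_Zmod_pow[OF q_gt_1 that] one_Zmod_pow by (auto simp: fun_eq_iff restrict_def)
    then show ?thesis
      unfolding A_def multiples_in_range[symmetric] carrier_Zmod_pow by (auto simp: PiE_iff)
  qed
  {
    fix x assume "x \<in> carrier (Zmod_pow q n)" "x [^]\<^bsub>Zmod_pow q n\<^esub> p = \<one>\<^bsub>Zmod_pow q n\<^esub>"
    then have x: "x \<in> carrier (Zmod_pow q n)" "x \<in> PiE {1..n} (\<lambda>_. A)" using iff by auto
    have "g i [^] x i = \<one>" if i: "i \<in> {1..n}" for i
    proof -
      obtain k where k: "x i = int (p ^ (N - 1)) * k" using PiE_mem[OF x(2) i] unfolding A_def of_nat_power by blast
      have gi: "g i \<in> carrier G" using g i by auto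
      have "g i [^] x i = (g i [^] (p ^ (N - 1))) [^] k"
        unfolding k using gi by (simp only: int_pow_pow[symmetric] int_pow_int)
      then show ?thesis using exponent[OF gi] by simp
    qed
    then have "eval_hom n g x = \<one>"
      unfolding eval_hom_def by (intro finprod_one_eqI) auto
    then show "x \<in> hom_kernel n g" using x by (simp add: hom_kernel_def)
  }
  assume \<tau>: "\<tau> \<subseteq> {1..n}"
  have "{x \<in> supported_on q n \<tau>. x [^]\<^bsub>Zmod_pow q n\<^esub> p = \<one>\<^bsub>Zmod_pow q n\<^esub>} =
    {x \<in> PiE {1..n} (\<lambda>_. A). \<forall>i\<in>{1..n} - \<tau>. x i = 0}"
    using iff unfolding supported_on_def by blast
  also have "card \<dots> = card A ^ card \<tau>"
    using prime_gt_0_nat[OF prime_p] by (intro card_supported_choice[OF \<tau>]) (auto simp: A_def image_iff intro!: bexI[of _ 0])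
  also have "card A = p" unfolding A_def using p0 by (subst card_image) (auto simp: inj_on_def)
  finally show "card {x \<in> supported_on q n \<tau>. x [^]\<^bsub>Zmod_pow q n\<^esub> p = \<one>\<^bsub>Zmod_pow q n\<^esub>} = p ^ card \<tau>" .
qed

text \<open>
  Let \<open>K\<close> be the kernel of the homomorphism \<open>g\<close> and \<open>S\<close> the coordinate subspace of \<open>\<tau>\<close>.  On a finite
  abelian group, taking \<open>p\<close>-th powers has a kernel of the same order as its cokernel.  For \<open>K \<inter> S\<close>
  the kernel is that of \<open>S\<close>, of order \<open>p ^ card \<tau>\<close>, whatever \<open>g\<close> is.  For the same reason a \<open>p\<close>-th
  power from \<open>K\<close> that lies in \<open>S\<close> is a \<open>p\<close>-th power from \<open>K \<inter> S\<close>: dropping the coordinates outside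
  \<open>\<tau>\<close> changes the root by an element of order \<open>p\<close>, which is in \<open>K\<close>.
\<close>

lemma pow_image_kernel:
  fixes n \<tau> g
  defines "R \<equiv> Zmod_pow q n" and "S \<equiv> supported_on q n \<tau>" and "K \<equiv> hom_kernel n g"
  assumes g: "g \<in> {1..n} \<rightarrow> carrier G" and \<tau>: "\<tau> \<subseteq> {1..n}"
  shows "(\<lambda>x. x [^]\<^bsub>R\<^esub> p) ` K \<inter> (K \<inter> S) = (\<lambda>x. x [^]\<^bsub>R\<^esub> p) ` (K \<inter> S)"
    and "card (K \<inter> S) = p ^ card \<tau> * card ((\<lambda>x. x [^]\<^bsub>R\<^esub> p) ` (K \<inter> S))"
    and "card (K \<inter> S) * card (generate G (g ` \<tau>)) = (p ^ N) ^ card \<tau>"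
proof -
  interpret R: comm_group R unfolding R_def by (rule comm_group_Zmod_pow[OF q_gt_1])
  interpret E: group_hom R G "eval_hom n g" unfolding R_def by (rule eval_hom_hom[OF g])
  have sS: "subgroup S R" unfolding R_def S_def by (rule subgroup_supported_on[OF q_gt_1])
  have sK: "subgroup K R" unfolding R_def K_def by (rule subgroup_hom_kernel[OF g])
  have sKS: "subgroup (K \<inter> S) R" by (rule R.subgroups_Inter_pair[OF sK sS])
  have finS: "finite S" using subgroup.subset[OF sS] finite_Zmod_pow unfolding R_def by (rule finite_subset)
  have ker: "x \<in> K" if "x \<in> carrier R" "x [^]\<^bsub>R\<^esub> p = \<one>\<^bsub>R\<^esub>" for x
    using pow_p_one_in_kernel[OF g] that by (simp add: R_def K_def)
  show "(\<lambda>x. x [^]\<^bsub>R\<^esub> p) ` K \<inter> (K \<inter> S) = (\<lambda>x. x [^]\<^bsub>R\<^esub> p) ` (K \<inter> S)"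
  proof
    show "(\<lambda>x. x [^]\<^bsub>R\<^esub> p) ` (K \<inter> S) \<subseteq> (\<lambda>x. x [^]\<^bsub>R\<^esub> p) ` K \<inter> (K \<inter> S)"
      using R.nat_pow_subgroup_closed[OF sKS] by blast
    show "(\<lambda>x. x [^]\<^bsub>R\<^esub> p) ` K \<inter> (K \<inter> S) \<subseteq> (\<lambda>x. x [^]\<^bsub>R\<^esub> p) ` (K \<inter> S)"
    proof clarify
      fix k assume k: "k \<in> K" "k [^]\<^bsub>R\<^esub> p \<in> S"
      have kR: "k \<in> carrier R" using k subgroup.subset[OF sK] by auto
      define r where "r = (\<lambda>i\<in>{1..n}. if i \<in> \<tau> then k i else 0)"
      have rS: "r \<in> S" using kR q_gt_1 prime_gt_0_nat[OF prime_p]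
        by (auto simp: r_def S_def supported_on_def R_def carrier_Zmod_pow PiE_iff)
      have rR: "r \<in> carrier R" using rS subgroup.subset[OF sS] by auto
      have "k [^]\<^bsub>R\<^esub> p = r [^]\<^bsub>R\<^esub> p"
        using k(2) kR rR unfolding S_def R_def supported_on_def
        by (auto simp: nat_pow_Zmod_pow[OF q_gt_1] r_def fun_eq_iff)
      then have "(r \<otimes>\<^bsub>R\<^esub> inv\<^bsub>R\<^esub> k) [^]\<^bsub>R\<^esub> p = \<one>\<^bsub>R\<^esub>"
        using kR rR by (simp add: R.nat_pow_distrib R.nat_pow_inv)
      then have "r \<otimes>\<^bsub>R\<^esub> inv\<^bsub>R\<^esub> k \<in> K" using kR rR by (intro ker) auto
      then have "r \<otimes>\<^bsub>R\<^esub> inv\<^bsub>R\<^esub> k \<otimes>\<^bsub>R\<^esub> k \<in> K" using k(1) by (rule subgroup.m_closed[OF sK])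
      then have "r \<in> K" using kR rR by (simp add: R.m_assoc)
      then show "k [^]\<^bsub>R\<^esub> p \<in> (\<lambda>x. x [^]\<^bsub>R\<^esub> p) ` (K \<inter> S)"
        using rS \<open>k [^]\<^bsub>R\<^esub> p = r [^]\<^bsub>R\<^esub> p\<close> by blast
    qed
  qed
  interpret P: group_hom R R "\<lambda>x. x [^]\<^bsub>R\<^esub> p"
    by unfold_locales (auto simp: hom_def R.nat_pow_distrib)
  have "{x \<in> K \<inter> S. x [^]\<^bsub>R\<^esub> p = \<one>\<^bsub>R\<^esub>} = {x \<in> S. x [^]\<^bsub>R\<^esub> p = \<one>\<^bsub>R\<^esub>}"
    using ker subgroup.subset[OF sS] by blast
  also have "card \<dots> = p ^ card \<tau>" using card_pow_p_one[OF g \<tau>] by (simp add: R_def S_def)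
  finally show "card (K \<inter> S) = p ^ card \<tau> * card ((\<lambda>x. x [^]\<^bsub>R\<^esub> p) ` (K \<inter> S))"
    using P.card_subgroup_hom[OF sKS] finS by simp
  have "{x \<in> S. eval_hom n g x = \<one>} = K \<inter> S"
    using subgroup.subset[OF sS] by (auto simp: K_def hom_kernel_def R_def)
  then have "card S = card (K \<inter> S) * card (generate G (g ` \<tau>))"
    using E.card_subgroup_hom[OF sS finS] eval_hom_image_supported_on[OF g \<tau>] by (simp add: S_def)
  moreover have "card S = (p ^ N) ^ card \<tau>"
    unfolding S_def using card_supported_on[OF _ \<tau>, of q] q_gt_1 prime_gt_0_nat[OF prime_p] by (simp add: nat_power_eq)
  ultimately show "card (K \<inter> S) * card (generate G (g ` \<tau>)) = (p ^ N) ^ card \<tau>" by simp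
qed

text \<open>
  The heart of the computation.  Random columns with supports \<open>\<sigma> j\<close> lie in the kernel of \<open>g\<close> with
  probability \<open>gen_weight G \<sigma> n g\<close>.  Given that, they generate the kernel with a probability that
  does not depend on \<open>g\<close>, nor even on \<open>G\<close>, and so is the probability of being nonsingular
  modulo \<open>p\<close>: by \<open>pow_image_kernel\<close> the numbers that enter \<open>card_generating_tuples\<close> are, up to
  common factors, those of the free module.
\<close>

lemma card_columns_generating_kernel:
  fixes n \<sigma> g
  defines "R \<equiv> Zmod_pow q n"
  assumes g: "g \<in> {1..n} \<rightarrow> carrier G"
    and \<sigma>: "\<And>j. j \<in> {1..n} \<Longrightarrow> \<sigma> j \<subseteq> {1..n}"
    and mono: "\<And>i j. 1 \<le> i \<Longrightarrow> i \<le> j \<Longrightarrow> j \<le> n \<Longrightarrow> \<sigma> i \<subseteq> \<sigma> j"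
  shows "real (card {x \<in> PiE {1..n} (\<lambda>j. supported_on q n (\<sigma> j)). generate R (x ` {1..n}) = hom_kernel n g}) =
    (\<Prod>j=1..n. real (p ^ N) ^ card (\<sigma> j)) * (nonsingular_prob p (\<lambda>j. card (\<sigma> j)) n * gen_weight G \<sigma> n g)"
proof -
  interpret R: comm_group R unfolding R_def by (rule comm_group_Zmod_pow[OF q_gt_1])
  have p0: "p > 0" using prime_gt_0_nat[OF prime_p] .
  define K0 where "K0 = hom_kernel n g"
  define K where "K j = K0 \<inter> supported_on q n (\<sigma> j)" for j
  define P where "P = (\<lambda>x. x [^]\<^bsub>R\<^esub> p) ` K0"
  have sK0: "subgroup K0 R" unfolding R_def K0_def by (rule subgroup_hom_kernel[OF g])
  have finR: "finite (carrier R)" unfolding R_def by (rule finite_Zmod_pow)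
  have K0R: "K0 \<subseteq> carrier R" using subgroup.subset[OF sK0] .
  have "K0 \<inter> supported_on q n {1..n} = K0"
    unfolding supported_on_all using K0R[unfolded R_def] by (rule Int_absorb2)
  then have "card K0 = p ^ n * card P"
    using pow_image_kernel(2)[OF g order_refl] unfolding K0_def[symmetric] P_def R_def by simp
  moreover have "x [^]\<^bsub>R\<^esub> (p ^ N) = \<one>\<^bsub>R\<^esub>" if "x \<in> K0" for x
    using that K0R unfolding R_def by (subst nat_pow_Zmod_pow[OF q_gt_1]) (auto simp: one_Zmod_pow)
  moreover have "subgroup (K j) R" for j
    unfolding K_def R_def by (rule R.subgroups_Inter_pair[unfolded R_def, OF sK0[unfolded R_def] subgroup_supported_on[OF q_gt_1]])
  moreover have "K i \<subseteq> K j" if "1 \<le> i" "i \<le> j" "j \<le> n" for i j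
    using mono[OF that] by (auto simp: K_def supported_on_def)
  ultimately have main: "card {x \<in> PiE {1..n} K. generate R (x ` {1..n}) = K0} =
    (\<Prod>j=1..n. card (K j) - p ^ (j - 1) * card (P \<inter> K j))"
    unfolding P_def by (intro R.card_generating_tuples[OF finR prime_p sK0, of N]) (auto simp: K_def)
  have "{x \<in> PiE {1..n} (\<lambda>j. supported_on q n (\<sigma> j)). generate R (x ` {1..n}) = K0} =
    {x \<in> PiE {1..n} K. generate R (x ` {1..n}) = K0}"
  proof (rule Collect_cong, rule iffI)
    fix x assume x: "x \<in> PiE {1..n} (\<lambda>j. supported_on q n (\<sigma> j)) \<and> generate R (x ` {1..n}) = K0"
    then have "x j \<in> K0" if "j \<in> {1..n}" for j using that generate.incl[of "x j" "x ` {1..n}" R] by auto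
    then show "x \<in> PiE {1..n} K \<and> generate R (x ` {1..n}) = K0" using x by (auto simp: K_def PiE_iff)
  next
    fix x assume x: "x \<in> PiE {1..n} K \<and> generate R (x ` {1..n}) = K0"
    then show "x \<in> PiE {1..n} (\<lambda>j. supported_on q n (\<sigma> j)) \<and> generate R (x ` {1..n}) = K0"
      by (auto simp: K_def PiE_iff)
  qed
  then have "real (card {x \<in> PiE {1..n} (\<lambda>j. supported_on q n (\<sigma> j)). generate R (x ` {1..n}) = K0}) =
    (\<Prod>j=1..n. real (card (K j) - p ^ (j - 1) * card (P \<inter> K j)))"
    using main by simp
  also have "\<dots> = (\<Prod>j=1..n. real (p ^ N) ^ card (\<sigma> j) *
    (max 0 (1 - real p ^ (j - 1) / real p ^ card (\<sigma> j)) * (1 / real (card (generate G (g ` \<sigma> j))))))"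
  proof (intro prod.cong refl)
    fix j assume j: "j \<in> {1..n}"
    define c where "c = card (P \<inter> K j)"
    have "P \<inter> K j = (\<lambda>x. x [^]\<^bsub>R\<^esub> p) ` K j"
      using pow_image_kernel(1)[OF g \<sigma>[OF j]] by (simp add: P_def K_def K0_def R_def)
    then have cK: "card (K j) = p ^ card (\<sigma> j) * c"
      using pow_image_kernel(2)[OF g \<sigma>[OF j]] by (simp add: c_def K_def K0_def R_def)
    have gen: "card (K j) * card (generate G (g ` \<sigma> j)) = (p ^ N) ^ card (\<sigma> j)"
      using pow_image_kernel(3)[OF g \<sigma>[OF j]] by (simp add: K_def K0_def)
    then have "card (K j) * card (generate G (g ` \<sigma> j)) \<noteq> 0" using p0 by simp
    then have gen0: "real (card (generate G (g ` \<sigma> j))) \<noteq> 0" by auto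
    have "real (card (K j) - p ^ (j - 1) * c) = max 0 (real p ^ card (\<sigma> j) * c - real p ^ (j - 1) * c)"
      unfolding cK by (cases "p ^ (j - 1) * c \<le> p ^ card (\<sigma> j) * c")
        (simp_all add: of_nat_diff max_def flip: of_nat_power of_nat_mult)
    also have "real p ^ card (\<sigma> j) * c - real p ^ (j - 1) * c =
      real (card (K j)) * (1 - real p ^ (j - 1) / real p ^ card (\<sigma> j))"
      unfolding cK using p0 by (simp add: field_simps)
    also have "max 0 \<dots> = real (card (K j)) * max 0 (1 - real p ^ (j - 1) / real p ^ card (\<sigma> j))"
      by (simp add: max_mult_distrib_left)
    also have "real (card (K j)) = real (p ^ N) ^ card (\<sigma> j) / real (card (generate G (g ` \<sigma> j)))"
      using gen gen0 by (simp add: eq_divide_eq flip: of_nat_power of_nat_mult)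
    finally show "real (card (K j) - p ^ (j - 1) * card (P \<inter> K j)) = real (p ^ N) ^ card (\<sigma> j) *
      (max 0 (1 - real p ^ (j - 1) / real p ^ card (\<sigma> j)) * (1 / real (card (generate G (g ` \<sigma> j)))))"
      by (simp add: c_def)
  qed
  also have "\<dots> = (\<Prod>j=1..n. real (p ^ N) ^ card (\<sigma> j)) * (nonsingular_prob p (\<lambda>j. card (\<sigma> j)) n * gen_weight G \<sigma> n g)"
    unfolding nonsingular_prob_def gen_weight_def by (simp only: prod.distrib)
  finally show ?thesis by (simp add: K0_def)
qed

end

section \<open>Matrices over the p-adic integers\<close>

lemma finprod_Zmod_pow:
  assumes "q > 1" "finite S" "f \<in> S \<rightarrow> carrier (Zmod_pow q n)" "i \<in> {1..n}"
  shows "finprod (Zmod_pow q n) f S i = (\<Sum>j\<in>S. f j i) mod q"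
proof -
  interpret R: comm_group "Zmod_pow q n" by (rule comm_group_Zmod_pow[OF assms(1)])
  show ?thesis using assms(2,3)
  proof (induction S rule: finite_induct)
    case empty
    then show ?case using assms(4) by (simp add: one_Zmod_pow)
  next
    case (insert a S)
    then have "finprod (Zmod_pow q n) f (insert a S) = f a \<otimes>\<^bsub>Zmod_pow q n\<^esub> finprod (Zmod_pow q n) f S"
      by (intro R.finprod_insert) auto
    then show ?case using insert assms(4) by (simp add: mult_Zmod_pow mod_simps)
  qed
qed

lemma int_power_gt_1: "p > 1 \<Longrightarrow> N > 0 \<Longrightarrow> int p ^ N > 1"
  by (intro one_less_power) auto

lemma Zp_bounds: "x \<in> carrier (Zp p) \<Longrightarrow> 0 \<le> x k \<and> x k < int p ^ k"
  and Zp_Suc_mod: "x \<in> carrier (Zp p) \<Longrightarrow> x (Suc k) mod int p ^ k = x k"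
  by (simp_all add: Zp_def)

lemma Zp_add_mod_mod:
  assumes "x \<in> carrier (Zp p)"
  shows "x (k + m) mod int p ^ k = x k"
proof (induction m)
  case 0
  then show ?case using Zp_bounds[OF assms, of k] by simp
next
  case (Suc m)
  have "x (k + Suc m) mod int p ^ k = x (Suc (k + m)) mod int p ^ (k + m) mod int p ^ k"
    by (simp add: mod_mod_cancel power_add)
  then show ?case using Zp_Suc_mod[OF assms, of "k + m"] Suc by simp
qed

lemma Zp_mod_self: "x \<in> carrier (Zp p) \<Longrightarrow> x k mod int p ^ k = x k"
  using Zp_bounds[of x p k] by simp

lemma Zp_ops:
  "x \<oplus>\<^bsub>Zp p\<^esub> y = (\<lambda>k. (x k + y k) mod int p ^ k)"
  "x \<otimes>\<^bsub>Zp p\<^esub> y = (\<lambda>k. (x k * y k) mod int p ^ k)"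
  "\<zero>\<^bsub>Zp p\<^esub> = (\<lambda>k. 0)" "\<one>\<^bsub>Zp p\<^esub> = (\<lambda>k. 1 mod int p ^ k)"
  by (simp_all add: Zp_def)

lemma finsum_Zp:
  assumes "p > 0" "finite A" "f \<in> A \<rightarrow> carrier (Zp p)"
  shows "(\<Oplus>\<^bsub>Zp p\<^esub>j\<in>A. f j) k = (\<Sum>j\<in>A. f j k) mod int p ^ k"
  using assms(2,3)
proof (induction A rule: finite_induct)
  interpret cring "Zp p" by (rule Zp_cring[OF assms(1)])
  case empty
  then show ?case by (simp add: Zp_ops)
next
  interpret cring "Zp p" by (rule Zp_cring[OF assms(1)])
  case (insert a A)
  then have "(\<Oplus>\<^bsub>Zp p\<^esub>j\<in>insert a A. f j) = f a \<oplus>\<^bsub>Zp p\<^esub> (\<Oplus>\<^bsub>Zp p\<^esub>j\<in>A. f j)"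
    by (intro finsum_insert) auto
  then show ?case using insert by (simp add: Zp_ops mod_add_right_eq)
qed

definition lift_Zp :: "nat \<Rightarrow> int \<Rightarrow> padic" where
  "lift_Zp p a = (\<lambda>k. a mod int p ^ k)"

lemma lift_Zp_closed: "p > 0 \<Longrightarrow> lift_Zp p a \<in> carrier (Zp p)"
  by (simp add: lift_Zp_def Zp_def mod_mod_cancel)

lemma carrier_Zp_pow: "carrier (Zp_pow p n) = PiE {1..n} (\<lambda>_. carrier (Zp p))"
  by (simp add: Zp_pow_def)

lemma mult_Zp_pow: "x \<otimes>\<^bsub>Zp_pow p n\<^esub> y = (\<lambda>i\<in>{1..n}. x i \<oplus>\<^bsub>Zp p\<^esub> y i)"
  by (simp add: Zp_pow_def)

lemma one_Zp_pow: "\<one>\<^bsub>Zp_pow p n\<^esub> = (\<lambda>i\<in>{1..n}. \<zero>\<^bsub>Zp p\<^esub>)"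
  by (simp add: Zp_pow_def)

lemma comm_group_Zp_pow:
  assumes "p > 0"
  shows "comm_group (Zp_pow p n)"
proof -
  interpret cring "Zp p" by (rule Zp_cring[OF assms])
  have "group (Zp_pow p n)"
    unfolding Zp_pow_def by (intro product_group) (rule add.is_group)
  then show ?thesis
    by (rule group.group_comm_groupI)
      (auto simp: carrier_Zp_pow mult_Zp_pow PiE_iff intro!: restrict_ext a_comm)
qed

lemma Zp_pow_eqI:
  assumes "x \<in> carrier (Zp_pow p n)" "y \<in> carrier (Zp_pow p n)" "\<And>i k. i \<in> {1..n} \<Longrightarrow> x i k = y i k"
  shows "x = y"
  using assms unfolding carrier_Zp_pow by (intro PiE_ext) (auto simp: fun_eq_iff)

lemma nat_pow_Zp_pow:
  assumes "p > 0" "x \<in> carrier (Zp_pow p n)" "i \<in> {1..n}"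
  shows "(x [^]\<^bsub>Zp_pow p n\<^esub> (m::nat)) i k = (int m * x i k) mod int p ^ k"
proof (induction m)
  case 0
  then show ?case using assms by (simp add: one_Zp_pow Zp_ops)
next
  case (Suc m)
  have "(x [^]\<^bsub>Zp_pow p n\<^esub> Suc m) i k = (int m * x i k mod int p ^ k + x i k) mod int p ^ k"
    using Suc assms by (simp add: mult_Zp_pow Zp_ops)
  then show ?case by (simp add: mod_simps algebra_simps)
qed

subsection \<open>Reduction modulo p^N\<close>

definition reduce :: "nat \<Rightarrow> nat \<Rightarrow> (nat \<Rightarrow> padic) \<Rightarrow> nat \<Rightarrow> int" where
  "reduce N n x = (\<lambda>i\<in>{1..n}. x i N)"

lemma reduce_closed:
  "x \<in> carrier (Zp_pow p n) \<Longrightarrow> reduce N n x \<in> carrier (Zmod_pow (int p ^ N) n)"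
  using Zp_bounds by (auto simp: reduce_def carrier_Zmod_pow carrier_Zp_pow PiE_iff)

lemma reduce_hom:
  assumes "p > 1" "N > 0"
  shows "group_hom (Zp_pow p n) (Zmod_pow (int p ^ N) n) (reduce N n)"
proof -
  interpret Z: comm_group "Zp_pow p n" using assms by (intro comm_group_Zp_pow) auto
  interpret R: comm_group "Zmod_pow (int p ^ N) n" 
    by (rule comm_group_Zmod_pow[OF int_power_gt_1[OF assms]])
  show ?thesis
    by unfold_locales
      (auto simp: hom_def reduce_closed, auto simp: reduce_def mult_Zp_pow mult_Zmod_pow Zp_ops fun_eq_iff)
qed

lemma reduce_surj:
  assumes "p > 0" "r \<in> carrier (Zmod_pow (int p ^ N) n)"
  obtains x where "x \<in> carrier (Zp_pow p n)" "reduce N n x = r"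
proof
  show "(\<lambda>i\<in>{1..n}. lift_Zp p (r i)) \<in> carrier (Zp_pow p n)"
    using lift_Zp_closed[OF assms(1)] by (auto simp: carrier_Zp_pow)
  show "reduce N n (\<lambda>i\<in>{1..n}. lift_Zp p (r i)) = r"
    using assms(2) by (auto simp: reduce_def lift_Zp_def carrier_Zmod_pow PiE_iff fun_eq_iff extensional_def)
qed

lemma reduce_eq_one:
  assumes p: "p > 0" and x: "x \<in> carrier (Zp_pow p n)" and "reduce N n x = \<one>\<^bsub>Zmod_pow (int p ^ N) n\<^esub>"
  obtains z where "z \<in> carrier (Zp_pow p n)" "x = z [^]\<^bsub>Zp_pow p n\<^esub> (p ^ N)"
proof -
  \<comment> \<open>Dividing by \<open>p ^ N\<close> costs \<open>N\<close> digits of precision, hence the shift of the index.\<close>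
  define z where "z = (\<lambda>i\<in>{1..n}. \<lambda>k. x i (k + N) div int p ^ N)"
  have pN: "int p ^ N > 0" using p by simp
  have xi: "x i \<in> carrier (Zp p)" if "i \<in> {1..n}" for i
    using x that by (auto simp: carrier_Zp_pow)
  have dvd: "x i (k + N) = int p ^ N * (x i (k + N) div int p ^ N)" if i: "i \<in> {1..n}" for i k
  proof -
    have "x i N = 0" using assms(3) i by (auto simp: reduce_def one_Zmod_pow fun_eq_iff restrict_def split: if_splits)
    then have "x i (k + N) mod int p ^ N = 0" using Zp_add_mod_mod[OF xi[OF i], of N k] by (simp add: add.commute)
    then show ?thesis by (simp add: dvd_eq_mod_eq_0[symmetric])
  qed
  have z: "z \<in> carrier (Zp_pow p n)"
  proof -
    have "(\<lambda>k. x i (k + N) div int p ^ N) \<in> carrier (Zp p)" if i: "i \<in> {1..n}" for i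
    proof -
      define y where "y k = x i (k + N) div int p ^ N" for k
      have y: "x i (k + N) = int p ^ N * y k" for k using dvd[OF i] by (simp add: y_def)
      have "0 \<le> y k \<and> y k < int p ^ k" for k
      proof -
        have "0 \<le> int p ^ N * y k" "int p ^ N * y k < int p ^ N * int p ^ k"
          using Zp_bounds[OF xi[OF i], of "k + N"] unfolding y by (auto simp: power_add mult.commute)
        then show ?thesis using pN by (simp add: zero_le_mult_iff)
      qed
      moreover have "y (Suc k) mod int p ^ k = y k" for k
      proof -
        have "int p ^ N * (y (Suc k) mod int p ^ k) = (int p ^ N * y (Suc k)) mod (int p ^ N * int p ^ k)"
          by (rule mult_mod_right)
        also have "\<dots> = x i (Suc (k + N)) mod int p ^ (k + N)"
          using y[of "Suc k"] by (simp add: power_add mult.commute)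
        also have "\<dots> = int p ^ N * y k" using Zp_Suc_mod[OF xi[OF i], of "k + N"] y by simp
        finally show ?thesis using p by simp
      qed
      ultimately show ?thesis by (simp add: Zp_def y_def[abs_def, symmetric])
    qed
    then show ?thesis by (auto simp: z_def carrier_Zp_pow)
  qed
  interpret Z: comm_group "Zp_pow p n" by (rule comm_group_Zp_pow[OF p])
  have "x = z [^]\<^bsub>Zp_pow p n\<^esub> (p ^ N)"
  proof (rule Zp_pow_eqI[OF x Z.nat_pow_closed[OF z]])
    fix i k assume i: "i \<in> {1..n}"
    have "(z [^]\<^bsub>Zp_pow p n\<^esub> (p ^ N)) i k = (int p ^ N * (x i (k + N) div int p ^ N)) mod int p ^ k"
      unfolding nat_pow_Zp_pow[OF p z i] using i by (simp add: z_def)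
    also have "\<dots> = x i k" using dvd[OF i, of k] Zp_add_mod_mod[OF xi[OF i], of k N] by simp
    finally show "x i k = (z [^]\<^bsub>Zp_pow p n\<^esub> (p ^ N)) i k" by simp
  qed
  then show ?thesis using that z by blast
qed

subsection \<open>The image of a matrix\<close>

definition mat_app :: "nat \<Rightarrow> nat \<Rightarrow> padic_matrix \<Rightarrow> (nat \<Rightarrow> padic) \<Rightarrow> nat \<Rightarrow> padic" where
  "mat_app p n A v = (\<lambda>i\<in>{1..n}. \<Oplus>\<^bsub>Zp p\<^esub>j\<in>{1..n}. A i j \<otimes>\<^bsub>Zp p\<^esub> v j)"

lemma mat_image_eq: "mat_image p n A = mat_app p n A ` carrier (Zp_pow p n)"
  by (simp add: mat_image_def mat_app_def)

definition column_residue :: "nat \<Rightarrow> nat \<Rightarrow> padic_matrix \<Rightarrow> nat \<Rightarrow> nat \<Rightarrow> int" where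
  "column_residue N n A j = reduce N n (\<lambda>i. A i j)"

locale padic_square_matrix =
  fixes p n :: nat and A :: padic_matrix
  assumes p_gt_1: "p > 1" and entries: "\<And>i j. i \<in> {1..n} \<Longrightarrow> j \<in> {1..n} \<Longrightarrow> A i j \<in> carrier (Zp p)"
begin

lemma p_pos: "p > 0" using p_gt_1 by simp

sublocale Zp: cring "Zp p" by (rule Zp_cring[OF p_pos])

abbreviation Zn where "Zn \<equiv> Zp_pow p n"

sublocale Z: comm_group "Zp_pow p n" by (rule comm_group_Zp_pow[OF p_pos])

lemma mat_app_closed: "v \<in> carrier Zn \<Longrightarrow> mat_app p n A v \<in> carrier Zn"
  unfolding mat_app_def carrier_Zp_pow
  by (auto intro!: Zp.finsum_closed Zp.m_closed entries simp: PiE_iff Pi_iff)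

lemma mat_app_nth:
  assumes "v \<in> carrier Zn" "i \<in> {1..n}"
  shows "mat_app p n A v i k = (\<Sum>j=1..n. A i j k * v j k) mod int p ^ k"
proof -
  have "mat_app p n A v i k = (\<Sum>j=1..n. (A i j \<otimes>\<^bsub>Zp p\<^esub> v j) k) mod int p ^ k"
    unfolding mat_app_def using assms
    by (simp, intro finsum_Zp[OF p_pos]) (auto intro!: Zp.m_closed entries simp: carrier_Zp_pow PiE_iff)
  also have "\<dots> = (\<Sum>j=1..n. A i j k * v j k) mod int p ^ k"
    by (simp add: Zp_ops mod_sum_eq)
  finally show ?thesis .
qed

lemma mat_app_hom: "group_hom Zn Zn (mat_app p n A)"
proof -
  have "mat_app p n A (v \<otimes>\<^bsub>Zn\<^esub> w) = mat_app p n A v \<otimes>\<^bsub>Zn\<^esub> mat_app p n A w"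
    if vw: "v \<in> carrier Zn" "w \<in> carrier Zn" for v w
  proof (rule Zp_pow_eqI)
    fix i k assume i: "i \<in> {1..n}"
    have "mat_app p n A (v \<otimes>\<^bsub>Zn\<^esub> w) i k = (\<Sum>j=1..n. A i j k * ((v j k + w j k) mod int p ^ k)) mod int p ^ k"
      using vw i by (simp add: mat_app_nth) (simp add: mult_Zp_pow Zp_ops)
    also have "\<dots> = (\<Sum>j=1..n. A i j k * ((v j k + w j k) mod int p ^ k) mod int p ^ k) mod int p ^ k"
      by (simp only: mod_sum_eq)
    also have "\<dots> = (\<Sum>j=1..n. A i j k * (v j k + w j k) mod int p ^ k) mod int p ^ k"
      by (simp only: mod_mult_right_eq)
    also have "\<dots> = (\<Sum>j=1..n. A i j k * (v j k + w j k)) mod int p ^ k"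
      by (simp only: mod_sum_eq)
    also have "\<dots> = (mat_app p n A v \<otimes>\<^bsub>Zn\<^esub> mat_app p n A w) i k"
      using i by (simp add: mult_Zp_pow Zp_ops mat_app_nth vw mod_add_eq distrib_left sum.distrib)
    finally show "mat_app p n A (v \<otimes>\<^bsub>Zn\<^esub> w) i k = (mat_app p n A v \<otimes>\<^bsub>Zn\<^esub> mat_app p n A w) i k" .
  qed (use vw mat_app_closed in auto)
  then show ?thesis
    by unfold_locales (auto simp: hom_def mat_app_closed)
qed

lemma subgroup_mat_image: "subgroup (mat_image p n A) Zn"
  unfolding mat_image_eq by (rule group_hom.img_is_subgroup[OF mat_app_hom])

text \<open>
  Nakayama's lemma for the image of a matrix: a set \<open>K\<close> of vectors that is covered by the image
  modulo \<open>p\<close> times \<open>K\<close> is contained in the image.  Iterating the hypothesis writes an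
  element of \<open>K\<close> as the image of a series with terms \<open>p ^ t\<close> times \<open>v t\<close>, which converges since the
  p-adic integers are complete.
\<close>

lemma nakayama_mat_image:
  assumes K: "K \<subseteq> carrier Zn"
    and step: "\<And>y. y \<in> K \<Longrightarrow> \<exists>v\<in>carrier Zn. \<exists>z\<in>K.
      y = mat_app p n A v \<otimes>\<^bsub>Zn\<^esub> z [^]\<^bsub>Zn\<^esub> p"
  shows "K \<subseteq> mat_image p n A"
proof
  fix y assume y: "y \<in> K"
  obtain V Y where VY: "\<And>y. y \<in> K \<Longrightarrow> V y \<in> carrier Zn \<and> Y y \<in> K \<and>
      y = mat_app p n A (V y) \<otimes>\<^bsub>Zn\<^esub> Y y [^]\<^bsub>Zn\<^esub> p"
    using step by metis
  define ys where "ys m = (Y ^^ m) y" for m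
  define vs where "vs m = V (ys m)" for m
  have ys: "ys m \<in> K" for m using y VY by (induction m) (auto simp: ys_def)
  have vs: "vs m \<in> carrier Zn" for m using VY ys by (simp add: vs_def)
  have ysC: "ys m \<in> carrier Zn" for m using ys K by auto
  have rec: "ys m i k mod int p ^ k = ((\<Sum>j=1..n. A i j k * vs m j k) + int p * ys (Suc m) i k) mod int p ^ k"
    if i: "i \<in> {1..n}" for m i k
  proof -
    have "ys m = mat_app p n A (vs m) \<otimes>\<^bsub>Zn\<^esub> ys (Suc m) [^]\<^bsub>Zn\<^esub> p"
      using VY[OF ys[of m]] by (simp add: vs_def ys_def)
    then have "ys m i k = (mat_app p n A (vs m) i k + (ys (Suc m) [^]\<^bsub>Zn\<^esub> p) i k) mod int p ^ k"
      using i by (simp add: mult_Zp_pow Zp_ops)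
    then show ?thesis
      using i by (simp add: mat_app_nth[OF vs] nat_pow_Zp_pow[OF p_pos ysC] mod_add_eq)
  qed
  have approx: "y i k mod int p ^ k =
    ((\<Sum>j=1..n. A i j k * (\<Sum>t<m. int p ^ t * vs t j k)) + int p ^ m * ys m i k) mod int p ^ k"
    if i: "i \<in> {1..n}" for m i k
  proof (induction m)
    case 0
    then show ?case by (simp add: ys_def)
  next
    case (Suc m)
    let ?S = "\<Sum>j=1..n. A i j k * (\<Sum>t<m. int p ^ t * vs t j k)"
    have red: "(a + c * (b mod d)) mod d = (a + c * b) mod d" for a b c d :: int
      by (metis mod_add_right_eq mod_mult_right_eq)
    have "y i k mod int p ^ k = (?S + int p ^ m * (ys m i k mod int p ^ k)) mod int p ^ k"
      unfolding Suc red ..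
    also have "\<dots> = (?S + int p ^ m * ((\<Sum>j=1..n. A i j k * vs m j k) + int p * ys (Suc m) i k)) mod int p ^ k"
      unfolding rec[OF i] red ..
    also have "?S + int p ^ m * ((\<Sum>j=1..n. A i j k * vs m j k) + int p * ys (Suc m) i k) =
      (\<Sum>j=1..n. A i j k * (\<Sum>t<Suc m. int p ^ t * vs t j k)) + int p ^ Suc m * ys (Suc m) i k"
      by (simp add: distrib_left sum.distrib sum_distrib_left mult.left_commute mult.assoc)
    finally show ?case .
  qed
  \<comment> \<open>The sum of the series; its residue modulo \<open>p ^ k\<close> depends on the first \<open>k\<close> terms only.\<close>
  define v where "v = (\<lambda>j\<in>{1..n}. \<lambda>k. (\<Sum>t<k. int p ^ t * vs t j k) mod int p ^ k)"
  have v: "v \<in> carrier Zn"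
  proof -
    have "v j \<in> carrier (Zp p)" if j: "j \<in> {1..n}" for j
    proof -
      have vsj: "vs t j \<in> carrier (Zp p)" for t using vs[of t] j by (auto simp: carrier_Zp_pow)
      have "v j (Suc k) mod int p ^ k = v j k" for k
      proof -
        have "v j (Suc k) mod int p ^ k = (\<Sum>t<Suc k. int p ^ t * vs t j (Suc k)) mod int p ^ k"
          using j by (simp add: v_def mod_mod_cancel)
        also have "\<dots> = (\<Sum>t<k. int p ^ t * vs t j (Suc k)) mod int p ^ k" by simp
        also have "\<dots> = (\<Sum>t<k. int p ^ t * vs t j (Suc k) mod int p ^ k) mod int p ^ k"
          by (simp only: mod_sum_eq)
        also have "\<dots> = (\<Sum>t<k. int p ^ t * vs t j k mod int p ^ k) mod int p ^ k"
          using Zp_Suc_mod[OF vsj] by (metis (no_types, lifting) mod_mult_right_eq)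
        also have "\<dots> = v j k" using j by (simp add: v_def mod_sum_eq)
        finally show ?thesis .
      qed
      moreover have "v j k \<in> {0..<int p ^ k}" for k using j p_pos by (simp add: v_def)
      ultimately show ?thesis by (simp add: Zp_def)
    qed
    then show ?thesis by (auto simp: carrier_Zp_pow v_def)
  qed
  have "y = mat_app p n A v"
  proof (rule Zp_pow_eqI[OF _ mat_app_closed[OF v]])
    show "y \<in> carrier Zn" using y K by auto
    fix i k assume i: "i \<in> {1..n}"
    have "y i \<in> carrier (Zp p)"
      using subsetD[OF K y] i unfolding carrier_Zp_pow by (rule PiE_mem)
    then have "y i k = y i k mod int p ^ k" using Zp_mod_self by simp
    also have "\<dots> = (\<Sum>j=1..n. A i j k * (\<Sum>t<k. int p ^ t * vs t j k)) mod int p ^ k"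
      unfolding approx[OF i, of k k] by simp
    also have "\<dots> = (\<Sum>j=1..n. A i j k * (\<Sum>t<k. int p ^ t * vs t j k) mod int p ^ k) mod int p ^ k"
      by (simp only: mod_sum_eq)
    also have "\<dots> = (\<Sum>j=1..n. A i j k * v j k mod int p ^ k) mod int p ^ k"
      by (rule arg_cong2[of _ _ _ _ "(mod)"], rule sum.cong) (simp_all add: v_def mod_mult_right_eq)
    also have "\<dots> = mat_app p n A v i k"
      by (simp only: mod_sum_eq mat_app_nth[OF v i])
    finally show "y i k = mat_app p n A v i k" .
  qed
  then show "y \<in> mat_image p n A" using v by (auto simp: mat_image_eq)
qed

definition unit_vec :: "nat \<Rightarrow> nat \<Rightarrow> padic" where
  "unit_vec j = (\<lambda>i\<in>{1..n}. if i = j then \<one>\<^bsub>Zp p\<^esub> else \<zero>\<^bsub>Zp p\<^esub>)"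

lemma unit_vec_closed: "unit_vec j \<in> carrier Zn"
  by (auto simp: unit_vec_def carrier_Zp_pow)

lemma mat_app_unit_vec:
  assumes "j \<in> {1..n}" "i \<in> {1..n}"
  shows "mat_app p n A (unit_vec j) i = A i j"
proof
  fix k
  have "mat_app p n A (unit_vec j) i k = (\<Sum>l=1..n. if l = j then A i j k * (1 mod int p ^ k) else 0) mod int p ^ k"
    unfolding mat_app_nth[OF unit_vec_closed assms(2)]
    by (intro arg_cong2[of _ _ _ _ "(mod)"] sum.cong refl) (auto simp: unit_vec_def Zp_ops)
  also have "\<dots> = A i j k mod int p ^ k" using assms by (simp add: mod_simps)
  finally show "mat_app p n A (unit_vec j) i k = A i j k"
    using Zp_mod_self[OF entries[OF assms(2,1)]] by simp
qed

text \<open>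
  The image of a matrix is a module over the p-adic integers, but modulo \<open>p ^ N\<close> every scalar is an
  integer: there it is the group that the columns generate.
\<close>

lemma reduce_mat_image:
  assumes N: "N > 0"
  shows "reduce N n ` mat_image p n A = generate (Zmod_pow (int p ^ N) n) (column_residue N n A ` {1..n})"
    (is "_ = generate ?R ?C")
proof
  have q: "int p ^ N > 1" by (rule int_power_gt_1[OF p_gt_1 N])
  interpret R: comm_group ?R by (rule comm_group_Zmod_pow[OF q])
  interpret red: group_hom "Zn" ?R "reduce N n" by (rule reduce_hom[OF p_gt_1 N])
  have col: "column_residue N n A j \<in> carrier ?R" if "j \<in> {1..n}" for j
    unfolding column_residue_def reduce_def carrier_Zmod_pow
    using Zp_bounds[OF entries[OF _ that]] by auto
  have sub: "subgroup (generate ?R ?C) ?R" using col by (intro R.generate_is_subgroup) auto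
  show "reduce N n ` mat_image p n A \<subseteq> generate ?R ?C"
  proof
    fix r assume "r \<in> reduce N n ` mat_image p n A"
    then obtain v where v: "v \<in> carrier Zn" "r = reduce N n (mat_app p n A v)"
      by (auto simp: mat_image_eq)
    define f where "f j = column_residue N n A j [^]\<^bsub>?R\<^esub> nat (v j N)" for j
    have vj: "v j N \<ge> 0" if "j \<in> {1..n}" for j 
      using Zp_bounds[OF PiE_mem[OF v(1)[unfolded carrier_Zp_pow] that]] by simp
    have f: "f \<in> {1..n} \<rightarrow> carrier ?R" using col by (auto simp: f_def)
    have "r = finprod ?R f {1..n}"
    proof (rule PiE_ext[of _ "{1..n}" "\<lambda>_. {0..<int p ^ N}"])
      show "r \<in> PiE {1..n} (\<lambda>_. {0..<int p ^ N})"
        using reduce_closed[OF mat_app_closed[OF v(1)]] v(2) by (simp add: carrier_Zmod_pow)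
      show "finprod ?R f {1..n} \<in> PiE {1..n} (\<lambda>_. {0..<int p ^ N})"
        using R.finprod_closed[OF f] by (simp add: carrier_Zmod_pow)
      fix i assume i: "i \<in> {1..n}"
      have "f j i = A i j N * v j N mod int p ^ N" if "j \<in> {1..n}" for j
        unfolding f_def nat_pow_Zmod_pow[OF q col[OF that]]
        using i vj[OF that] by (simp add: column_residue_def reduce_def mult.commute)
      then have "finprod ?R f {1..n} i = (\<Sum>j=1..n. A i j N * v j N mod int p ^ N) mod int p ^ N"
        by (subst finprod_Zmod_pow[OF q _ f i]) simp_all
      also have "\<dots> = r i" using i by (simp add: v(2) reduce_def mat_app_nth[OF v(1)] mod_sum_eq)
      finally show "r i = finprod ?R f {1..n} i" by simp
    qed
    also have "\<dots> \<in> generate ?R ?C"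
    proof (rule R.finprod_in_subgroup[OF sub])
      show "f j \<in> generate ?R ?C" if "j \<in> {1..n}" for j
        unfolding f_def using that by (intro R.nat_pow_subgroup_closed[OF sub]) (auto intro: generate.incl)
    qed simp
    finally show "r \<in> generate ?R ?C" .
  qed
  show "generate ?R ?C \<subseteq> reduce N n ` mat_image p n A"
  proof (rule R.generate_subgroup_incl)
    show "subgroup (reduce N n ` mat_image p n A) ?R"
      by (rule red.subgroup_img_is_subgroup[OF subgroup_mat_image])
    show "?C \<subseteq> reduce N n ` mat_image p n A"
    proof clarify
      fix j assume j: "j \<in> {1..n}"
      have "column_residue N n A j = reduce N n (mat_app p n A (unit_vec j))"
        unfolding column_residue_def reduce_def
        by (intro restrict_ext) (simp add: mat_app_unit_vec[OF j])
      then show "column_residue N n A j \<in> reduce N n ` mat_image p n A"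
        using unit_vec_closed by (auto simp: mat_image_eq)
    qed
  qed
qed

end

section \<open>Cokernels isomorphic to a given group\<close>

lemma hom_finprod_comm_group:
  assumes "comm_group G" "comm_group H" "h \<in> hom G H" "f \<in> A \<rightarrow> carrier G"
  shows "h (finprod G f A) = finprod H (\<lambda>i. h (f i)) A"
proof -
  interpret G: comm_group G by fact
  interpret H: comm_group H by fact
  interpret h: group_hom G H h using assms(3) by unfold_locales
  show ?thesis
    using assms(4)
  proof (induction A rule: infinite_finite_induct)
    case (insert a A)
    then have f: "f \<in> A \<rightarrow> carrier G" "f a \<in> carrier G" by auto
    then have "(\<lambda>i. h (f i)) \<in> A \<rightarrow> carrier H" "h (f a) \<in> carrier H" by (auto simp: Pi_iff)
    with f show ?case using insert by simp
  qed simp_all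
qed

context torsion_module
begin

lemma eval_hom_comp:
  assumes "\<phi> \<in> hom G G" "g \<in> {1..n} \<rightarrow> carrier G" "\<And>i. i \<in> {1..n} \<Longrightarrow> g' i = \<phi> (g i)"
  shows "eval_hom n g' x = \<phi> (eval_hom n g x)"
proof -
  interpret \<phi>: group_hom G G \<phi> using assms(1) by unfold_locales
  have "\<phi> (eval_hom n g x) = finprod G (\<lambda>i. \<phi> (g i [^] x i)) {1..n}"
    unfolding eval_hom_def
    by (rule hom_finprod_comm_group[OF _ _ assms(1)]) (use assms(2) in \<open>auto simp: Pi_iff comm_group_axioms\<close>)
  also have "\<dots> = eval_hom n g' x"
    unfolding eval_hom_def
    by (rule finprod_cong') (use assms(2,3) in \<open>auto simp: Pi_iff \<phi>.hom_int_pow\<close>)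
  finally show ?thesis by simp
qed

lemma eval_hom_surj_iff:
  assumes "g \<in> {1..n} \<rightarrow> carrier G"
  shows "eval_hom n g ` carrier (Zmod_pow q n) = generate G (g ` {1..n})"
  using eval_hom_image_supported_on[OF assms order_refl] by (simp only: supported_on_all)

text \<open>
  Two surjections onto \<open>G\<close> with the same kernel differ by an automorphism of \<open>G\<close>.
\<close>

lemma hom_kernel_eq_imp_auto:
  assumes g: "g \<in> gen_tuples G {1..n} (carrier G)" "h \<in> gen_tuples G {1..n} (carrier G)"
    and ker: "hom_kernel n g = hom_kernel n h"
  shows "\<exists>\<phi>\<in>auto G. \<forall>i\<in>{1..n}. h i = \<phi> (g i)"
proof -
  let ?R = "Zmod_pow q n"
  have gC: "g \<in> {1..n} \<rightarrow> carrier G" "h \<in> {1..n} \<rightarrow> carrier G" using g by (auto simp: gen_tuples_def PiE_iff Pi_iff)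
  interpret R: comm_group ?R by (rule comm_group_Zmod_pow[OF q_gt_1])
  interpret g: group_hom ?R G "eval_hom n g" by (rule eval_hom_hom[OF gC(1)])
  interpret h: group_hom ?R G "eval_hom n h" by (rule eval_hom_hom[OF gC(2)])
  have surj: "eval_hom n g ` carrier ?R = carrier G" "eval_hom n h ` carrier ?R = carrier G"
    using g unfolding eval_hom_surj_iff[OF gC(1)] eval_hom_surj_iff[OF gC(2)] by (auto simp: gen_tuples_def)
  have eq: "eval_hom n g x = eval_hom n g y \<longleftrightarrow> eval_hom n h x = eval_hom n h y"
    if xy: "x \<in> carrier ?R" "y \<in> carrier ?R" for x y
  proof -
    have "eval_hom n f x = eval_hom n f y \<longleftrightarrow> x \<otimes>\<^bsub>?R\<^esub> inv\<^bsub>?R\<^esub> y \<in> hom_kernel n f"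
      if "f \<in> {1..n} \<rightarrow> carrier G" for f
    proof -
      interpret f: group_hom ?R G "eval_hom n f" by (rule eval_hom_hom[OF that])
      have "eval_hom n f (x \<otimes>\<^bsub>?R\<^esub> inv\<^bsub>?R\<^esub> y) = eval_hom n f x \<otimes> inv (eval_hom n f y)"
        using xy by simp
      then show ?thesis
        using xy inv_solve_right'[of "\<one>" "eval_hom n f x" "eval_hom n f y"] by (auto simp: hom_kernel_def)
    qed
    then show ?thesis using gC ker by simp
  qed
  define s where "s y = (SOME x. x \<in> carrier ?R \<and> eval_hom n g x = y)" for y
  have s: "s y \<in> carrier ?R \<and> eval_hom n g (s y) = y" if "y \<in> carrier G" for y
  proof -
    have "\<exists>x. x \<in> carrier ?R \<and> eval_hom n g x = y" using that surj(1) by (metis imageE)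
    then show ?thesis unfolding s_def by (rule someI_ex)
  qed
  define \<phi> where "\<phi> = (\<lambda>y\<in>carrier G. eval_hom n h (s y))"
  have \<phi>: "\<phi> (eval_hom n g x) = eval_hom n h x" if x: "x \<in> carrier ?R" for x
    using s[OF g.hom_closed[OF x]] eq[of "s (eval_hom n g x)" x] x by (simp add: \<phi>_def)
  have "\<phi> \<in> hom G G"
  proof (rule homI)
    fix y z assume yz: "y \<in> carrier G" "z \<in> carrier G"
    then show "\<phi> y \<in> carrier G" using s by (simp add: \<phi>_def)
    have "\<phi> (y \<otimes> z) = \<phi> (eval_hom n g (s y \<otimes>\<^bsub>?R\<^esub> s z))" using s yz by simp
    also have "\<dots> = eval_hom n h (s y \<otimes>\<^bsub>?R\<^esub> s z)" using s yz by (intro \<phi>) simp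
    also have "\<dots> = \<phi> y \<otimes> \<phi> z" using s yz by (simp add: \<phi>_def)
    finally show "\<phi> (y \<otimes> z) = \<phi> y \<otimes> \<phi> z" .
  qed
  moreover have "bij_betw \<phi> (carrier G) (carrier G)"
  proof (rule bij_betw_imageI)
    show "inj_on \<phi> (carrier G)"
    proof (rule inj_onI)
      fix y z assume yz: "y \<in> carrier G" "z \<in> carrier G" "\<phi> y = \<phi> z"
      then show "y = z" using s[OF yz(1)] s[OF yz(2)] eq[of "s y" "s z"] by (simp add: \<phi>_def)
    qed
    have "\<phi> ` carrier G = \<phi> ` eval_hom n g ` carrier ?R" by (simp only: surj(1))
    also have "\<dots> = eval_hom n h ` carrier ?R" using \<phi> by (simp add: image_image)
    finally show "\<phi> ` carrier G = carrier G" using surj(2) by simp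
  qed
  ultimately have "\<phi> \<in> auto G" by (auto simp: auto_def Bij_def \<phi>_def)
  moreover have "h i = \<phi> (g i)" if i: "i \<in> {1..n}" for i
  proof -
    let ?e = "\<lambda>k\<in>{1..n}. if k = i then 1 else (0::int)"
    have "?e \<in> carrier ?R" using q_gt_1 prime_gt_0_nat[OF prime_p] by (auto simp: carrier_Zmod_pow)
    from \<phi>[OF this] show ?thesis using eval_hom_unit[OF gC(1) i] eval_hom_unit[OF gC(2) i] by simp
  qed
  ultimately show ?thesis by blast
qed

text \<open>
  The automorphism group acts on the surjections with a given kernel, simply transitively: an
  automorphism is determined by its values on generators.
\<close>

lemma card_gen_tuples_same_kernel:
  assumes g: "g \<in> gen_tuples G {1..n} (carrier G)"
  shows "card {h \<in> gen_tuples G {1..n} (carrier G). hom_kernel n h = hom_kernel n g} = card (auto G)"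
proof -
  let ?R = "Zmod_pow q n"
  let ?T = "{h \<in> gen_tuples G {1..n} (carrier G). hom_kernel n h = hom_kernel n g}"
  define \<Psi> where "\<Psi> \<phi> = (\<lambda>i\<in>{1..n}. \<phi> (g i))" for \<phi> :: "'a \<Rightarrow> 'a"
  have gC: "g \<in> {1..n} \<rightarrow> carrier G" using g by (auto simp: gen_tuples_def PiE_iff Pi_iff)
  interpret g: group_hom ?R G "eval_hom n g" by (rule eval_hom_hom[OF gC])
  have surj: "eval_hom n g ` carrier ?R = carrier G"
    using g unfolding eval_hom_surj_iff[OF gC] by (auto simp: gen_tuples_def)
  have comp: "eval_hom n (\<Psi> \<phi>) x = \<phi> (eval_hom n g x)" if "\<phi> \<in> auto G" for \<phi> x
    using that by (intro eval_hom_comp[OF _ gC]) (auto simp: auto_def \<Psi>_def)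
  have "bij_betw \<Psi> (auto G) ?T"
  proof (rule bij_betw_imageI)
    show "inj_on \<Psi> (auto G)"
    proof (rule inj_onI)
      fix \<phi> \<psi> assume *: "\<phi> \<in> auto G" "\<psi> \<in> auto G" "\<Psi> \<phi> = \<Psi> \<psi>"
      show "\<phi> = \<psi>"
      proof (rule extensionalityI[of _ "carrier G"])
        fix y assume "y \<in> carrier G"
        then obtain x where "y = eval_hom n g x" using surj by (metis imageE)
        then show "\<phi> y = \<psi> y" using comp[OF *(1), of x] comp[OF *(2), of x] *(3) by simp
      qed (use * in \<open>auto simp: auto_def Bij_def\<close>)
    qed
    show "\<Psi> ` auto G = ?T"
    proof (rule equalityI; rule subsetI)
      fix h assume "h \<in> \<Psi> ` auto G"
      then obtain \<phi> where \<phi>: "\<phi> \<in> auto G" "h = \<Psi> \<phi>" by blast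
      have \<phi>h: "\<phi> \<in> hom G G" "bij_betw \<phi> (carrier G) (carrier G)" using \<phi>(1) by (auto simp: auto_def Bij_def)
      interpret \<phi>: group_hom G G \<phi> using \<phi>h(1) by unfold_locales
      have hP: "h \<in> PiE {1..n} (\<lambda>_. carrier G)" using gC unfolding \<phi>(2) \<Psi>_def by (auto simp: Pi_iff)
      then have hC: "h \<in> {1..n} \<rightarrow> carrier G" by auto
      have "generate G (h ` {1..n}) = eval_hom n h ` carrier ?R" using eval_hom_surj_iff[OF hC] by simp
      also have "\<dots> = \<phi> ` eval_hom n g ` carrier ?R" by (simp add: \<phi>(2) comp[OF \<phi>(1)] image_image)
      also have "\<dots> = carrier G" using surj \<phi>h(2) by (simp add: bij_betw_def)
      finally have 1: "h \<in> gen_tuples G {1..n} (carrier G)" using hP by (simp add: gen_tuples_def)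
      have "\<phi> y = \<one> \<longleftrightarrow> y = \<one>" if "y \<in> carrier G" for y
        using that \<phi>h(2) \<phi>.hom_one inj_onD[of \<phi> "carrier G" y \<one>] by (auto simp: bij_betw_def)
      then have "hom_kernel n h = hom_kernel n g"
        unfolding hom_kernel_def \<phi>(2) by (auto simp: comp[OF \<phi>(1)] eval_hom_closed[OF gC])
      then show "h \<in> ?T" using 1 by simp
    next
      fix h assume h: "h \<in> ?T"
      then obtain \<phi> where "\<phi> \<in> auto G" "\<forall>i\<in>{1..n}. h i = \<phi> (g i)"
        using hom_kernel_eq_imp_auto[OF g, of h] by auto
      moreover have "h \<in> extensional {1..n}" using h by (auto simp: gen_tuples_def PiE_iff)
      ultimately have "h = \<Psi> \<phi>" by (intro extensionalityI[of _ "{1..n}"]) (auto simp: \<Psi>_def)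
      then show "h \<in> \<Psi> ` auto G" using \<open>\<phi> \<in> auto G\<close> by blast
    qed
  qed
  from bij_betw_same_card[OF this] show ?thesis by (rule sym)
qed

end

locale padic_cokernel = torsion_module G p N + padic_square_matrix p n A
  for G (structure) and p N n :: nat and A :: padic_matrix
begin

definition lifted_kernel :: "(nat \<Rightarrow> 'a) \<Rightarrow> (nat \<Rightarrow> padic) set" where
  "lifted_kernel g = {x \<in> carrier (Zp_pow p n). eval_hom n g (reduce N n x) = \<one>}"

sublocale red: group_hom "Zp_pow p n" "Zmod_pow q n" "reduce N n"
  by (rule reduce_hom[OF p_gt_1 N_pos])

lemma reduce_lifted_kernel: "reduce N n ` lifted_kernel g = hom_kernel n g"
proof
  show "reduce N n ` lifted_kernel g \<subseteq> hom_kernel n g"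
    by (auto simp: lifted_kernel_def hom_kernel_def reduce_closed)
  show "hom_kernel n g \<subseteq> reduce N n ` lifted_kernel g"
  proof
    fix r assume r: "r \<in> hom_kernel n g"
    then obtain x where "x \<in> carrier Zn" "reduce N n x = r"
      using reduce_surj[OF p_pos, of r N n] by (auto simp: hom_kernel_def)
    then show "r \<in> reduce N n ` lifted_kernel g" using r by (force simp: lifted_kernel_def hom_kernel_def)
  qed
qed

lemma lifted_kernel_eq_iff: "lifted_kernel g = lifted_kernel h \<longleftrightarrow> hom_kernel n g = hom_kernel n h"
proof
  assume "lifted_kernel g = lifted_kernel h"
  then show "hom_kernel n g = hom_kernel n h" using reduce_lifted_kernel by metis
next
  have "lifted_kernel f = {x \<in> carrier Zn. reduce N n x \<in> hom_kernel n f}" for f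
    by (auto simp: lifted_kernel_def hom_kernel_def reduce_closed)
  moreover assume "hom_kernel n g = hom_kernel n h"
  ultimately show "lifted_kernel g = lifted_kernel h" by simp
qed

text \<open>
  Whether the image of \<open>A\<close> is the kernel of a given homomorphism to \<open>G\<close> can be read off from \<open>A\<close>
  modulo \<open>p ^ N\<close>.  An element of the kernel that agrees with an element of the image modulo \<open>p ^ N\<close>
  differs from it by \<open>p ^ N\<close> times some \<open>z\<close>, that is by \<open>p\<close> times \<open>p ^ (N - 1) * z\<close>, and the latter
  is in the kernel by the choice of \<open>N\<close>.  So Nakayama's lemma applies.
\<close>

lemma mat_image_eq_lifted_kernel_iff:
  assumes g: "g \<in> {1..n} \<rightarrow> carrier G"
  shows "mat_image p n A = lifted_kernel g \<longleftrightarrow>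
    generate (Zmod_pow q n) (column_residue N n A ` {1..n}) = hom_kernel n g"
proof
  assume "mat_image p n A = lifted_kernel g"
  then show "generate (Zmod_pow q n) (column_residue N n A ` {1..n}) = hom_kernel n g"
    using reduce_mat_image[OF N_pos] reduce_lifted_kernel by metis
next
  assume "generate (Zmod_pow q n) (column_residue N n A ` {1..n}) = hom_kernel n g"
  then have img: "reduce N n ` mat_image p n A = hom_kernel n g" using reduce_mat_image[OF N_pos] by simp
  interpret E: group_hom "Zmod_pow q n" G "eval_hom n g" by (rule eval_hom_hom[OF g])
  have sub: "mat_image p n A \<subseteq> carrier Zn" using subgroup.subset[OF subgroup_mat_image] .
  show "mat_image p n A = lifted_kernel g"
  proof
    show "mat_image p n A \<subseteq> lifted_kernel g"
    proof
      fix x assume x: "x \<in> mat_image p n A"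
      then have "reduce N n x \<in> hom_kernel n g" using img by blast
      then show "x \<in> lifted_kernel g" using x sub by (auto simp: lifted_kernel_def hom_kernel_def)
    qed
    show "lifted_kernel g \<subseteq> mat_image p n A"
    proof (rule nakayama_mat_image)
      show "lifted_kernel g \<subseteq> carrier Zn" by (auto simp: lifted_kernel_def)
      fix y assume y: "y \<in> lifted_kernel g"
      then have yC: "y \<in> carrier Zn" by (simp add: lifted_kernel_def)
      have "reduce N n y \<in> reduce N n ` mat_image p n A" using y img reduce_lifted_kernel by blast
      then obtain v where v: "v \<in> carrier Zn" "reduce N n y = reduce N n (mat_app p n A v)"
        by (auto simp: mat_image_eq)
      let ?w = "mat_app p n A v"
      have w: "?w \<in> carrier Zn" by (rule mat_app_closed[OF v(1)])
      have "reduce N n (y \<otimes>\<^bsub>Zn\<^esub> inv\<^bsub>Zn\<^esub> ?w) = \<one>\<^bsub>Zmod_pow q n\<^esub>"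
        using v(2) yC w by simp
      then obtain z where z: "z \<in> carrier Zn"
        "y \<otimes>\<^bsub>Zn\<^esub> inv\<^bsub>Zn\<^esub> ?w = z [^]\<^bsub>Zn\<^esub> (p ^ N)"
        using reduce_eq_one[OF p_pos _ ] yC w by (metis Z.inv_closed Z.m_closed)
      define z' where "z' = z [^]\<^bsub>Zn\<^esub> (p ^ (N - 1))"
      have "eval_hom n g (reduce N n z') = eval_hom n g (reduce N n z) [^] (p ^ (N - 1))"
        using z(1) by (simp add: z'_def red.hom_nat_pow E.hom_nat_pow reduce_closed)
      then have "eval_hom n g (reduce N n z') = \<one>" using exponent eval_hom_closed[OF g] by simp
      then have z': "z' \<in> lifted_kernel g" using z(1) by (simp add: lifted_kernel_def z'_def)
      have "z' [^]\<^bsub>Zn\<^esub> p = z [^]\<^bsub>Zn\<^esub> (p ^ N)"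
        using z(1) N_pos unfolding z'_def by (simp add: Z.nat_pow_pow power_eq_if mult.commute)
      then have "y = z' [^]\<^bsub>Zn\<^esub> p \<otimes>\<^bsub>Zn\<^esub> ?w"
        using z yC w Z.inv_solve_right by (metis Z.inv_closed Z.m_closed Z.inv_inv)
      then have "y = ?w \<otimes>\<^bsub>Zn\<^esub> z' [^]\<^bsub>Zn\<^esub> p"
        using z' w by (simp add: Z.m_comm lifted_kernel_def)
      then show "\<exists>v\<in>carrier Zn. \<exists>z\<in>lifted_kernel g. y = mat_app p n A v \<otimes>\<^bsub>Zn\<^esub> z [^]\<^bsub>Zn\<^esub> p"
        using v(1) z' by blast
    qed
  qed
qed

lemma mat_image_normal: "mat_image p n A \<lhd> Zn"
  using Z.subgroup_imp_normal[OF subgroup_mat_image] .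

text \<open>
  One direction is the first isomorphism theorem.  For the other, a homomorphism \<open>F\<close> from the whole
  p-adic module to \<open>G\<close> is determined by its values on unit vectors, although only the group structure
  is assumed to be respected: it kills all multiples of \<open>p ^ N\<close>, and modulo these every vector is an
  integer combination of unit vectors.
\<close>

lemma cok_iso_iff:
  "cok p n A \<cong> G \<longleftrightarrow> (\<exists>g\<in>gen_tuples G {1..n} (carrier G). mat_image p n A = lifted_kernel g)"
proof
  assume "\<exists>g\<in>gen_tuples G {1..n} (carrier G). mat_image p n A = lifted_kernel g"
  then obtain g where g: "g \<in> gen_tuples G {1..n} (carrier G)" "mat_image p n A = lifted_kernel g" by blast
  have gC: "g \<in> {1..n} \<rightarrow> carrier G" using g by (auto simp: gen_tuples_def PiE_iff Pi_iff)
  interpret E: group_hom "Zmod_pow q n" G "eval_hom n g" by (rule eval_hom_hom[OF gC])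
  let ?F = "\<lambda>x. eval_hom n g (reduce N n x)"
  interpret F: group_hom "Zn" G ?F
    by unfold_locales (auto simp: hom_def reduce_closed)
  have "?F ` carrier Zn = carrier G"
  proof
    show "carrier G \<subseteq> ?F ` carrier Zn"
    proof
      fix y assume "y \<in> carrier G"
      then have "y \<in> eval_hom n g ` carrier (Zmod_pow q n)"
        unfolding eval_hom_surj_iff[OF gC] using g(1) by (simp add: gen_tuples_def)
      then obtain r where r: "r \<in> carrier (Zmod_pow q n)" "y = eval_hom n g r" by blast
      obtain x where "x \<in> carrier Zn" "reduce N n x = r" using reduce_surj[OF p_pos r(1)] .
      then show "y \<in> ?F ` carrier Zn" using r(2) by blast
    qed
  qed (use F.hom_closed in auto)
  then have "(\<lambda>X. the_elem (?F ` X)) \<in> iso (Zn Mod kernel Zn G ?F) G"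
    by (rule F.FactGroup_iso_set)
  moreover have "kernel Zn G ?F = mat_image p n A"
    unfolding g(2) by (simp add: kernel_def lifted_kernel_def)
  ultimately show "cok p n A \<cong> G" by (auto simp: is_iso_def cok_def)
next
  assume "cok p n A \<cong> G"
  then obtain \<phi> where \<phi>: "\<phi> \<in> iso (Zn Mod mat_image p n A) G" by (auto simp: is_iso_def cok_def)
  interpret N: normal "mat_image p n A" "Zn" by (rule mat_image_normal)
  interpret Q: group "Zn Mod mat_image p n A" by (rule N.factorgroup_is_group)
  have \<phi>h: "\<phi> \<in> hom (Zn Mod mat_image p n A) G"
    and bij: "bij_betw \<phi> (carrier (Zn Mod mat_image p n A)) (carrier G)"
    using \<phi> by (auto simp: iso_def)
  interpret \<phi>: group_hom "Zn Mod mat_image p n A" G \<phi> using \<phi>h by unfold_locales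
  define F where "F x = \<phi> (mat_image p n A #>\<^bsub>Zn\<^esub> x)" for x
  have F: "F \<in> hom Zn G"
    using Group.hom_compose[OF N.r_coset_hom_Mod \<phi>h] by (simp add: F_def[abs_def] o_def)
  interpret F: group_hom "Zn" G F using F by unfold_locales
  have Fsurj: "F ` carrier Zn = carrier G"
  proof -
    have "carrier G = \<phi> ` (\<lambda>x. mat_image p n A #>\<^bsub>Zn\<^esub> x) ` carrier Zn"
      using bij by (auto simp: bij_betw_def FactGroup_def RCOSETS_def)
    then show ?thesis by (simp add: F_def image_image)
  qed
  have Fker: "F x = \<one> \<longleftrightarrow> x \<in> mat_image p n A" if x: "x \<in> carrier Zn" for x
  proof -
    have "F x = \<one> \<longleftrightarrow> mat_image p n A #>\<^bsub>Zn\<^esub> x = mat_image p n A"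
    proof
      assume "F x = \<one>"
      moreover have "mat_image p n A #>\<^bsub>Zn\<^esub> x \<in> carrier (Zn Mod mat_image p n A)"
        using x by (auto simp: FactGroup_def RCOSETS_def)
      moreover have "\<phi> (mat_image p n A) = \<one>" using \<phi>.hom_one by (simp add: FactGroup_def)
      moreover have "mat_image p n A \<in> carrier (Zn Mod mat_image p n A)"
        using Q.one_closed by (simp add: FactGroup_def)
      ultimately show "mat_image p n A #>\<^bsub>Zn\<^esub> x = mat_image p n A"
        using bij by (auto simp: F_def bij_betw_def inj_on_def)
    next
      assume "mat_image p n A #>\<^bsub>Zn\<^esub> x = mat_image p n A"
      then show "F x = \<one>" using \<phi>.hom_one by (simp add: F_def FactGroup_def)
    qed
    also have "\<dots> \<longleftrightarrow> x \<in> mat_image p n A"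
      using x Z.coset_join1[OF _ x subgroup_mat_image] Z.coset_join2[OF x subgroup_mat_image]
        N.subset by blast
    finally show ?thesis .
  qed
  define g where "g = (\<lambda>i\<in>{1..n}. F (unit_vec i))"
  have gP: "g \<in> PiE {1..n} (\<lambda>_. carrier G)" using unit_vec_closed by (auto simp: g_def)
  then have gC: "g \<in> {1..n} \<rightarrow> carrier G" by auto
  have Fg: "F x = eval_hom n g (reduce N n x)" if x: "x \<in> carrier Zn" for x
  proof -
    define f where "f i = unit_vec i [^]\<^bsub>Zn\<^esub> nat (x i N)" for i
    define y where "y = finprod Zn f {1..n}"
    have f: "f \<in> {1..n} \<rightarrow> carrier Zn" using unit_vec_closed by (auto simp: f_def)
    have yC: "y \<in> carrier Zn" unfolding y_def by (rule Z.finprod_closed[OF f])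
    have xN: "0 \<le> x i N \<and> x i N < q" if "i \<in> {1..n}" for i
      using Zp_bounds[OF PiE_mem[OF x[unfolded carrier_Zp_pow] that]] by simp
    have R: "comm_group (Zmod_pow q n)" by (rule comm_group_Zmod_pow[OF q_gt_1])
    have "reduce N n y = reduce N n x"
    proof (rule PiE_ext[of _ "{1..n}" "\<lambda>_. {0..<q}"])
      show "reduce N n y \<in> PiE {1..n} (\<lambda>_. {0..<q})" "reduce N n x \<in> PiE {1..n} (\<lambda>_. {0..<q})"
        using reduce_closed[OF yC] reduce_closed[OF x] by (auto simp: carrier_Zmod_pow)
      fix i assume i: "i \<in> {1..n}"
      have "reduce N n y i = finprod (Zmod_pow q n) (\<lambda>i. reduce N n (f i)) {1..n} i"
        unfolding y_def by (simp only: hom_finprod_comm_group[OF Z.comm_group_axioms R red.homh f])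
      also have "\<dots> = (\<Sum>j=1..n. reduce N n (f j) i) mod q"
        by (rule finprod_Zmod_pow[OF q_gt_1 _ _ i]) (use f reduce_closed in \<open>auto simp: Pi_iff\<close>)
      also have "\<dots> = (\<Sum>j=1..n. if j = i then x i N else 0) mod q"
      proof (intro arg_cong2[of _ _ _ _ "(mod)"] sum.cong refl)
        fix j assume j: "j \<in> {1..n}"
        show "reduce N n (f j) i = (if j = i then x i N else 0)"
        proof -
          have "reduce N n (f j) i = (int (nat (x j N)) * unit_vec j i N) mod q"
            unfolding f_def reduce_def using i nat_pow_Zp_pow[OF p_pos unit_vec_closed i] by simp
          then show ?thesis using i xN[OF j] q_gt_1 by (auto simp: unit_vec_def Zp_ops)
        qed
      qed
      also have "\<dots> = reduce N n x i" using i xN[OF i] by (simp add: reduce_def)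
      finally show "reduce N n y i = reduce N n x i" .
    qed
    then have "reduce N n (x \<otimes>\<^bsub>Zn\<^esub> inv\<^bsub>Zn\<^esub> y) = \<one>\<^bsub>Zmod_pow q n\<^esub>"
      using x yC by simp
    then obtain z where z: "z \<in> carrier Zn"
        "x \<otimes>\<^bsub>Zn\<^esub> inv\<^bsub>Zn\<^esub> y = z [^]\<^bsub>Zn\<^esub> (p ^ N)"
      using reduce_eq_one[OF p_pos _ ] yC x by (metis Z.inv_closed Z.m_closed)
    have "F x \<otimes> inv (F y) = F (z [^]\<^bsub>Zn\<^esub> (p ^ N))" using z x yC by (metis F.hom_inv F.hom_mult Z.inv_closed)
    also have "\<dots> = F z [^] (p ^ N)" using z by (simp add: F.hom_nat_pow)
    also have "\<dots> = \<one>" using pow_q[of "F z"] z by (metis F.hom_closed int_pow_int of_nat_power)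
    finally have "F x = F y" using x yC by (metis F.hom_closed inv_closed inv_equality inv_inv)
    also have "F y = finprod G (\<lambda>i. F (f i)) {1..n}"
      unfolding y_def by (rule hom_finprod_comm_group[OF Z.comm_group_axioms comm_group_axioms F f])
    also have "\<dots> = eval_hom n g (reduce N n x)"
      unfolding eval_hom_def
    proof (rule finprod_cong')
      fix i assume i: "i \<in> {1..n}"
      have "F (f i) = F (unit_vec i) [^] nat (x i N)" by (simp add: f_def F.hom_nat_pow unit_vec_closed)
      also have "\<dots> = F (unit_vec i) [^] x i N" using xN[OF i] by (metis int_nat_eq int_pow_int)
      finally show "F (f i) = g i [^] reduce N n x i" using i by (simp add: g_def reduce_def)
    qed (use gC in \<open>auto simp: Pi_iff\<close>)
    finally show ?thesis .
  qed
  have "generate G (g ` {1..n}) = carrier G"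
  proof
    show "generate G (g ` {1..n}) \<subseteq> carrier G" using gC by (intro generate_incl) auto
    show "carrier G \<subseteq> generate G (g ` {1..n})"
      unfolding eval_hom_surj_iff[OF gC, symmetric] Fsurj[symmetric] using Fg reduce_closed by blast
  qed
  then have "g \<in> gen_tuples G {1..n} (carrier G)" using gP by (simp add: gen_tuples_def)
  moreover have "mat_image p n A = lifted_kernel g"
    using Fker Fg N.subset by (auto simp: lifted_kernel_def)
  ultimately show "\<exists>g\<in>gen_tuples G {1..n} (carrier G). mat_image p n A = lifted_kernel g" by blast
qed

lemma card_presentations:
  "card {g \<in> gen_tuples G {1..n} (carrier G).
      generate (Zmod_pow q n) (column_residue N n A ` {1..n}) = hom_kernel n g} =
    (if cok p n A \<cong> G then card (auto G) else 0)"
proof -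
  have eq: "{g \<in> gen_tuples G {1..n} (carrier G).
      generate (Zmod_pow q n) (column_residue N n A ` {1..n}) = hom_kernel n g} =
     {g \<in> gen_tuples G {1..n} (carrier G). mat_image p n A = lifted_kernel g}"
  proof (rule Collect_cong, rule conj_cong[OF refl])
    fix g assume "g \<in> gen_tuples G {1..n} (carrier G)"
    then have "g \<in> {1..n} \<rightarrow> carrier G" by (auto simp: gen_tuples_def)
    then show "generate (Zmod_pow q n) (column_residue N n A ` {1..n}) = hom_kernel n g \<longleftrightarrow>
      mat_image p n A = lifted_kernel g"
      by (rule mat_image_eq_lifted_kernel_iff[symmetric])
  qed
  show ?thesis
  proof (cases "cok p n A \<cong> G")
    case True
    then obtain g where g: "g \<in> gen_tuples G {1..n} (carrier G)" "mat_image p n A = lifted_kernel g"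
      using cok_iso_iff by blast
    have "{g \<in> gen_tuples G {1..n} (carrier G). mat_image p n A = lifted_kernel g} =
      {h \<in> gen_tuples G {1..n} (carrier G). hom_kernel n h = hom_kernel n g}"
      unfolding g(2) lifted_kernel_eq_iff by auto
    then show ?thesis using True card_gen_tuples_same_kernel[OF g(1)] eq by simp
  next
    case False
    then have "{g \<in> gen_tuples G {1..n} (carrier G). mat_image p n A = lifted_kernel g} = {}"
      using cok_iso_iff by blast
    then show ?thesis using False unfolding eq by (simp only: card.empty if_False)
  qed
qed

end

section \<open>The law of the residues of a Haar-random matrix\<close>

lemma residue_class_in_borel_Zp: "{x \<in> carrier (Zp p). x N = a} \<in> sets (borel_Zp p)"
proof -
  have "open ((\<lambda>x::padic. x N) -` {a})"
    by (intro open_vimage discrete_topology_class.open_discrete continuous_on_product_coordinates)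
  then have "(\<lambda>x::padic. x N) -` {a} \<in> sets borel" by (rule borel_open)
  then have "carrier (Zp p) \<inter> (\<lambda>x::padic. x N) -` {a} \<in> sets (borel_Zp p)"
    unfolding borel_Zp_def sets_restrict_space by blast
  moreover have "carrier (Zp p) \<inter> (\<lambda>x::padic. x N) -` {a} = {x \<in> carrier (Zp p). x N = a}" by auto
  ultimately show ?thesis by simp
qed

lemma space_borel_Zp: "space (borel_Zp p) = carrier (Zp p)"
  by (simp add: borel_Zp_def space_restrict_space)

text \<open>
  The residue classes modulo \<open>p ^ N\<close> are translates of each other, hence equally likely.
\<close>

lemma haar_residue_prob:
  assumes p: "p > 0" and haar: "haar_prob_measure p \<mu>" and a: "a \<in> {0..<int p ^ N}"
  shows "measure \<mu> {x \<in> carrier (Zp p). x N = a} = 1 / real p ^ N"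
proof -
  interpret prob_space \<mu> using haar by (simp add: haar_prob_measure_def)
  interpret Zp: cring "Zp p" by (rule Zp_cring[OF p])
  have sets: "sets \<mu> = sets (borel_Zp p)" using haar by (simp add: haar_prob_measure_def)
  have space: "space \<mu> = carrier (Zp p)" using sets_eq_imp_space_eq[OF sets] by (simp add: space_borel_Zp)
  define B where "B a = {x \<in> carrier (Zp p). x N = a}" for a
  have B: "B a \<in> sets \<mu>" for a unfolding B_def sets by (rule residue_class_in_borel_Zp)
  have same: "measure \<mu> (B b) = measure \<mu> (B 0)" if b: "b \<in> {0..<int p ^ N}" for b
  proof -
    have l: "lift_Zp p b \<in> carrier (Zp p)" by (rule lift_Zp_closed[OF p])
    have lN: "lift_Zp p b N = b" using b by (simp add: lift_Zp_def)
    have "(\<lambda>x. lift_Zp p b \<oplus>\<^bsub>Zp p\<^esub> x) ` B 0 = B b"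
    proof (rule equalityI; rule subsetI)
      fix y assume "y \<in> (\<lambda>x. lift_Zp p b \<oplus>\<^bsub>Zp p\<^esub> x) ` B 0"
      then obtain x where x: "x \<in> carrier (Zp p)" "x N = 0" "y = lift_Zp p b \<oplus>\<^bsub>Zp p\<^esub> x" by (auto simp: B_def)
      then show "y \<in> B b" using l lN b by (simp add: B_def) (simp add: Zp_ops)
    next
      fix y assume y: "y \<in> B b"
      let ?x = "\<ominus>\<^bsub>Zp p\<^esub> lift_Zp p b \<oplus>\<^bsub>Zp p\<^esub> y"
      have yC: "y \<in> carrier (Zp p)" using y by (simp add: B_def)
      have xC: "?x \<in> carrier (Zp p)" using l yC by simp
      have e: "lift_Zp p b \<oplus>\<^bsub>Zp p\<^esub> ?x = y" using l yC by (simp only: Zp.r_neg2)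
      have "(lift_Zp p b \<oplus>\<^bsub>Zp p\<^esub> ?x) N = (b + ?x N) mod int p ^ N" unfolding Zp_ops(1)[of p "lift_Zp p b"] by (simp only: lN)
      then have "(b + ?x N) mod int p ^ N = b mod int p ^ N" using e y b by (simp add: B_def)
      then have "int p ^ N dvd ?x N" by (metis add_diff_cancel_left' mod_eq_dvd_iff)
      then have "?x N = 0" using Zp_bounds[OF xC, of N] by (metis dvd_imp_mod_0 mod_pos_pos_trivial)
      then have "?x \<in> B 0" using xC by (simp add: B_def)
      then show "y \<in> (\<lambda>x. lift_Zp p b \<oplus>\<^bsub>Zp p\<^esub> x) ` B 0" using e by (metis imageI)
    qed
    then have "emeasure \<mu> (B b) = emeasure \<mu> (B 0)"
      using haar l B unfolding haar_prob_measure_def by metis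
    then show ?thesis by (simp add: measure_def)
  qed
  have "1 = measure \<mu> (\<Union>b\<in>{0..<int p ^ N}. B b)"
  proof -
    have "(\<Union>b\<in>{0..<int p ^ N}. B b) = space \<mu>"
      unfolding space B_def using Zp_bounds by auto
    then show ?thesis by (simp add: prob_space)
  qed
  also have "\<dots> = (\<Sum>b\<in>{0..<int p ^ N}. measure \<mu> (B b))"
    using B by (intro finite_measure_finite_Union) (auto simp: disjoint_family_on_def B_def)
  also have "\<dots> = (\<Sum>b\<in>{0..<int p ^ N}. measure \<mu> (B 0))" by (intro sum.cong refl same)
  also have "\<dots> = real p ^ N * measure \<mu> (B 0)" by (simp add: nat_power_eq)
  finally have "measure \<mu> (B 0) = 1 / real p ^ N" using p by (simp add: field_simps)
  then show ?thesis using same[OF a] by (simp add: B_def)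
qed

definition residue_columns :: "nat \<Rightarrow> nat \<Rightarrow> padic_matrix \<Rightarrow> nat \<Rightarrow> nat \<Rightarrow> int" where
  "residue_columns N n A = (\<lambda>j\<in>{1..n}. column_residue N n A j)"

lemma haar_random_matrix_entries:
  assumes X: "haar_random_matrix p n \<sigma> M X" and p: "p > 0" 
    and w: "w \<in> space M" and ij: "i \<in> {1..n}" "j \<in> {1..n}"
  shows "X w i j \<in> carrier (Zp p)" and "i \<notin> \<sigma> j \<Longrightarrow> X w i j = \<zero>\<^bsub>Zp p\<^esub>"
proof -
  interpret Zp: cring "Zp p" by (rule Zp_cring[OF p])
  show zero: "i \<notin> \<sigma> j \<Longrightarrow> X w i j = \<zero>\<^bsub>Zp p\<^esub>" using X w ij by (auto simp: haar_random_matrix_def)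
  have "X w i j \<in> carrier (Zp p)" if "i \<in> \<sigma> j"
  proof -
    have "(\<lambda>w. X w i j) \<in> measurable M (borel_Zp p)"
      using X ij that by (auto simp: haar_random_matrix_def haar_random_def)
    from measurable_space[OF this w] show ?thesis by (simp add: space_borel_Zp)
  qed
  then show "X w i j \<in> carrier (Zp p)" using zero Zp.zero_closed by (cases "i \<in> \<sigma> j") auto
qed

lemma residue_columns_in_PiE:
  assumes X: "haar_random_matrix p n \<sigma> M X" and p: "p > 0" and w: "w \<in> space M"
  shows "residue_columns N n (X w) \<in> PiE {1..n} (\<lambda>j. supported_on (int p ^ N) n (\<sigma> j))"
proof -
  have "column_residue N n (X w) j \<in> supported_on (int p ^ N) n (\<sigma> j)" if j: "j \<in> {1..n}" for j
    using Zp_bounds[OF haar_random_matrix_entries(1)[OF X p w _ j], of _ N]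
      haar_random_matrix_entries(2)[OF X p w _ j]
    by (auto simp: supported_on_def column_residue_def reduce_def carrier_Zmod_pow Zp_ops)
  then show ?thesis by (auto simp: residue_columns_def)
qed

lemma prob_residue_columns_eq:
  assumes M: "prob_space M" and X: "haar_random_matrix p n \<sigma> M X" and p: "p > 0"
    and \<sigma>: "\<And>j. j \<in> {1..n} \<Longrightarrow> \<sigma> j \<subseteq> {1..n}"
    and x: "x \<in> PiE {1..n} (\<lambda>j. supported_on (int p ^ N) n (\<sigma> j))"
  shows "{w \<in> space M. residue_columns N n (X w) = x} \<in> sets M"
    and "measure M {w \<in> space M. residue_columns N n (X w) = x} = 1 / (\<Prod>j=1..n. real (p ^ N) ^ card (\<sigma> j))"
proof -
  interpret prob_space M by fact
  define I where "I = {(i, j). j \<in> {1..n} \<and> i \<in> \<sigma> j}"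
  define Y where "Y = (\<lambda>(i, j) w. X w i j)"
  define B where "B = (\<lambda>(i, j). {z \<in> carrier (Zp p). z N = x j i})"
  have I_swap: "I = prod.swap ` (SIGMA j:{1..n}. \<sigma> j)" by (force simp: I_def)
  have fin\<sigma>: "finite (\<sigma> j)" if "j \<in> {1..n}" for j using \<sigma>[OF that] finite_subset by blast
  then have fI: "finite I" unfolding I_swap by (intro finite_imageI finite_SigmaI) auto
  have meas: "Y ij \<in> measurable M (borel_Zp p)" if "ij \<in> I" for ij
    using X that by (auto simp: haar_random_matrix_def haar_random_def I_def Y_def)
  have B: "B ij \<in> sets (borel_Zp p)" for ij
    unfolding B_def using residue_class_in_borel_Zp by (simp split: prod.split)
  have xj: "x j \<in> supported_on (int p ^ N) n (\<sigma> j)" if "j \<in> {1..n}" for j using x that by auto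
  have event: "{w \<in> space M. residue_columns N n (X w) = x} = {w \<in> space M. \<forall>ij\<in>I. Y ij w \<in> B ij}"
  proof (rule Collect_cong, rule conj_cong[OF refl])
    fix w assume w: "w \<in> space M"
    note ent = haar_random_matrix_entries[OF X p w]
    have "residue_columns N n (X w) = x \<longleftrightarrow> (\<forall>j\<in>{1..n}. \<forall>i\<in>{1..n}. X w i j N = x j i)"
    proof
      assume e: "residue_columns N n (X w) = x"
      show "\<forall>j\<in>{1..n}. \<forall>i\<in>{1..n}. X w i j N = x j i"
        unfolding e[symmetric] by (simp add: residue_columns_def column_residue_def reduce_def)
    next
      assume e: "\<forall>j\<in>{1..n}. \<forall>i\<in>{1..n}. X w i j N = x j i"
      show "residue_columns N n (X w) = x"
      proof (rule PiE_ext[OF residue_columns_in_PiE[OF X p w] x])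
        fix j assume j: "j \<in> {1..n}"
        show "residue_columns N n (X w) j = x j"
          using e j xj[OF j] by (intro PiE_ext[of _ "{1..n}" "\<lambda>_. UNIV"])
            (auto simp: residue_columns_def column_residue_def reduce_def supported_on_def carrier_Zmod_pow PiE_iff)
      qed
    qed
    also have "\<dots> \<longleftrightarrow> (\<forall>j\<in>{1..n}. \<forall>i\<in>\<sigma> j. X w i j N = x j i)"
    proof -
      have "X w i j N = x j i" if "j \<in> {1..n}" "i \<in> {1..n}" "i \<notin> \<sigma> j" for i j
        using ent(2)[OF that(2,1,3)] xj[OF that(1)] that by (simp add: Zp_ops supported_on_def)
      then show ?thesis using \<sigma> by blast
    qed
    also have "\<dots> \<longleftrightarrow> (\<forall>ij\<in>I. Y ij w \<in> B ij)"
      using ent(1) \<sigma> unfolding I_def Y_def B_def by fast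
    finally show "residue_columns N n (X w) = x \<longleftrightarrow> (\<forall>ij\<in>I. Y ij w \<in> B ij)" .
  qed
  have each: "prob (Y ij -` B ij \<inter> space M) = 1 / real p ^ N" if ij: "ij \<in> I" for ij
  proof -
    obtain i j where eq: "ij = (i, j)" by (cases ij)
    have hr: "haar_random p M (\<lambda>w. X w i j)" using X ij unfolding eq by (simp add: haar_random_matrix_def I_def)
    have "j \<in> {1..n}" "i \<in> \<sigma> j" using ij unfolding eq I_def by auto
    then have "i \<in> {1..n}" "j \<in> {1..n}" using \<sigma>[of j] by auto
    then have "x j i \<in> {0..<int p ^ N}" using xj[of j] by (auto simp: supported_on_def carrier_Zmod_pow)
    then have "measure (distr M (borel_Zp p) (Y ij)) (B ij) = 1 / real p ^ N"
      using haar_residue_prob[OF p] hr unfolding haar_random_def eq Y_def B_def by simp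
    then show ?thesis using measure_distr[OF meas[OF ij] B] by simp
  qed
  show "{w \<in> space M. residue_columns N n (X w) = x} \<in> sets M"
  proof -
    have "{w \<in> space M. \<forall>ij\<in>I. Y ij w \<in> B ij} = space M \<inter> (\<Inter>ij\<in>I. Y ij -` B ij \<inter> space M)" by auto
    also have "\<dots> \<in> sets M"
    proof (cases "I = {}")
      case False
      then show ?thesis
        by (intro sets.Int sets.top sets.finite_INT[OF fI] measurable_sets[OF meas B])
    qed simp
    finally show ?thesis using event by simp
  qed
  have "measure M {w \<in> space M. \<forall>ij\<in>I. Y ij w \<in> B ij} = (1 / real p ^ N) ^ card I"
  proof (cases "I = {}")
    case True
    then show ?thesis by (simp add: prob_space)
  next
    case False
    have "{w \<in> space M. \<forall>ij\<in>I. Y ij w \<in> B ij} = (\<Inter>ij\<in>I. Y ij -` B ij \<inter> space M)" using False by auto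
    also have "prob \<dots> = (\<Prod>ij\<in>I. prob (Y ij -` B ij \<inter> space M))"
      using X B False fI unfolding haar_random_matrix_def
      by (intro indep_varsD_finite[where M' = "\<lambda>_. borel_Zp p"]) (auto simp: I_def Y_def)
    also have "\<dots> = (\<Prod>ij\<in>I. 1 / real p ^ N)" by (intro prod.cong refl each)
    finally show ?thesis by simp
  qed
  also have "card I = (\<Sum>j=1..n. card (\<sigma> j))"
    unfolding I_swap using fin\<sigma> by (subst card_image) auto
  also have "(1 / real p ^ N) ^ (\<Sum>j=1..n. card (\<sigma> j)) = 1 / (\<Prod>j=1..n. real (p ^ N) ^ card (\<sigma> j))"
    by (simp add: power_sum power_divide prod_dividef)
  finally show "measure M {w \<in> space M. residue_columns N n (X w) = x} = 1 / (\<Prod>j=1..n. real (p ^ N) ^ card (\<sigma> j))"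
    using event by simp
qed

lemma prob_residue_columns_in:
  assumes M: "prob_space M" and X: "haar_random_matrix p n \<sigma> M X" and p: "p > 0"
    and \<sigma>: "\<And>j. j \<in> {1..n} \<Longrightarrow> \<sigma> j \<subseteq> {1..n}"
    and T: "T \<subseteq> PiE {1..n} (\<lambda>j. supported_on (int p ^ N) n (\<sigma> j))"
  shows "measure M {w \<in> space M. residue_columns N n (X w) \<in> T} = real (card T) / (\<Prod>j=1..n. real (p ^ N) ^ card (\<sigma> j))"
proof -
  interpret prob_space M by fact
  have fT: "finite T" by (rule finite_subset[OF T]) (intro finite_PiE finite_supported_on finite_atLeastAtMost)
  have "{w \<in> space M. residue_columns N n (X w) \<in> T} = (\<Union>x\<in>T. {w \<in> space M. residue_columns N n (X w) = x})" by auto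
  also have "prob \<dots> = (\<Sum>x\<in>T. prob {w \<in> space M. residue_columns N n (X w) = x})"
    using prob_residue_columns_eq(1)[OF M X p \<sigma>] T fT
    by (intro finite_measure_finite_Union) (auto simp: disjoint_family_on_def)
  also have "\<dots> = (\<Sum>x\<in>T. 1 / (\<Prod>j=1..n. real (p ^ N) ^ card (\<sigma> j)))"
    using T by (intro sum.cong refl prob_residue_columns_eq(2)[OF M X p \<sigma>]) auto
  finally show ?thesis by simp
qed

section \<open>The law of the cokernel\<close>

lemma (in group) auto_card_pos: "finite (carrier G) \<Longrightarrow> card (auto G) > 0"
proof -
  assume fin: "finite (carrier G)"
  have "auto G \<subseteq> PiE (carrier G) (\<lambda>_. carrier G)"
    by (auto simp: auto_def Bij_def hom_def PiE_def)
  then have "finite (auto G)" using fin finite_PiE finite_subset by metis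
  then show ?thesis using id_in_auto by (auto simp: card_gt_0_iff)
qed

text \<open>
  An exact formula for the law of the cokernel, from counting in two ways the pairs of a generating
  tuple \<open>g\<close> and of a tuple of columns that generates the kernel of \<open>g\<close>.  Each tuple of columns
  whose cokernel is isomorphic to \<open>G\<close> occurs with \<open>card (auto G)\<close> tuples \<open>g\<close>
  (\<open>card_presentations\<close>), and the number of columns for a given \<open>g\<close> is known from
  \<open>card_columns_generating_kernel\<close>.
\<close>

lemma (in torsion_module) cok_law:
  assumes fin: "finite (carrier G)" and M: "prob_space M" and X: "haar_random_matrix p n \<sigma> M X"
    and \<sigma>: "\<And>j. j \<in> {1..n} \<Longrightarrow> \<sigma> j \<subseteq> {1..n}"
    and mono: "\<And>i j. 1 \<le> i \<Longrightarrow> i \<le> j \<Longrightarrow> j \<le> n \<Longrightarrow> \<sigma> i \<subseteq> \<sigma> j"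
  shows "measure M {w \<in> space M. cok p n (X w) \<cong> G} =
    nonsingular_prob p (\<lambda>j. card (\<sigma> j)) n * surj_moment G \<sigma> n / card (auto G)"
proof -
  have p0: "p > 0" "p > 1" using prime_gt_0_nat[OF prime_p] prime_gt_1_nat[OF prime_p] by auto
  let ?R = "Zmod_pow q n"
  define \<Omega> where "\<Omega> = PiE {1..n} (\<lambda>j. supported_on q n (\<sigma> j))"
  define V where "V = gen_tuples G {1..n} (carrier G)"
  define T where "T g = {x \<in> \<Omega>. generate ?R (x ` {1..n}) = hom_kernel n g}" for g
  define E where "E = {x \<in> \<Omega>. \<exists>g\<in>V. x \<in> T g}"
  define D where "D = (\<Prod>j=1..n. real (p ^ N) ^ card (\<sigma> j))"
  have D0: "D > 0" unfolding D_def using p0 by (intro prod_pos) auto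
  have aut: "card (auto G) > 0" by (rule auto_card_pos[OF fin])
  have f\<Omega>: "finite \<Omega>" unfolding \<Omega>_def by (intro finite_PiE finite_supported_on finite_atLeastAtMost)
  have fV: "finite V" unfolding V_def gen_tuples_def
    using finite_PiE[of "{1..n}" "\<lambda>_. carrier G"] fin by (auto intro: rev_finite_subset)
  have pres: "card {g \<in> V. residue_columns N n A \<in> T g} = (if cok p n A \<cong> G then card (auto G) else 0)"
    if A: "\<And>i j. i \<in> {1..n} \<Longrightarrow> j \<in> {1..n} \<Longrightarrow> A i j \<in> carrier (Zp p)" and "residue_columns N n A \<in> \<Omega>" for A
  proof -
    interpret padic_cokernel G p N n A using p0 A by unfold_locales auto
    have "residue_columns N n A ` {1..n} = column_residue N n A ` {1..n}"
      by (auto simp: residue_columns_def)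
    then show ?thesis using card_presentations that(2) by (simp add: V_def T_def)
  qed
  have "{w \<in> space M. cok p n (X w) \<cong> G} = {w \<in> space M. residue_columns N n (X w) \<in> E}"
  proof (rule Collect_cong, rule conj_cong[OF refl])
    fix w assume w: "w \<in> space M"
    have in\<Omega>: "residue_columns N n (X w) \<in> \<Omega>" unfolding \<Omega>_def by (rule residue_columns_in_PiE[OF X p0(1) w])
    have "cok p n (X w) \<cong> G \<longleftrightarrow> card {g \<in> V. residue_columns N n (X w) \<in> T g} \<noteq> 0"
      using pres[OF haar_random_matrix_entries(1)[OF X p0(1) w] in\<Omega>] aut by simp
    also have "\<dots> \<longleftrightarrow> residue_columns N n (X w) \<in> E" using in\<Omega> fV by (auto simp: E_def)
    finally show "cok p n (X w) \<cong> G \<longleftrightarrow> residue_columns N n (X w) \<in> E" .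
  qed
  then have 1: "measure M {w \<in> space M. cok p n (X w) \<cong> G} = real (card E) / D"
    using prob_residue_columns_in[OF M X p0(1) \<sigma>, of E N] by (simp add: D_def E_def \<Omega>_def)
  have cnt: "card {g \<in> V. x \<in> T g} = (if x \<in> E then card (auto G) else 0)" if x: "x \<in> \<Omega>" for x
  proof -
    \<comment> \<open>Every tuple of columns is the reduction of some matrix, to which \<open>pres\<close> applies.\<close>
    define A where "A i j = lift_Zp p (x j i)" for i j
    have xj: "x j \<in> PiE {1..n} (\<lambda>_. {0..<q})" if "j \<in> {1..n}" for j
      using x that by (auto simp: \<Omega>_def supported_on_def carrier_Zmod_pow)
    have "residue_columns N n A = x"
    proof (rule extensionalityI[of _ "{1..n}"])
      fix j assume j: "j \<in> {1..n}"
      show "residue_columns N n A j = x j"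
        using j xj[OF j] by (intro extensionalityI[of _ "{1..n}"])
          (auto simp: residue_columns_def column_residue_def reduce_def A_def lift_Zp_def PiE_iff)
    qed (use x in \<open>auto simp: residue_columns_def \<Omega>_def PiE_iff\<close>)
    then have "card {g \<in> V. x \<in> T g} = (if cok p n A \<cong> G then card (auto G) else 0)"
      using pres[of A] lift_Zp_closed[OF p0(1)] x by (simp add: A_def)
    moreover have "x \<in> E \<longleftrightarrow> card {g \<in> V. x \<in> T g} \<noteq> 0" using x fV by (auto simp: E_def)
    ultimately show ?thesis using aut by (auto split: if_splits)
  qed
  have "real (card (auto G) * card E) = (\<Sum>x\<in>\<Omega>. real (card {g \<in> V. x \<in> T g}))"
  proof -
    have "(\<Sum>x\<in>\<Omega>. real (card {g \<in> V. x \<in> T g})) = (\<Sum>x\<in>\<Omega>. if x \<in> E then real (card (auto G)) else 0)"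
      using cnt by (intro sum.cong refl) simp
    also have "\<dots> = (\<Sum>x\<in>\<Omega> \<inter> E. real (card (auto G)))" 
      using sum.inter_restrict[OF f\<Omega>, of "\<lambda>_. real (card (auto G))" E] by simp
    also have "\<Omega> \<inter> E = E" by (auto simp: E_def)
    finally show ?thesis by simp
  qed
  also have "\<dots> = (\<Sum>x\<in>\<Omega>. \<Sum>g\<in>V. if x \<in> T g then 1 else 0)"
    using fV by (intro sum.cong refl) (simp add: sum.If_cases Int_def)
  also have "\<dots> = (\<Sum>g\<in>V. \<Sum>x\<in>\<Omega>. if x \<in> T g then 1 else 0)" by (rule sum.swap)
  also have "\<dots> = (\<Sum>g\<in>V. real (card (T g)))"
    using f\<Omega> by (intro sum.cong refl) (auto simp: sum.If_cases Int_def T_def)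
  also have "\<dots> = (\<Sum>g\<in>V. D * (nonsingular_prob p (\<lambda>j. card (\<sigma> j)) n * gen_weight G \<sigma> n g))"
  proof (intro sum.cong refl)
    fix g assume "g \<in> V"
    then have "g \<in> {1..n} \<rightarrow> carrier G" by (auto simp: V_def gen_tuples_def)
    from card_columns_generating_kernel[OF this \<sigma> mono]
    show "real (card (T g)) = D * (nonsingular_prob p (\<lambda>j. card (\<sigma> j)) n * gen_weight G \<sigma> n g)"
      by (simp add: T_def \<Omega>_def D_def)
  qed
  also have "\<dots> = D * (nonsingular_prob p (\<lambda>j. card (\<sigma> j)) n * surj_moment G \<sigma> n)"
    by (simp add: surj_moment_def V_def sum_distrib_left)
  finally show ?thesis unfolding 1 using D0 aut by (simp add: field_simps)
qed

section \<open>Rank zero\<close>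

text \<open>
  The trivial group as a group on \<open>nat\<close>, the type of the groups that \<open>converges_to_CL\<close> ranges over.
\<close>

definition one_element_group :: "nat monoid" where
  "one_element_group = \<lparr>carrier = {0}, monoid.mult = (\<lambda>_ _. 0), one = 0\<rparr>"

lemma one_element_group_simps [simp]:
  "carrier one_element_group = {0}" "x \<otimes>\<^bsub>one_element_group\<^esub> y = 0" "\<one>\<^bsub>one_element_group\<^esub> = 0"
  by (simp_all add: one_element_group_def)

lemma comm_group_one_element_group: "comm_group one_element_group"
  by (rule comm_groupI) auto

lemma iso_trivial_group_iff:
  assumes "group H" "group K" "carrier K = {\<one>\<^bsub>K\<^esub>}"
  shows "H \<cong> K \<longleftrightarrow> carrier H = {\<one>\<^bsub>H\<^esub>}"
proof
  interpret H: group H by fact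
  assume "H \<cong> K"
  then obtain h where "bij_betw h (carrier H) {\<one>\<^bsub>K\<^esub>}" using assms(3) by (auto simp: is_iso_def iso_def)
  then have "card (carrier H) = 1" by (simp add: bij_betw_same_card)
  then obtain a where a: "carrier H = {a}" using card_1_singletonE by blast
  then show "carrier H = {\<one>\<^bsub>H\<^esub>}" using H.one_closed by simp
next
  interpret K: group K by fact
  assume "carrier H = {\<one>\<^bsub>H\<^esub>}"
  then have "(\<lambda>_. \<one>\<^bsub>K\<^esub>) \<in> iso H K" using assms(3) by (auto simp: iso_def hom_def bij_betw_def)
  then show "H \<cong> K" by (auto simp: is_iso_def)
qed

lemma iso_one_element_group_iff:
  "group H \<Longrightarrow> H \<cong> one_element_group \<longleftrightarrow> carrier H = {\<one>\<^bsub>H\<^esub>}"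
  using comm_group.axioms(2)[OF comm_group_one_element_group]
  by (intro iso_trivial_group_iff) auto

lemma iso_Fp_pow_zero_iff:
  "group H \<Longrightarrow> H \<cong> Fp_pow p 0 \<longleftrightarrow> carrier H = {\<one>\<^bsub>H\<^esub>}"
  by (intro iso_trivial_group_iff) (auto simp: Fp_pow_def intro!: product_group)

lemma (in comm_group) FactGroup_trivial_iff:
  assumes "subgroup N G"
  shows "carrier (G Mod N) = {\<one>\<^bsub>G Mod N\<^esub>} \<longleftrightarrow> N = carrier G"
proof
  assume triv: "carrier (G Mod N) = {\<one>\<^bsub>G Mod N\<^esub>}"
  have "x \<in> N" if x: "x \<in> carrier G" for x
  proof -
    have "N #> x \<in> carrier (G Mod N)" using x by (auto simp: FactGroup_def RCOSETS_def)
    then have "N #> x = N" using triv by (simp add: FactGroup_def)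
    then show ?thesis using coset_join1[OF _ x assms] subgroup.subset[OF assms] by blast
  qed
  then show "N = carrier G" using subgroup.subset[OF assms] by blast
next
  assume N: "N = carrier G"
  have "N #> x = N" if "x \<in> carrier G" for x using coset_join2[OF that assms] that N by simp
  then show "carrier (G Mod N) = {\<one>\<^bsub>G Mod N\<^esub>}"
    using one_closed by (auto simp: FactGroup_def RCOSETS_def)
qed

text \<open>
  A cokernel that is trivial modulo \<open>p\<close> is trivial, by Nakayama's lemma for the set of all vectors.
\<close>

lemma (in padic_square_matrix) mod_p_cok_trivial_iff:
  "mod_p p (cok p n A) \<cong> Fp_pow p 0 \<longleftrightarrow> cok p n A \<cong> one_element_group"
proof -
  let ?Z = "Zp_pow p n" and ?I = "mat_image p n A"
  interpret C: comm_group "cok p n A"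
    unfolding cok_def by (rule Z.abelian_FactGroup[OF subgroup_mat_image])
  interpret I: normal ?I ?Z by (rule Z.subgroup_imp_normal[OF subgroup_mat_image])
  interpret \<pi>: group_hom ?Z "cok p n A" "\<lambda>x. ?I #>\<^bsub>?Z\<^esub> x"
    using I.r_coset_hom_Mod C.group_axioms unfolding cok_def
    by (intro group_hom.intro group_hom_axioms.intro Z.group_axioms) auto
  let ?P = "(\<lambda>y. y [^]\<^bsub>cok p n A\<^esub> p) ` carrier (cok p n A)"
  have sP: "subgroup ?P (cok p n A)" by (rule C.subgroup_pow_image[OF C.subgroup_self])
  have carr: "carrier (cok p n A) = (\<lambda>x. ?I #>\<^bsub>?Z\<^esub> x) ` carrier ?Z"
    by (auto simp: cok_def FactGroup_def RCOSETS_def)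
  have "mod_p p (cok p n A) \<cong> Fp_pow p 0 \<longleftrightarrow> ?P = carrier (cok p n A)"
    unfolding mod_p_def
    by (simp only: iso_Fp_pow_zero_iff[OF comm_group.axioms(2)[OF C.abelian_FactGroup[OF sP]]]
        C.FactGroup_trivial_iff[OF sP])
  also have "\<dots> \<longleftrightarrow> ?I = carrier ?Z"
  proof
    assume P: "?P = carrier (cok p n A)"
    have "carrier ?Z \<subseteq> ?I"
    proof (rule nakayama_mat_image[OF order_refl])
      fix y assume y: "y \<in> carrier ?Z"
      then have "?I #>\<^bsub>?Z\<^esub> y \<in> ?P" unfolding P by (rule \<pi>.hom_closed)
      then obtain z where z: "z \<in> carrier ?Z" "?I #>\<^bsub>?Z\<^esub> y = (?I #>\<^bsub>?Z\<^esub> z) [^]\<^bsub>cok p n A\<^esub> p"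
        unfolding carr by auto
      then have "?I #>\<^bsub>?Z\<^esub> y = ?I #>\<^bsub>?Z\<^esub> (z [^]\<^bsub>?Z\<^esub> p)" by (simp add: \<pi>.hom_nat_pow)
      moreover have "y \<in> ?I #>\<^bsub>?Z\<^esub> y" by (rule Z.rcos_self[OF y subgroup_mat_image])
      ultimately obtain i where "i \<in> ?I" "y = i \<otimes>\<^bsub>?Z\<^esub> z [^]\<^bsub>?Z\<^esub> p" by (auto simp: r_coset_def)
      then show "\<exists>v\<in>carrier ?Z. \<exists>z\<in>carrier ?Z. y = mat_app p n A v \<otimes>\<^bsub>?Z\<^esub> z [^]\<^bsub>?Z\<^esub> p"
        using z by (auto simp: mat_image_eq)
    qed
    then show "?I = carrier ?Z" using I.subset by blast
  next
    assume "?I = carrier ?Z"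
    then have "carrier (cok p n A) = {\<one>\<^bsub>cok p n A\<^esub>}"
      using Z.FactGroup_trivial_iff[OF subgroup_mat_image] by (simp add: cok_def)
    then show "?P = carrier (cok p n A)" using C.nat_pow_one by auto
  qed
  also have "\<dots> \<longleftrightarrow> cok p n A \<cong> one_element_group"
    using iso_one_element_group_iff[OF C.group_axioms] Z.FactGroup_trivial_iff[OF subgroup_mat_image]
    by (simp add: cok_def)
  finally show ?thesis .
qed

lemma surj_moment_one_element_group:
  assumes "\<And>j. j \<in> {1..n} \<Longrightarrow> \<sigma> j \<subseteq> {1..n}"
  shows "surj_moment one_element_group \<sigma> n = 1"
proof -
  have gen: "generate one_element_group S = {0}" if "S \<subseteq> {0}" for S
  proof
    show "generate one_element_group S \<subseteq> {0}" 
      using group.generate_incl[OF comm_group.axioms(2)[OF comm_group_one_element_group], of S] that by simp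
    show "{0} \<subseteq> generate one_element_group S" using generate.one[of one_element_group S] by simp
  qed
  have "gen_tuples one_element_group {1..n} {0} = PiE {1..n} (\<lambda>_. {0})"
  proof -
    have "generate one_element_group (g ` {1..n}) = {0}" if "g \<in> PiE {1..n} (\<lambda>_. {0})" for g
      by (rule gen, rule image_subsetI, rule PiE_mem[OF that])
    then show ?thesis unfolding gen_tuples_def by blast
  qed
  also have "\<dots> = {\<lambda>i\<in>{1..n}. 0}" by (simp add: PiE_singleton)
  finally have V: "gen_tuples one_element_group {1..n} {0} = {\<lambda>i\<in>{1..n}. 0}" .
  have "generate one_element_group ((\<lambda>i\<in>{1..n}. 0) ` \<sigma> j) = {0}" if "j \<in> {1..n}" for j
    using assms[OF that] by (intro gen) auto
  then have "gen_weight one_element_group \<sigma> n (\<lambda>i\<in>{1..n}. 0) = 1"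
    unfolding gen_weight_def by (intro prod.neutral) simp
  then show ?thesis unfolding surj_moment_def one_element_group_simps V by simp
qed

lemma card_auto_one_element_group: "card (auto one_element_group) = 1"
proof -
  have "f = (\<lambda>x\<in>{0}. 0)" if "f \<in> auto one_element_group" for f
    using that by (intro extensionalityI[of _ "{0}"]) (auto simp: auto_def Bij_def hom_def)
  moreover have "(\<lambda>x\<in>{0}. 0) \<in> auto one_element_group"
    by (auto simp: auto_def Bij_def hom_def bij_betw_def)
  ultimately have "auto one_element_group = {\<lambda>x\<in>{0}. 0}" by blast
  then show ?thesis by simp
qed

section \<open>Convergence to the Cohen--Lenstra distribution\<close>

lemma CL_eq: "CL p G = euler_prod p / card (auto G)"
  by (simp add: CL_def euler_prod_def)

lemma cl_zero: "cl p 0 = euler_prod p"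
  by (simp add: cl_def euler_prod_def)

lemma finite_abelian_p_group_torsion_module:
  assumes "prime p" "finite_abelian_p_group p G" "order G = p ^ k"
  shows "torsion_module G p (Suc k)"
proof -
  interpret comm_group G using assms(2) by (simp add: finite_abelian_p_group_def)
  show ?thesis
    using assms pow_order_eq_1 by unfold_locales (auto simp: finite_abelian_p_group_def)
qed

lemma surj_moment_tendsto_1:
  fixes \<sigma> :: "nat \<Rightarrow> nat \<Rightarrow> nat set"
  assumes p: "prime p"
    and sub: "\<And>n j. n \<ge> 1 \<Longrightarrow> j \<in> {1..n} \<Longrightarrow> \<sigma> n j \<subseteq> {1..n}"
    and mono: "\<And>n i j. n \<ge> 1 \<Longrightarrow> 1 \<le> i \<Longrightarrow> i \<le> j \<Longrightarrow> j \<le> n \<Longrightarrow> \<sigma> n i \<subseteq> \<sigma> n j"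
    and G: "finite_abelian_p_group p G"
    and lim: "(\<lambda>n. nonsingular_prob p (\<lambda>j. card (\<sigma> n j)) n) \<longlonglongrightarrow> euler_prod p"
  shows "(\<lambda>n. surj_moment G (\<sigma> n) n) \<longlonglongrightarrow> 1"
proof -
  interpret comm_group G using G by (simp add: finite_abelian_p_group_def)
  from G obtain k where k: "order G = p ^ k" and fin: "finite (carrier G)" by (auto simp: finite_abelian_p_group_def)
  define C where "C = card {H. subgroup H G}"
  have p1: "p > 1" using prime_gt_1_nat[OF p] .
  have fin\<sigma>: "finite (\<sigma> n j)" if "j \<in> {1..n}" for n j
    using that sub[of n j] by (auto intro: finite_subset)
  have "\<exists>B. B \<longlonglongrightarrow> 1 \<and> (\<forall>\<^sub>F n in sequentially. (\<forall>j\<in>{1..n}. j \<le> card (\<sigma> n j)) \<and>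
     (\<Prod>i\<in>jumps (\<lambda>j. card (\<sigma> n j)) n. 1 + real C / real p ^ (card (\<sigma> n i) - i)) \<le> B n)"
  proof (rule jump_product_bound[where s = "\<lambda>n j. card (\<sigma> n j)", OF p1 _ _ lim])
    show "card (\<sigma> n i) \<le> card (\<sigma> n j)" if "1 \<le> i" "i \<le> j" "j \<le> n" for n i j
      using that mono[of n i j] fin\<sigma>[of j n] by (intro card_mono) auto
    show "card (\<sigma> n j) \<le> n" if "j \<in> {1..n}" for n j
      using that sub[of n j] card_mono[of "{1..n}" "\<sigma> n j"] by auto
  qed
  then obtain B where B: "B \<longlonglongrightarrow> 1"
    "\<forall>\<^sub>F n in sequentially. (\<forall>j\<in>{1..n}. j \<le> card (\<sigma> n j)) \<and>
     (\<Prod>i\<in>jumps (\<lambda>j. card (\<sigma> n j)) n. 1 + real C / real p ^ (card (\<sigma> n i) - i)) \<le> B n" by blast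
  show ?thesis
  proof (rule tendsto_sandwich[OF _ _ _ B(1)])
    have "(\<lambda>n. (1 / real p) ^ n) \<longlonglongrightarrow> 0" using p1 by (intro LIMSEQ_realpow_zero) auto
    then have "(\<lambda>n. 1 - real C * (1 / real p) ^ n) \<longlonglongrightarrow> 1 - real C * 0"
      by (intro tendsto_diff tendsto_mult tendsto_const)
    then show "(\<lambda>n. 1 - real C / real p ^ n) \<longlonglongrightarrow> 1" by (simp add: power_divide)
    show "\<forall>\<^sub>F n in sequentially. 1 - real C / real p ^ n \<le> surj_moment G (\<sigma> n) n"
      using eventually_ge_at_top[of 1]
    proof eventually_elim
      case (elim n)
      show ?case unfolding C_def by (rule surj_moment_ge[OF fin p k sub[OF elim]])
    qed
    show "\<forall>\<^sub>F n in sequentially. surj_moment G (\<sigma> n) n \<le> B n"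
      using B(2) eventually_ge_at_top[of 1]
    proof eventually_elim
      case (elim n)
      have "surj_moment G (\<sigma> n) n \<le> (\<Prod>i | i \<in> {1..<n} \<and> \<sigma> n (Suc i) \<noteq> \<sigma> n i.
         1 + real C / real p ^ (card (\<sigma> n i) - i))"
        unfolding C_def using elim(1) by (intro surj_moment_le[OF fin p k sub[OF elim(2)] mono[OF elim(2)] _ elim(2)]) auto
      also have "{i. i \<in> {1..<n} \<and> \<sigma> n (Suc i) \<noteq> \<sigma> n i} = jumps (\<lambda>j. card (\<sigma> n j)) n"
      proof -
        have "\<sigma> n (Suc i) \<noteq> \<sigma> n i \<longleftrightarrow> card (\<sigma> n (Suc i)) \<noteq> card (\<sigma> n i)" if "i \<in> {1..<n}" for i
          using that mono[OF elim(2), of i "Suc i"] fin\<sigma>[of "Suc i" n] card_subset_eq[of "\<sigma> n (Suc i)" "\<sigma> n i"] by auto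
        then show ?thesis by (auto simp: jumps_def)
      qed
      finally show ?case using elim(1) by linarith
    qed
  qed
qed

theorem theorem1p2:
  fixes p :: nat
    and \<sigma> :: "nat \<Rightarrow> nat \<Rightarrow> nat set"
    and M :: "nat \<Rightarrow> 'w measure"
    and X :: "nat \<Rightarrow> 'w \<Rightarrow> padic_matrix"
  assumes "prime p"
    and "\<And>n j. n \<ge> 1 \<Longrightarrow> j \<in> {1..n} \<Longrightarrow> \<sigma> n j \<subseteq> {1..n}"
    and "\<And>n i j. n \<ge> 1 \<Longrightarrow> 1 \<le> i \<Longrightarrow> i \<le> j \<Longrightarrow> j \<le> n \<Longrightarrow> \<sigma> n i \<subseteq> \<sigma> n j"
    and "\<And>n. n \<ge> 1 \<Longrightarrow> prob_space (M n)"
    and "\<And>n. n \<ge> 1 \<Longrightarrow> haar_random_matrix p n (\<sigma> n) (M n) (X n)"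
  shows "converges_to_CL p M (\<lambda>n w. cok p n (X n w)) \<longleftrightarrow>
         converges_to_CL_in_rank p 0 M (\<lambda>n w. cok p n (X n w))"
proof -
  define Q where "Q n = nonsingular_prob p (\<lambda>j. card (\<sigma> n j)) n" for n
  have p0: "p > 0" "p > 1" using prime_gt_0_nat[OF assms(1)] prime_gt_1_nat[OF assms(1)] by auto
  have law: "measure (M n) {w \<in> space (M n). cok p n (X n w) \<cong> G} = Q n * surj_moment G (\<sigma> n) n / card (auto G)"
    if n: "n \<ge> 1" and G: "finite_abelian_p_group p G" for n and G :: "nat monoid"
  proof -
    obtain k where k: "order G = p ^ k" and fin: "finite (carrier G)" using G by (auto simp: finite_abelian_p_group_def)
    interpret torsion_module G p "Suc k" by (rule finite_abelian_p_group_torsion_module[OF assms(1) G k])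
    show ?thesis
      unfolding Q_def by (rule cok_law[OF fin assms(4)[OF n] assms(5)[OF n] assms(2)[OF n] assms(3)[OF n]])
  qed
  have triv: "finite_abelian_p_group p one_element_group"
    using comm_group_one_element_group by (auto simp: finite_abelian_p_group_def order_def intro!: exI[of _ 0])
  have rank0: "measure (M n) {w \<in> space (M n). mod_p p (cok p n (X n w)) \<cong> Fp_pow p 0} = Q n" if n: "n \<ge> 1" for n
  proof -
    have "{w \<in> space (M n). mod_p p (cok p n (X n w)) \<cong> Fp_pow p 0} =
      {w \<in> space (M n). cok p n (X n w) \<cong> one_element_group}"
    proof (rule Collect_cong, rule conj_cong[OF refl])
      fix w assume w: "w \<in> space (M n)"
      interpret padic_square_matrix p n "X n w"
        using p0 haar_random_matrix_entries(1)[OF assms(5)[OF n] p0(1) w] by unfold_locales auto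
      show "mod_p p (cok p n (X n w)) \<cong> Fp_pow p 0 \<longleftrightarrow> cok p n (X n w) \<cong> one_element_group"
        by (rule mod_p_cok_trivial_iff)
    qed
    then show ?thesis
      using law[OF n triv] surj_moment_one_element_group[OF assms(2)[OF n]] card_auto_one_element_group by simp
  qed
  have rank0_iff: "converges_to_CL_in_rank p 0 M (\<lambda>n w. cok p n (X n w)) \<longleftrightarrow> Q \<longlonglongrightarrow> euler_prod p"
    unfolding converges_to_CL_in_rank_def cl_zero
    by (rule tendsto_cong, rule eventually_mono[OF eventually_ge_at_top[of 1] rank0])
  have law_iff: "(\<lambda>n. measure (M n) {w \<in> space (M n). cok p n (X n w) \<cong> G}) \<longlonglongrightarrow> CL p G \<longleftrightarrow>
      (\<lambda>n. Q n * surj_moment G (\<sigma> n) n / card (auto G)) \<longlonglongrightarrow> euler_prod p / card (auto G)"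
    if "finite_abelian_p_group p G" for G :: "nat monoid"
    unfolding CL_eq
    by (rule tendsto_cong, rule eventually_mono[OF eventually_ge_at_top[of 1]], rule law[OF _ that])
  show ?thesis
    unfolding rank0_iff
  proof
    assume "converges_to_CL p M (\<lambda>n w. cok p n (X n w))"
    then have "(\<lambda>n. Q n * surj_moment one_element_group (\<sigma> n) n / card (auto one_element_group))
        \<longlonglongrightarrow> euler_prod p / card (auto one_element_group)"
      using triv law_iff[OF triv] by (simp add: converges_to_CL_def)
    then have "(\<lambda>n. Q n * surj_moment one_element_group (\<sigma> n) n) \<longlonglongrightarrow> euler_prod p"
      by (simp add: card_auto_one_element_group)
    moreover have "\<forall>\<^sub>F n in sequentially. Q n * surj_moment one_element_group (\<sigma> n) n = Q n"
      using eventually_ge_at_top[of 1]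
    proof eventually_elim
      case (elim n)
      then show ?case using surj_moment_one_element_group[OF assms(2)[OF elim]] by simp
    qed
    ultimately show "Q \<longlonglongrightarrow> euler_prod p" by (rule Lim_transform_eventually)
  next
    assume Q: "Q \<longlonglongrightarrow> euler_prod p"
    show "converges_to_CL p M (\<lambda>n w. cok p n (X n w))"
      unfolding converges_to_CL_def
    proof (intro allI impI)
      fix G :: "nat monoid" assume G: "finite_abelian_p_group p G"
      have "(\<lambda>n. surj_moment G (\<sigma> n) n) \<longlonglongrightarrow> 1"
        by (rule surj_moment_tendsto_1[OF assms(1,2,3) G]) (use Q in \<open>simp_all add: Q_def[abs_def]\<close>)
      then have "(\<lambda>n. Q n * surj_moment G (\<sigma> n) n * (1 / card (auto G))) \<longlonglongrightarrow> euler_prod p * 1 * (1 / card (auto G))"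
        using Q by (intro tendsto_mult tendsto_const)
      then show "(\<lambda>n. measure (M n) {w \<in> space (M n). cok p n (X n w) \<cong> G}) \<longlonglongrightarrow> CL p G"
        unfolding law_iff[OF G] by simp
    qed
  qed
qed

end
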